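(* For any digraph $D$, $$\Xi_D(x;y)=\sum_S \operatorname{sgn}(\pi(S))\, f_{\pi(S)}(x,y)\,p_{\sigma(S)}(-y),$$ where the sum is over all path-cycle covers $S$ of the complement $D'$. Equivalently, $$\Xi_D(x;y)=\bigl[\omega_x\,\Xi_{D'}(x;-y)\bigr]_{x\to(x,y)}.$$
   Context: A digraph is a finite labelled directed graph without multiple edges, possibly with loops and with bidirected edges. The complement $D'$ of $D$ is the digraph on the same vertex set whose edges are precisely the ordered pairs $(i,j)$ of vertices (including $i=j$) that are not edges of $D$. A path-cycle cover of $D$ is a subset $S$ of the edges of $D$ no two of which share their initial vertex and no two of which share their terminal vertex; equivalently the spanning subgraph with edge set $S$ is a vertex-disjoint union of directed paths and directed cycles (isolated vertices are directed paths with no edges; loops are cycles of length one). $\pi(S)$ is the set of vertex sets of the directed paths and $\sigma(S)$ is the set of vertex sets of the directed cycles. $x=(x_1,x_2,\dots)$ and $y=(y_1,y_2,\dots)$ are two sets of commuting independent indeterminates. For an integer partition $\lambda$ with $r_i$ parts equal to $i$, the augmented monomial symmetric function is $\tilde m_\lambda=(r_1!\,r_2!\cdots)\,m_\lambda$; $p_\lambda$ is the power sum symmetric function. A set partition used as a subscript stands for its type (the integer partition of its block sizes). The path-cycle symmetric function is $$\Xi_D(x;y)=\sum_S\tilde m_{\pi(S)}(x)\,p_{\sigma(S)}(y),$$ the sum over all path-cycle covers $S$ of $D$. For a set or integer partition $\tau$, $\operatorname{sgn}\tau=(-1)^{|\tau|-\ell(\tau)}$, with $|\tau|$ the sum of the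 sizes of the parts and $\ell(\tau)$ the number of parts. $\omega$ is the usual involution on symmetric functions sending $e_\lambda$ to $h_\lambda$, and the forgotten symmetric functions are $f_\lambda=(\operatorname{sgn}\lambda)\,\omega(\tilde m_\lambda)$. $g(-y)$ is obtained from $g(y)$ by negating each variable; $f_\lambda(x,y)$ is $f_\lambda$ in the union of the $x$ and $y$ variables. $\omega_x$ means that $\omega$ is applied to $g(x;y)$ regarded as a symmetric function in $x$ with coefficients in the $y$'s. $[g(x;y)]_{x\to(x,y)}$ means that, treating $g$ as a symmetric function in the $x$'s with coefficients in the $y$'s, the set of $x$ variables is replaced by the union of the $x$ and $y$ variables; i.e. one applies the endomorphism of $\Lambda(x)\otimes\Lambda(y)$ sending $p_m(x)$ to $p_m(x)+p_m(y)$ and fixing each $p_n(y)$. *)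

theory Defs
  imports
    "HOL-Library.Poly_Mapping"
    "HOL-Library.Multiset"
    "HOL-Library.Nat_Bijection"
    "Graph_Theory.Pair_Digraph"
begin

section \<open>Formal power series in an arbitrary set of variables\<close>

text \<open>
  A monomial in variables from \<open>'v\<close> is a finitely supported exponent function
  \<open>'v \<Rightarrow>\<^sub>0 nat\<close>; a power series assigns a coefficient to every monomial.
\<close>

typedef ('v, 'a) mfps = "UNIV :: (('v \<Rightarrow>\<^sub>0 nat) \<Rightarrow> 'a) set"
  morphisms coeff Mfps ..

setup_lifting type_definition_mfps

lemma mfps_eqI: "(\<And>m. coeff f m = coeff g m) \<Longrightarrow> f = g"
  by (metis coeff_inverse ext)

lemma coeff_Mfps [simp]: "coeff (Mfps f) m = f m"
  by (simp add: Mfps_inverse)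

definition splits :: "('v \<Rightarrow>\<^sub>0 nat) \<Rightarrow> (('v \<Rightarrow>\<^sub>0 nat) \<times> ('v \<Rightarrow>\<^sub>0 nat)) set" where
  "splits m = {(a, b). a + b = m}"

lemma finite_bounded_monos:
  assumes "finite K"
  shows "finite {m :: 'v \<Rightarrow>\<^sub>0 nat. Poly_Mapping.keys m \<subseteq> K \<and> (\<forall>i. Poly_Mapping.lookup m i \<le> N)}"
    (is "finite ?M")
proof -
  have "finite {f. \<forall>i. (i \<in> K \<longrightarrow> f i \<in> {..N}) \<and> (i \<notin> K \<longrightarrow> f i = (0::nat))}" (is "finite ?F")
    by (rule finite_set_of_finite_funs) (auto simp: assms)
  moreover have "Poly_Mapping.lookup ` ?M \<subseteq> ?F"
    by (auto simp: in_keys_iff)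
  ultimately have "finite (Poly_Mapping.lookup ` ?M)"
    by (rule rev_finite_subset)
  moreover have "inj_on Poly_Mapping.lookup ?M"
    by (rule inj_onI) (simp only: lookup_inject)
  ultimately show ?thesis
    using finite_imageD by blast
qed

lemma lookup_le_degree:
  fixes m :: "'v \<Rightarrow>\<^sub>0 nat"
  shows "Poly_Mapping.lookup m i \<le> (\<Sum>j\<in>Poly_Mapping.keys m. Poly_Mapping.lookup m j)"
proof (cases "i \<in> Poly_Mapping.keys m")
  case True
  then show ?thesis
    by (intro member_le_sum[of i _ "Poly_Mapping.lookup m"]) auto
qed (simp add: in_keys_iff)

definition bounded_monos :: "('v \<Rightarrow>\<^sub>0 nat) \<Rightarrow> ('v \<Rightarrow>\<^sub>0 nat) set" where
  "bounded_monos m = {a. Poly_Mapping.keys a \<subseteq> Poly_Mapping.keys m \<and>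
     (\<forall>i. Poly_Mapping.lookup a i \<le> (\<Sum>j\<in>Poly_Mapping.keys m. Poly_Mapping.lookup m j))}"

lemma bounded_monosI:
  assumes le: "\<And>i. Poly_Mapping.lookup a i \<le> Poly_Mapping.lookup m i"
  shows "a \<in> bounded_monos m"
proof -
  have "i \<in> Poly_Mapping.keys m" if "i \<in> Poly_Mapping.keys a" for i
    using that le[of i] by (simp add: in_keys_iff)
  moreover have "Poly_Mapping.lookup a i \<le> (\<Sum>j\<in>Poly_Mapping.keys m. Poly_Mapping.lookup m j)" for i
    using le[of i] lookup_le_degree[of m i] by (rule order_trans)
  ultimately show ?thesis
    unfolding bounded_monos_def by (intro CollectI conjI subsetI allI)
qed

lemma finite_splits: "finite (splits m)"
proof -
  have "splits m \<subseteq> bounded_monos m \<times> bounded_monos m"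
  proof
    fix x assume "x \<in> splits m"
    then have "m = fst x + snd x"
      by (auto simp only: splits_def case_prod_unfold mem_Collect_eq)
    then have "fst x \<in> bounded_monos m" "snd x \<in> bounded_monos m"
      by (auto intro!: bounded_monosI simp only: Poly_Mapping.lookup_add le_add1 le_add2)
    then show "x \<in> bounded_monos m \<times> bounded_monos m"
      by (simp only: mem_Times_iff)
  qed
  moreover have "finite (bounded_monos m \<times> bounded_monos m)"
    unfolding bounded_monos_def
    by (intro finite_cartesian_product finite_bounded_monos finite_keys)
  ultimately show ?thesis
    by (rule finite_subset)
qed

instantiation mfps :: (type, comm_ring_1) comm_ring_1
begin

lift_definition zero_mfps :: "('a, 'b) mfps" is "\<lambda>_. 0" .
lift_definition one_mfps :: "('a, 'b) mfps" is "\<lambda>m. if m = 0 then 1 else 0" .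
lift_definition plus_mfps :: "('a, 'b) mfps \<Rightarrow> ('a, 'b) mfps \<Rightarrow> ('a, 'b) mfps"
  is "\<lambda>f g m. f m + g m" .
lift_definition minus_mfps :: "('a, 'b) mfps \<Rightarrow> ('a, 'b) mfps \<Rightarrow> ('a, 'b) mfps"
  is "\<lambda>f g m. f m - g m" .
lift_definition uminus_mfps :: "('a, 'b) mfps \<Rightarrow> ('a, 'b) mfps"
  is "\<lambda>f m. - f m" .
lift_definition times_mfps :: "('a, 'b) mfps \<Rightarrow> ('a, 'b) mfps \<Rightarrow> ('a, 'b) mfps"
  is "\<lambda>f g m. \<Sum>(a, b)\<in>splits m. f a * g b" .

instance
proof
  fix f g h :: "('a, 'b) mfps"
  show "f * g * h = f * (g * h)"
  proof (rule mfps_eqI)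
    fix m :: "'a \<Rightarrow>\<^sub>0 nat"
    let ?A = "SIGMA x:splits m. splits (fst x)"
    let ?B = "SIGMA x:splits m. splits (snd x)"
    have "coeff (f * g * h) m = (\<Sum>x\<in>splits m. \<Sum>y\<in>splits (fst x). coeff f (fst y) * coeff g (snd y) * coeff h (snd x))"
      by (simp add: times_mfps.rep_eq case_prod_unfold sum_distrib_right)
    also have "\<dots> = (\<Sum>(x, y)\<in>?A. coeff f (fst y) * coeff g (snd y) * coeff h (snd x))"
      by (subst sum.Sigma) (auto simp: finite_splits)
    also have "\<dots> = (\<Sum>(x, y)\<in>?B. coeff f (fst x) * (coeff g (fst y) * coeff h (snd y)))"
      by (rule sum.reindex_bij_witness
          [where i = "\<lambda>(x, y). ((fst x + fst y, snd y), (fst x, fst y))"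
             and j = "\<lambda>(x, y). ((fst y, snd y + snd x), (snd y, snd x))"])
        (auto simp: splits_def algebra_simps)
    also have "\<dots> = (\<Sum>x\<in>splits m. \<Sum>y\<in>splits (snd x). coeff f (fst x) * (coeff g (fst y) * coeff h (snd y)))"
      by (subst sum.Sigma) (auto simp: finite_splits)
    also have "\<dots> = coeff (f * (g * h)) m"
      by (simp add: times_mfps.rep_eq case_prod_unfold sum_distrib_left)
    finally show "coeff (f * g * h) m = coeff (f * (g * h)) m" .
  qed
  show "f * g = g * f"
  proof (rule mfps_eqI)
    fix m :: "'a \<Rightarrow>\<^sub>0 nat"
    have "(\<Sum>(a, b)\<in>splits m. coeff f a * coeff g b) = (\<Sum>(a, b)\<in>splits m. coeff g a * coeff f b)"
      by (rule sum.reindex_bij_witness[where i = prod.swap and j = prod.swap])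
        (auto simp: splits_def algebra_simps)
    then show "coeff (f * g) m = coeff (g * f) m"
      by (simp add: times_mfps.rep_eq)
  qed
  show "1 * f = f"
  proof (rule mfps_eqI)
    fix m :: "'a \<Rightarrow>\<^sub>0 nat"
    have "(\<Sum>(a, b)\<in>splits m. (if a = 0 then 1 else 0) * coeff f b)
        = (\<Sum>x\<in>splits m. if x = (0, m) then coeff f m else 0)"
    proof (rule sum.cong[OF refl])
      fix x assume "x \<in> splits m"
      then have "fst x + snd x = m"
        by (simp add: splits_def case_prod_unfold)
      then show "(case x of (a, b) \<Rightarrow> (if a = 0 then 1 else 0) * coeff f b) =
          (if x = (0, m) then coeff f m else 0)"
        by (cases x) auto
    qed
    also have "\<dots> = coeff f m"
    proof -
      have "(0, m) \<in> splits m"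
        by (simp add: splits_def)
      then show ?thesis
        by (simp only: sum.delta[OF finite_splits] if_True)
    qed
    finally have "(\<Sum>(a, b)\<in>splits m. (if a = 0 then 1 else 0) * coeff f b) = coeff f m" .
    then show "coeff (1 * f) m = coeff f m"
      by (simp add: times_mfps.rep_eq one_mfps.rep_eq)
  qed
  show "(f + g) * h = f * h + g * h"
    by (rule mfps_eqI)
      (simp add: times_mfps.rep_eq plus_mfps.rep_eq case_prod_unfold algebra_simps sum.distrib)
  show "f + g + h = f + (g + h)" "f + g = g + f" "0 + f = f" "- f + f = 0" "f - g = f + - g"
    by (transfer; simp add: fun_eq_iff algebra_simps)+
  show "(0::('a, 'b) mfps) \<noteq> 1"
    by transfer (metis zero_neq_one)
qed

end

definition const :: "'a::comm_ring_1 \<Rightarrow> ('v, 'a) mfps" where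
  "const c = Mfps (\<lambda>m. if m = 0 then c else 0)"

definition mono_degree :: "('v \<Rightarrow>\<^sub>0 nat) \<Rightarrow> nat" where
  "mono_degree m = (\<Sum>i\<in>Poly_Mapping.keys m. Poly_Mapping.lookup m i)"

definition exponents :: "('v \<Rightarrow>\<^sub>0 nat) \<Rightarrow> nat multiset" where
  "exponents m = image_mset (Poly_Mapping.lookup m) (mset_set (Poly_Mapping.keys m))"

definition rename_mono :: "('v \<Rightarrow> 'w) \<Rightarrow> ('v \<Rightarrow>\<^sub>0 nat) \<Rightarrow> ('w \<Rightarrow>\<^sub>0 nat)" where
  "rename_mono \<rho> m = (\<Sum>i\<in>Poly_Mapping.keys m. Poly_Mapping.single (\<rho> i) (Poly_Mapping.lookup m i))"

text \<open>
  Substitution of the variable \<open>\<rho> v\<close> for each variable \<open>v\<close>. It makes sense for all power series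
  when \<open>\<rho>\<close> has finite fibres (the sum below is then finite), and it is only used for such \<open>\<rho>\<close>.
\<close>

definition rename :: "('v \<Rightarrow> 'w) \<Rightarrow> ('v, 'a::comm_ring_1) mfps \<Rightarrow> ('w, 'a) mfps" where
  "rename \<rho> f = Mfps (\<lambda>m. \<Sum>m' | rename_mono \<rho> m' = m. coeff f m')"


lemma rename_mono_superset:
  assumes "finite K" "Poly_Mapping.keys m \<subseteq> K"
  shows "rename_mono \<rho> m = (\<Sum>i\<in>K. Poly_Mapping.single (\<rho> i) (Poly_Mapping.lookup m i))"
  unfolding rename_mono_def
  by (rule sum.mono_neutral_left) (use assms in \<open>auto simp: in_keys_iff\<close>)

lemma rename_mono_add: "rename_mono \<rho> (a + b) = rename_mono \<rho> a + rename_mono \<rho> b"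
proof -
  let ?K = "Poly_Mapping.keys a \<union> Poly_Mapping.keys b"
  have "Poly_Mapping.keys (a + b) \<subseteq> ?K"
    by (rule Poly_Mapping.keys_add)
  then show ?thesis
    by (simp add: rename_mono_superset[of ?K] Poly_Mapping.lookup_add single_add sum.distrib)
qed

lemma rename_mono_single [simp]:
  "rename_mono \<rho> (Poly_Mapping.single i n) = Poly_Mapping.single (\<rho> i) n"
  by (cases "n = 0") (auto simp: rename_mono_def)

lemma rename_mono_sum:
  "finite I \<Longrightarrow> rename_mono \<rho> (\<Sum>i\<in>I. t i) = (\<Sum>i\<in>I. rename_mono \<rho> (t i))"
  by (induction I rule: finite_induct) (auto simp: rename_mono_add, simp add: rename_mono_def)

lemma rename_mono_comp: "rename_mono \<tau> (rename_mono \<rho> m) = rename_mono (\<tau> \<circ> \<rho>) m"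
  by (subst (2) rename_mono_def) (simp add: rename_mono_sum, simp add: rename_mono_def)

lemma lookup_le_rename_mono:
  "Poly_Mapping.lookup m i \<le> Poly_Mapping.lookup (rename_mono \<rho> m) (\<rho> i)"
proof (cases "i \<in> Poly_Mapping.keys m")
  case True
  have "Poly_Mapping.lookup m i = Poly_Mapping.lookup (Poly_Mapping.single (\<rho> i) (Poly_Mapping.lookup m i)) (\<rho> i)"
    by simp
  also have "\<dots> \<le> (\<Sum>j\<in>Poly_Mapping.keys m.
      Poly_Mapping.lookup (Poly_Mapping.single (\<rho> j) (Poly_Mapping.lookup m j)) (\<rho> i))"
    using True
    by (intro member_le_sum[of i _ "\<lambda>j. Poly_Mapping.lookup (Poly_Mapping.single (\<rho> j) (Poly_Mapping.lookup m j)) (\<rho> i)"]) auto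
  finally show ?thesis
    by (simp add: rename_mono_def lookup_sum)
qed (simp add: in_keys_iff)

lemma finite_rename_fibre:
  assumes "\<And>w. finite (\<rho> -` {w})"
  shows "finite {m'. rename_mono \<rho> m' = m}"
proof -
  let ?K = "\<Union>w\<in>Poly_Mapping.keys m. \<rho> -` {w}"
  let ?N = "\<Sum>j\<in>Poly_Mapping.keys m. Poly_Mapping.lookup m j"
  have "finite {a. Poly_Mapping.keys a \<subseteq> ?K \<and> (\<forall>i. Poly_Mapping.lookup a i \<le> ?N)}"
    by (rule finite_bounded_monos) (use assms in auto)
  moreover have "i \<in> ?K" if "rename_mono \<rho> a = m" "i \<in> Poly_Mapping.keys a" for a i
    using that lookup_le_rename_mono[of a i \<rho>] by (auto simp: in_keys_iff)
  moreover have "Poly_Mapping.lookup a i \<le> ?N" if "rename_mono \<rho> a = m" for a i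
    using that lookup_le_rename_mono[of a i \<rho>] lookup_le_degree[of m "\<rho> i"] by auto
  ultimately show ?thesis
    by (elim rev_finite_subset) blast
qed

lemma rename_add: "rename \<rho> (f + g) = rename \<rho> f + rename \<rho> g"
  by (rule mfps_eqI) (simp add: rename_def plus_mfps.rep_eq sum.distrib)

lemma rename_mult:
  assumes fin: "\<And>w. finite (\<rho> -` {w})"
  shows "rename \<rho> (f * g) = rename \<rho> f * rename \<rho> g"
proof (rule mfps_eqI)
  fix m
  let ?fib = "\<lambda>m. {m'. rename_mono \<rho> m' = m}"
  let ?A = "SIGMA m':?fib m. splits m'"
  let ?B = "SIGMA x:splits m. ?fib (fst x) \<times> ?fib (snd x)"
  note [simp] = finite_rename_fibre[OF fin] finite_splits
  have "coeff (rename \<rho> (f * g)) m = (\<Sum>(m', x)\<in>?A. coeff f (fst x) * coeff g (snd x))"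
    by (simp add: rename_def times_mfps.rep_eq case_prod_unfold sum.Sigma)
  also have "\<dots> = (\<Sum>(x, y)\<in>?B. coeff f (fst y) * coeff g (snd y))"
    by (rule sum.reindex_bij_witness
        [where i = "\<lambda>(x, y). (fst y + snd y, y)"
           and j = "\<lambda>(m', x). ((rename_mono \<rho> (fst x), rename_mono \<rho> (snd x)), x)"])
      (auto simp: splits_def rename_mono_add)
  also have "\<dots> = (\<Sum>x\<in>splits m. \<Sum>y\<in>?fib (fst x) \<times> ?fib (snd x). coeff f (fst y) * coeff g (snd y))"
    by (subst sum.Sigma) auto
  also have "\<dots> = coeff (rename \<rho> f * rename \<rho> g) m"
    by (simp add: rename_def times_mfps.rep_eq case_prod_unfold sum_product sum.cartesian_product)
  finally show "coeff (rename \<rho> (f * g)) m = coeff (rename \<rho> f * rename \<rho> g) m" .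
qed

lemma rename_comp:
  assumes fin: "\<And>w. finite (\<rho> -` {w})" "\<And>w. finite (\<tau> -` {w})"
  shows "rename \<tau> (rename \<rho> f) = rename (\<tau> \<circ> \<rho>) f"
proof (rule mfps_eqI)
  fix m
  note [simp] = finite_rename_fibre[OF fin(1)] finite_rename_fibre[OF fin(2)]
  have "coeff (rename \<tau> (rename \<rho> f)) m =
      (\<Sum>(a, b)\<in>(SIGMA a:{a. rename_mono \<tau> a = m}. {b. rename_mono \<rho> b = a}). coeff f b)"
    by (simp add: rename_def sum.Sigma)
  also have "\<dots> = (\<Sum>b | rename_mono (\<tau> \<circ> \<rho>) b = m. coeff f b)"
    by (rule sum.reindex_bij_witness[where i = "\<lambda>b. (rename_mono \<rho> b, b)" and j = snd])
      (auto simp flip: rename_mono_comp)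
  finally show "coeff (rename \<tau> (rename \<rho> f)) m = coeff (rename (\<tau> \<circ> \<rho>) f) m"
    by (simp add: rename_def)
qed


section \<open>Symmetric functions\<close>

text \<open>
  Symmetric functions have rational coefficients. The variable set is a type parameter, to be
  instantiated with countably infinite types only. Integer partitions are multisets of positive
  integers.
\<close>

definition is_partition :: "nat multiset \<Rightarrow> bool" where
  "is_partition \<mu> \<longleftrightarrow> 0 \<notin># \<mu>"

definition symmetric_functions :: "('v, rat) mfps set" where
  "symmetric_functions = {f.
     (\<exists>d. \<forall>m. coeff f m \<noteq> 0 \<longrightarrow> mono_degree m \<le> d) \<and>
     (\<forall>\<rho> :: 'v \<Rightarrow> 'v. bij \<rho> \<longrightarrow> rename \<rho> f = f)}"

definition monomial_sf :: "nat multiset \<Rightarrow> ('v, rat) mfps" where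
  "monomial_sf \<mu> = Mfps (\<lambda>m. if exponents m = \<mu> then 1 else 0)"

definition aug_monomial_sf :: "nat multiset \<Rightarrow> ('v, rat) mfps" where
  "aug_monomial_sf \<mu> = of_nat (\<Prod>i\<in>set_mset \<mu>. fact (count \<mu> i)) * monomial_sf \<mu>"

definition power_sum :: "nat \<Rightarrow> ('v, rat) mfps" where
  "power_sum n = Mfps (\<lambda>m. if \<exists>i. m = Poly_Mapping.single i n then 1 else 0)"

definition elementary :: "nat \<Rightarrow> ('v, rat) mfps" where
  "elementary n = Mfps (\<lambda>m. if mono_degree m = n \<and> (\<forall>i. Poly_Mapping.lookup m i \<le> 1) then 1 else 0)"

definition complete :: "nat \<Rightarrow> ('v, rat) mfps" where
  "complete n = Mfps (\<lambda>m. if mono_degree m = n then 1 else 0)"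

definition power_sum_sf :: "nat multiset \<Rightarrow> ('v, rat) mfps" where
  "power_sum_sf \<mu> = (\<Prod>n\<in>#\<mu>. power_sum n)"

definition elementary_sf :: "nat multiset \<Rightarrow> ('v, rat) mfps" where
  "elementary_sf \<mu> = (\<Prod>n\<in>#\<mu>. elementary n)"

definition complete_sf :: "nat multiset \<Rightarrow> ('v, rat) mfps" where
  "complete_sf \<mu> = (\<Prod>n\<in>#\<mu>. complete n)"

text \<open>
  \<open>omega\<close> is the linear map on symmetric functions with \<open>e\<^sub>\<mu> \<mapsto> h\<^sub>\<lambda>\<close>. The value \<open>0\<close> outside the
  symmetric functions is a convention that makes it unique as a total function.
\<close>

definition is_omega :: "(('v, rat) mfps \<Rightarrow> ('v, rat) mfps) \<Rightarrow> bool" where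
  "is_omega \<phi> \<longleftrightarrow>
     (\<forall>f\<in>symmetric_functions. \<forall>g\<in>symmetric_functions. \<phi> (f + g) = \<phi> f + \<phi> g) \<and>
     (\<forall>c. \<forall>f\<in>symmetric_functions. \<phi> (const c * f) = const c * \<phi> f) \<and>
     (\<forall>\<mu>. is_partition \<mu> \<longrightarrow> \<phi> (elementary_sf \<mu>) = complete_sf \<mu>) \<and>
     (\<forall>f. f \<notin> symmetric_functions \<longrightarrow> \<phi> f = 0)"

definition omega :: "('v, rat) mfps \<Rightarrow> ('v, rat) mfps" where
  "omega = (THE \<phi>. is_omega \<phi>)"

definition sgn_partition :: "nat multiset \<Rightarrow> int" where
  "sgn_partition \<mu> = (-1) ^ (sum_mset \<mu> - size \<mu>)"

definition forgotten_sf :: "nat multiset \<Rightarrow> ('v, rat) mfps" where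
  "forgotten_sf \<mu> = of_int (sgn_partition \<mu>) * omega (aug_monomial_sf \<mu>)"


section \<open>Two sets of variables\<close>

text \<open>
  The variables are \<open>x\<^sub>i = Inl i\<close> and \<open>y\<^sub>j = Inr j\<close>. A symmetric function in the union of the two
  sets, such as \<open>f\<^sub>\<mu>(x, y)\<close>, is the instance of the general notion at the variable type \<open>nat + nat\<close>.
\<close>

type_synonym xy_series = "(nat + nat, rat) mfps"

definition in_x :: "(nat, rat) mfps \<Rightarrow> xy_series" where
  "in_x f = rename Inl f"

definition in_y :: "(nat, rat) mfps \<Rightarrow> xy_series" where
  "in_y f = rename Inr f"

definition xy_mono :: "(nat \<Rightarrow>\<^sub>0 nat) \<Rightarrow> (nat \<Rightarrow>\<^sub>0 nat) \<Rightarrow> (nat + nat \<Rightarrow>\<^sub>0 nat)" where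
  "xy_mono a b = rename_mono Inl a + rename_mono Inr b"

definition x_part :: "(nat + nat \<Rightarrow>\<^sub>0 nat) \<Rightarrow> (nat \<Rightarrow>\<^sub>0 nat)" where
  "x_part m = Poly_Mapping.map_key Inl m"

definition y_part :: "(nat + nat \<Rightarrow>\<^sub>0 nat) \<Rightarrow> (nat \<Rightarrow>\<^sub>0 nat)" where
  "y_part m = Poly_Mapping.map_key Inr m"

definition negate_y :: "xy_series \<Rightarrow> xy_series" where
  "negate_y f = Mfps (\<lambda>m. (-1) ^ mono_degree (y_part m) * coeff f m)"

text \<open>
  \<open>y_coeff f b\<close> is the coefficient of the monomial \<open>y\<^sup>b\<close> in \<open>f\<close>, a series in the \<open>x\<close> variables;
  \<open>omega_x\<close> applies \<open>omega\<close> to each of these coefficients.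
\<close>

definition y_coeff :: "xy_series \<Rightarrow> (nat \<Rightarrow>\<^sub>0 nat) \<Rightarrow> (nat, rat) mfps" where
  "y_coeff f b = Mfps (\<lambda>a. coeff f (xy_mono a b))"

definition omega_x :: "xy_series \<Rightarrow> xy_series" where
  "omega_x f = Mfps (\<lambda>m. coeff (omega (y_coeff f (y_part m))) (x_part m))"

text \<open>
  The \<open>x\<close> variables are enumerated by all the \<open>x\<close> and \<open>y\<close> variables together: \<open>x\<^sub>n\<close> becomes
  the variable \<open>sum_decode n\<close>, with \<open>sum_decode\<close> a bijection from \<open>nat\<close> to \<open>nat + nat\<close>.
  On series that are symmetric in \<open>x\<close> the result does not depend on the enumeration.
\<close>

definition x_to_xy :: "xy_series \<Rightarrow> xy_series" where
  "x_to_xy f = rename (case_sum sum_decode Inr) f"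


lemma coeff_rename_power_sum:
  assumes "inj \<rho>" "n > 0"
  shows "coeff (rename \<rho> (power_sum n)) m = (if \<exists>i. m = Poly_Mapping.single (\<rho> i) n then 1 else 0)"
proof -
  have fin: "finite {m'. rename_mono \<rho> m' = m}"
    by (rule finite_rename_fibre) (use assms in \<open>auto intro: finite_vimageI\<close>)
  have "coeff (rename \<rho> (power_sum n)) m =
      of_nat (card {m'. rename_mono \<rho> m' = m \<and> (\<exists>i. m' = Poly_Mapping.single i n)})"
    using fin by (simp add: rename_def power_sum_def sum.If_cases Int_def)
  also have "{m'. rename_mono \<rho> m' = m \<and> (\<exists>i. m' = Poly_Mapping.single i n)} =
      (\<lambda>i. Poly_Mapping.single i n) ` {i. m = Poly_Mapping.single (\<rho> i) n}"
    by auto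
  also have "of_nat (card \<dots>) = (if \<exists>i. m = Poly_Mapping.single (\<rho> i) n then 1 else (0::rat))"
  proof (cases "\<exists>i. m = Poly_Mapping.single (\<rho> i) n")
    case True
    then obtain i where i: "m = Poly_Mapping.single (\<rho> i) n" ..
    have "{j. m = Poly_Mapping.single (\<rho> j) n} = {i}"
    proof -
      have "j = i" if "Poly_Mapping.single (\<rho> i) n = Poly_Mapping.single (\<rho> j) n" for j
      proof -
        have "Poly_Mapping.keys (Poly_Mapping.single (\<rho> i) n) = Poly_Mapping.keys (Poly_Mapping.single (\<rho> j) n)"
          using that by simp
        then show ?thesis
          using assms by (simp add: inj_eq)
      qed
      then show ?thesis using i by auto
    qed
    then show ?thesis using True by simp
  qed auto
  finally show ?thesis .
qed

lemma finite_vimage_x_to_xy: "finite (case_sum sum_decode Inr -` {w})"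
proof -
  have "case_sum sum_decode Inr -` {w} \<subseteq> {Inl (sum_encode w)} \<union> Inr ` (Inr -` {w})"
    by (auto split: sum.splits)
  moreover have "finite (Inr -` {w})"
    by (rule finite_vimageI) auto
  ultimately show ?thesis
    by (meson finite.emptyI finite.insertI finite_Un finite_imageI finite_subset)
qed

lemma finite_vimage_inj: "inj \<rho> \<Longrightarrow> finite (\<rho> -` {w})"
  by (rule finite_vimageI) auto

text \<open>
  \<open>x_to_xy\<close> respects sums and products, sends each \<open>p\<^sub>n(x)\<close> to \<open>p\<^sub>n(x) + p\<^sub>n(y)\<close> and fixes each
  \<open>p\<^sub>n(y)\<close>.
\<close>

lemma x_to_xy_add: "x_to_xy (f + g) = x_to_xy f + x_to_xy g"
  by (simp add: x_to_xy_def rename_add)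

lemma x_to_xy_mult: "x_to_xy (f * g) = x_to_xy f * x_to_xy g"
  by (simp add: x_to_xy_def rename_mult finite_vimage_x_to_xy)

lemma x_to_xy_in_y: "x_to_xy (in_y f) = in_y f"
  by (simp add: x_to_xy_def in_y_def rename_comp finite_vimage_x_to_xy finite_vimage_inj comp_def)

lemma x_to_xy_power_sum:
  assumes "n > 0"
  shows "x_to_xy (in_x (power_sum n)) = in_x (power_sum n) + in_y (power_sum n)"
proof -
  have "x_to_xy (in_x (power_sum n)) = rename sum_decode (power_sum n)"
    by (simp add: x_to_xy_def in_x_def rename_comp finite_vimage_x_to_xy finite_vimage_inj comp_def)
  also have "\<dots> = in_x (power_sum n) + in_y (power_sum n)"
  proof (rule mfps_eqI)
    fix m :: "nat + nat \<Rightarrow>\<^sub>0 nat"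
    have ex: "(\<exists>i. P (sum_decode i)) \<longleftrightarrow> (\<exists>i. P (Inl i)) \<or> (\<exists>i. P (Inr i))" for P
      by (metis sum_encode_inverse sum.exhaust)
    have ne: "Poly_Mapping.single (Inl i :: nat + nat) n \<noteq> Poly_Mapping.single (Inr j) n" for i j
    proof
      assume "Poly_Mapping.single (Inl i :: nat + nat) n = Poly_Mapping.single (Inr j) n"
      then have "Poly_Mapping.keys (Poly_Mapping.single (Inl i :: nat + nat) n) =
          Poly_Mapping.keys (Poly_Mapping.single (Inr j :: nat + nat) n)"
        by simp
      then show False using assms by simp
    qed
    show "coeff (rename sum_decode (power_sum n)) m = coeff (in_x (power_sum n) + in_y (power_sum n)) m"
      using assms ne ne[symmetric]
      by (auto simp: in_x_def in_y_def plus_mfps.rep_eq coeff_rename_power_sum inj_sum_decode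
          ex[of "\<lambda>w. m = Poly_Mapping.single w n"])
  qed
  finally show ?thesis .
qed


section \<open>Path-cycle covers\<close>

definition complement_digraph :: "'a pair_pre_digraph \<Rightarrow> 'a pair_pre_digraph" where
  "complement_digraph D = \<lparr> pverts = pverts D, parcs = pverts D \<times> pverts D - parcs D \<rparr>"

definition path_cycle_cover :: "'a pair_pre_digraph \<Rightarrow> 'a rel \<Rightarrow> bool" where
  "path_cycle_cover D S \<longleftrightarrow> S \<subseteq> parcs D \<and> inj_on fst S \<and> inj_on snd S"

definition incident_arcs :: "'a rel \<Rightarrow> 'a set \<Rightarrow> 'a rel" where
  "incident_arcs S C = {e \<in> S. fst e \<in> C \<or> snd e \<in> C}"

text \<open>
  A list \<open>v\<^sub>1, \<dots>, v\<^sub>k\<close> of distinct vertices runs through a path component of the spanning subgraph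
  with arc set \<open>S\<close> iff the arcs of \<open>S\<close> meeting it are exactly the \<open>(v\<^sub>i, v\<^sub>i\<^sub>+\<^sub>1)\<close> for \<open>i < k\<close>,
  and through a cycle component iff they are these together with \<open>(v\<^sub>k, v\<^sub>1)\<close>.
\<close>

definition path_sets :: "'a pair_pre_digraph \<Rightarrow> 'a rel \<Rightarrow> 'a set set" where
  "path_sets D S = {set vs | vs. vs \<noteq> [] \<and> distinct vs \<and> set vs \<subseteq> pverts D \<and>
     incident_arcs S (set vs) = set (zip vs (tl vs))}"

definition cycle_sets :: "'a pair_pre_digraph \<Rightarrow> 'a rel \<Rightarrow> 'a set set" where
  "cycle_sets D S = {set vs | vs. vs \<noteq> [] \<and> distinct vs \<and> set vs \<subseteq> pverts D \<and>
     incident_arcs S (set vs) = set (zip vs (rotate1 vs))}"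

definition set_partition_type :: "'a set set \<Rightarrow> nat multiset" where
  "set_partition_type P = image_mset card (mset_set P)"

definition path_cycle_sf :: "'a pair_pre_digraph \<Rightarrow> xy_series" where
  "path_cycle_sf D = (\<Sum>S | path_cycle_cover D S.
     in_x (aug_monomial_sf (set_partition_type (path_sets D S))) *
     in_y (power_sum_sf (set_partition_type (cycle_sets D S))))"

end

theory Submission
  imports Defs "HOL-Combinatorics.Orbits"
begin

text \<open>
  Both sides are sums over all permutations \<open>w\<close> of the vertex set of a product over the orbits of
  \<open>w\<close>, and the factors belonging to one orbit agree.

  Let \<open>S\<close> be a path-cycle cover and \<open>T\<close> the set of initial vertices of its arcs. A permutation \<open>w\<close>
  of the vertices whose graph contains \<open>S\<close> arises by joining the end of every path of \<open>S\<close> to the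
  start of a path, in a bijective way. Its orbits contained in \<open>T\<close> are the cycles of \<open>S\<close>; every
  other orbit is a union of paths. The key identity (\<open>aug_monomial_paths\<close>, unweighted form
  \<open>aug_monomial_type\<close>) is that the augmented monomial function of the paths of \<open>S\<close> equals
  the sum over these \<open>w\<close> of the product, over the orbits \<open>C\<close> not contained in \<open>T\<close>, of
  \<open>(-1)\<^bsup>|C| - 1 + |C \<inter> T|\<^esup> p\<^bsub>|C|\<^esub>\<close>. To see this, compare coefficients of a monomial: a term on the
  right counts the colourings of the vertices on paths that are invariant under \<open>w\<close>. If a colouring
  gives the ends of two different paths the same colour, composing \<open>w\<close> with the transposition of
  these ends is a sign-reversing involution. If not, at most one \<open>w\<close> leaves the colouring invariant,
  the one that closes up every path to a cycle, and it does so exactly when the colouring is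
  constant on paths; these colourings are what an augmented monomial function counts.
  Since \<open>\<omega> p\<^sub>n = (-1)\<^bsup>n - 1\<^esup> p\<^sub>n\<close>, applying \<open>\<omega>\<close> only replaces the sign by \<open>(-1)\<^bsup>|C \<inter> T|\<^esup>\<close>.

  A cover together with such a \<open>w\<close> is the same thing as a permutation \<open>w\<close> together with a set \<open>T\<close> of
  vertices \<open>v\<close> for which \<open>(v, w v)\<close> is an arc. So both sides become sums over \<open>w\<close>, and for each
  orbit \<open>C\<close> there remains a sum over the subsets of \<open>B = {v \<in> C. (v, w v) \<in> D}\<close> on the left and of
  \<open>C - B\<close> on the right. The alternating signs make almost everything cancel: both sums are
  \<open>p(x) + p(y)\<close> if \<open>B = C\<close>, \<open>(-1)\<^bsup>|C| - 1\<^esup> p(x)\<close> if \<open>B\<close> is empty, and \<open>0\<close> otherwise, with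
  \<open>p = p\<^bsub>|C|\<^esub>\<close> (\<open>sum_left_factor_eq_sum_right_factor\<close>).

  All of this needs that \<open>\<omega>\<close>, defined by a description, exists and is a ring homomorphism on
  symmetric functions. By Newton's identities and the key identity for the empty cover with weighted
  vertices, the \<open>e\<^sub>\<mu>\<close> span; as there are as many \<open>e\<^sub>\<mu>\<close> as monomial functions up to each degree,
  they form a basis (\<open>elementary_independent\<close>, \<open>symmetric_functions_eq_span\<close>, \<open>is_omega_omega\<close>).
\<close>

section \<open>Coefficients of power series\<close>

lemma coeff_zero [simp]: "coeff 0 m = 0"
  by (simp add: zero_mfps.rep_eq)

lemma coeff_one: "coeff 1 m = (if m = 0 then 1 else 0)"
  by (simp add: one_mfps.rep_eq)

lemma coeff_add [simp]: "coeff (f + g) m = coeff f m + coeff g m"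
  by (simp add: plus_mfps.rep_eq)

lemma coeff_uminus [simp]: "coeff (- f) m = - coeff f m"
  by (simp add: uminus_mfps.rep_eq)

lemma coeff_sum: "coeff (\<Sum>i\<in>I. F i) m = (\<Sum>i\<in>I. coeff (F i) m)"
  by (induction I rule: infinite_finite_induct) auto

lemma coeff_mult: "coeff (f * g) m = (\<Sum>x\<in>splits m. coeff f (fst x) * coeff g (snd x))"
  by (simp add: times_mfps.rep_eq case_prod_unfold)

lemma coeff_const_mult [simp]: "coeff (const c * f) m = c * coeff f m"
proof -
  have zero: "(0, m) \<in> splits m"
    by (simp add: splits_def)
  have "coeff (const c * f) m = (\<Sum>x\<in>splits m. if x = (0, m) then c * coeff f m else 0)"
    unfolding coeff_mult
    by (rule sum.cong) (auto simp: splits_def const_def)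
  also have "\<dots> = c * coeff f m"
    by (simp only: sum.delta[OF finite_splits] zero if_True)
  finally show ?thesis .
qed

lemma const_one [simp]: "const 1 = 1"
  by (rule mfps_eqI) (simp add: const_def coeff_one)

lemma const_zero [simp]: "const 0 = 0"
  by (rule mfps_eqI) (simp add: const_def)

lemma const_add: "const (a + b) = const a + const b"
  by (rule mfps_eqI) (simp add: const_def)

lemma const_uminus: "const (- a) = - const a"
  by (rule mfps_eqI) (simp add: const_def)

lemma const_mult: "const (a * b) = const a * const b"
  by (rule mfps_eqI) (simp, simp add: const_def)

lemma const_of_nat: "const (of_nat k) = of_nat k"
  by (induction k) (auto simp: const_add)

lemma const_prod: "const (\<Prod>i\<in>I. F i) = (\<Prod>i\<in>I. const (F i))"
  by (induction I rule: infinite_finite_induct) (auto simp: const_mult)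

section \<open>Colourings and products of power sums\<close>

lemma minus_single_plus:
  fixes m :: "'v \<Rightarrow>\<^sub>0 nat"
  assumes "a \<le> Poly_Mapping.lookup m i"
  shows "Poly_Mapping.single i a + (m - Poly_Mapping.single i a) = m"
  by (rule poly_mapping_eqI)
    (use assms in \<open>auto simp: Poly_Mapping.lookup_add Poly_Mapping.lookup_minus lookup_single when_def\<close>)

lemma eq_minus_single_iff:
  fixes m :: "'v \<Rightarrow>\<^sub>0 nat"
  assumes "a \<le> Poly_Mapping.lookup m i"
  shows "u = m - Poly_Mapping.single i a \<longleftrightarrow> Poly_Mapping.single i a + u = m"
  using minus_single_plus[OF assms] by (metis add_left_cancel)

lemma finite_lookup_ge:
  fixes m :: "'v \<Rightarrow>\<^sub>0 nat"
  assumes "0 < a"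
  shows "finite {i. a \<le> Poly_Mapping.lookup m i}"
  by (rule finite_subset[OF _ finite_keys[of m]]) (use assms in \<open>auto simp: in_keys_iff\<close>)

lemma single_eq_single_iff:
  assumes "0 < (a::nat)"
  shows "Poly_Mapping.single i a = Poly_Mapping.single j a \<longleftrightarrow> i = j"
  using assms by (metis lookup_single_eq lookup_single_not_eq less_irrefl)

text \<open>
  Only the splittings of \<open>m\<close> whose first part is a pure power \<open>x\<^sub>i\<^sup>a\<close> contribute, one for each
  variable that occurs in \<open>m\<close> with exponent at least \<open>a\<close>.
\<close>

lemma coeff_power_sum_mult:
  assumes "0 < a"
  shows "coeff (power_sum a * f) m
    = (\<Sum>i | a \<le> Poly_Mapping.lookup m i. coeff f (m - Poly_Mapping.single i a))"
proof -
  let ?s = "\<lambda>i. Poly_Mapping.single i a"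
  have "coeff (power_sum a * f) m
      = (\<Sum>x\<in>splits m. if \<exists>i. fst x = ?s i then coeff f (snd x) else 0)"
    unfolding coeff_mult by (rule sum.cong) (auto simp: power_sum_def)
  also have "\<dots> = (\<Sum>x | x \<in> splits m \<and> (\<exists>i. fst x = ?s i). coeff f (snd x))"
    by (simp add: sum.If_cases finite_splits Int_def)
  also have "\<dots> = (\<Sum>i | a \<le> Poly_Mapping.lookup m i. coeff f (m - ?s i))"
  proof -
    have "bij_betw (\<lambda>i. (?s i, m - ?s i)) {i. a \<le> Poly_Mapping.lookup m i}
        {x \<in> splits m. \<exists>i. fst x = ?s i}"
    proof (rule bij_betwI')
      fix y assume "y \<in> {x \<in> splits m. \<exists>i. fst x = ?s i}"
      then obtain i where i: "fst y = ?s i" "?s i + snd y = m"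
        by (auto simp: splits_def)
      have le: "a \<le> Poly_Mapping.lookup m i"
        by (subst i(2)[symmetric]) (simp add: Poly_Mapping.lookup_add)
      then have "y = (?s i, m - ?s i)"
        using i eq_minus_single_iff[OF le, of "snd y"] by (cases y) simp
      then show "\<exists>i\<in>{i. a \<le> Poly_Mapping.lookup m i}. y = (?s i, m - ?s i)"
        using le by blast
    qed (use assms in \<open>auto simp: single_eq_single_iff splits_def minus_single_plus\<close>)
    from sum.reindex_bij_betw[OF this, of "\<lambda>x. coeff f (snd x)"] show ?thesis
      by simp
  qed
  finally show ?thesis .
qed

text \<open>
  An element \<open>c\<close> of weight \<open>n c\<close> and colour \<open>\<gamma> c\<close> contributes the factor \<open>x\<^bsub>\<gamma> c\<^esub>\<close> to the power
  \<open>n c\<close>. Products of power sums and augmented monomial functions are generating functions of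
  colourings with respect to this monomial, which reduces identities between them to counting.
\<close>

definition colour_monomial :: "'i set \<Rightarrow> ('i \<Rightarrow> nat) \<Rightarrow> ('i \<Rightarrow> 'v) \<Rightarrow> ('v \<Rightarrow>\<^sub>0 nat)" where
  "colour_monomial I n \<gamma> = (\<Sum>c\<in>I. Poly_Mapping.single (\<gamma> c) (n c))"

lemma keys_colour_monomial:
  assumes "finite I" "\<And>c. c \<in> I \<Longrightarrow> 0 < n c"
  shows "Poly_Mapping.keys (colour_monomial I n \<gamma>) = \<gamma> ` I"
  using assms
  by (auto simp: colour_monomial_def in_keys_iff lookup_sum lookup_single when_def split: if_splits)

lemma finite_colourings:
  assumes "finite I" "\<And>c. c \<in> I \<Longrightarrow> 0 < n c"
  shows "finite {\<gamma> \<in> I \<rightarrow>\<^sub>E UNIV. colour_monomial I n \<gamma> = m \<and> Q \<gamma>}"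
proof (rule finite_subset)
  show "{\<gamma> \<in> I \<rightarrow>\<^sub>E UNIV. colour_monomial I n \<gamma> = m \<and> Q \<gamma>} \<subseteq> I \<rightarrow>\<^sub>E Poly_Mapping.keys m"
  proof
    fix \<gamma> assume "\<gamma> \<in> {\<gamma> \<in> I \<rightarrow>\<^sub>E UNIV. colour_monomial I n \<gamma> = m \<and> Q \<gamma>}"
    then have "\<gamma> ` I = Poly_Mapping.keys m" "\<gamma> \<in> extensional I"
      using keys_colour_monomial[of I n \<gamma>] assms by (auto simp: PiE_def)
    then show "\<gamma> \<in> I \<rightarrow>\<^sub>E Poly_Mapping.keys m"
      by (auto simp: PiE_def)
  qed
  show "finite (I \<rightarrow>\<^sub>E Poly_Mapping.keys m)"
    by (intro finite_PiE assms) auto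
qed

lemma colour_monomial_insert:
  assumes "finite I" "c \<notin> I"
  shows "colour_monomial (insert c I) n (\<gamma>(c := i))
    = Poly_Mapping.single i (n c) + colour_monomial I n \<gamma>"
proof -
  have "(\<Sum>x\<in>I. Poly_Mapping.single ((\<gamma>(c := i)) x) (n x)) = (\<Sum>x\<in>I. Poly_Mapping.single (\<gamma> x) (n x))"
    by (rule sum.cong) (use assms in auto)
  then show ?thesis
    using assms by (simp add: colour_monomial_def)
qed

text \<open>
  Choose the colour \<open>i\<close> of the new element \<open>c\<close> first. The predicate \<open>Q\<close> allows the same recursion
  to serve for all colourings and for the injective ones.
\<close>

lemma card_colourings_insert:
  assumes I: "finite I" "c \<notin> I" and pos: "\<And>b. b \<in> insert c I \<Longrightarrow> 0 < n b"
  shows "card {\<gamma> \<in> insert c I \<rightarrow>\<^sub>E UNIV. colour_monomial (insert c I) n \<gamma> = m \<and> Q \<gamma>}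
    = (\<Sum>i | n c \<le> Poly_Mapping.lookup m i.
        card {\<gamma> \<in> I \<rightarrow>\<^sub>E UNIV. colour_monomial I n \<gamma> = m - Poly_Mapping.single i (n c) \<and> Q (\<gamma>(c := i))})"
    (is "card ?L = (\<Sum>i\<in>?N. card (?R i))")
proof -
  have "bij_betw (\<lambda>(i, \<gamma>). \<gamma>(c := i)) (Sigma ?N ?R) ?L"
  proof (rule bij_betwI')
    fix x y assume "x \<in> Sigma ?N ?R" "y \<in> Sigma ?N ?R"
    then have ext: "snd x \<in> extensional I" "snd y \<in> extensional I"
      by (auto simp: PiE_def)
    show "((case x of (i, \<gamma>) \<Rightarrow> \<gamma>(c := i)) = (case y of (i, \<gamma>) \<Rightarrow> \<gamma>(c := i))) = (x = y)"
    proof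
      assume eq: "(case x of (i, \<gamma>) \<Rightarrow> \<gamma>(c := i)) = (case y of (i, \<gamma>) \<Rightarrow> \<gamma>(c := i))"
      have "fst x = fst y"
        using fun_cong[OF eq, of c] by (simp add: case_prod_unfold)
      moreover have "snd x = snd y"
        using ext I(2) fun_cong[OF eq]
        by (intro extensionalityI[of _ I]) (auto simp: case_prod_unfold fun_upd_def, metis)
      ultimately show "x = y" by (simp add: prod_eq_iff)
    qed simp
  next
    fix x assume "x \<in> Sigma ?N ?R"
    then show "(case x of (i, \<gamma>) \<Rightarrow> \<gamma>(c := i)) \<in> ?L"
      by (auto simp: colour_monomial_insert[OF I] minus_single_plus intro!: PiE_fun_upd[where T = "\<lambda>_. UNIV"])
  next
    fix \<gamma> assume g: "\<gamma> \<in> ?L"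
    define \<delta> where "\<delta> = \<gamma>(c := undefined)"
    have d: "\<gamma> = \<delta>(c := \<gamma> c)" "\<delta> \<in> I \<rightarrow>\<^sub>E UNIV"
      using g I(2) fun_upd_in_PiE[of c I \<gamma>] by (auto simp: \<delta>_def)
    have m: "m = Poly_Mapping.single (\<gamma> c) (n c) + colour_monomial I n \<delta>"
      using g colour_monomial_insert[OF I, of n \<delta> "\<gamma> c"] d(1) by simp
    have le: "n c \<le> Poly_Mapping.lookup m (\<gamma> c)"
      by (subst m) (simp add: Poly_Mapping.lookup_add)
    have "(\<gamma> c, \<delta>) \<in> Sigma ?N ?R"
      using le d g eq_minus_single_iff[OF le] m by simp
    then show "\<exists>x\<in>Sigma ?N ?R. \<gamma> = (case x of (i, \<gamma>) \<Rightarrow> \<gamma>(c := i))"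
      using d(1) by (intro bexI[of _ "(\<gamma> c, \<delta>)"]) auto
  qed
  then have "card ?L = card (Sigma ?N ?R)"
    by (simp add: bij_betw_same_card)
  also have "\<dots> = (\<Sum>i\<in>?N. card (?R i))"
    by (rule card_SigmaI) (use I pos in \<open>auto intro!: finite_lookup_ge finite_colourings\<close>)
  finally show ?thesis .
qed

lemma coeff_prod_power_sum:
  fixes I :: "'i set" and m :: "'v \<Rightarrow>\<^sub>0 nat"
  assumes "finite I" "\<And>c. c \<in> I \<Longrightarrow> 0 < n c"
  shows "coeff (\<Prod>c\<in>I. power_sum (n c)) m
    = of_nat (card {\<gamma> \<in> I \<rightarrow>\<^sub>E UNIV. colour_monomial I n \<gamma> = m})"
  using assms
proof (induction I arbitrary: m rule: finite_induct)
  case empty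
  have "{\<gamma>. (\<gamma> :: 'i \<Rightarrow> 'v) = (\<lambda>x. undefined) \<and> m = 0} = (if m = 0 then {\<lambda>x. undefined} else {})"
    by auto
  then show ?case
    by (auto simp: colour_monomial_def coeff_one)
next
  case (insert c I)
  have "coeff (\<Prod>c\<in>insert c I. power_sum (n c)) m
      = (\<Sum>i | n c \<le> Poly_Mapping.lookup m i.
          of_nat (card {\<gamma> \<in> I \<rightarrow>\<^sub>E UNIV. colour_monomial I n \<gamma> = m - Poly_Mapping.single i (n c)}))"
    using insert by (simp add: coeff_power_sum_mult)
  then show ?case
    using card_colourings_insert[of I c n m "\<lambda>_. True"] insert by simp
qed

section \<open>Augmented monomial functions count injective colourings\<close>

lemma count_exponents:
  assumes "0 < k"
  shows "count (exponents m) k = card {i. Poly_Mapping.lookup m i = k}"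
proof -
  have "count (exponents m) k
      = (\<Sum>y\<in>Poly_Mapping.lookup m -` {k} \<inter> Poly_Mapping.keys m. count (mset_set (Poly_Mapping.keys m)) y)"
    by (simp add: exponents_def count_image_mset)
  also have "\<dots> = (\<Sum>y\<in>Poly_Mapping.lookup m -` {k} \<inter> Poly_Mapping.keys m. 1)"
    by (rule sum.cong) auto
  also have "Poly_Mapping.lookup m -` {k} \<inter> Poly_Mapping.keys m = {i. Poly_Mapping.lookup m i = k}"
    using assms by (auto simp: in_keys_iff)
  finally show ?thesis by simp
qed

text \<open>
  Only removing a variable completely takes one part away from the exponents, hence the equality in
  the assumption.
\<close>

lemma exponents_minus_single:
  fixes m :: "'v \<Rightarrow>\<^sub>0 nat"
  assumes "Poly_Mapping.lookup m i = k" "0 < k"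
  shows "exponents m = add_mset k (exponents (m - Poly_Mapping.single i k))"
proof -
  let ?m' = "m - Poly_Mapping.single i k"
  have keys: "Poly_Mapping.keys m = insert i (Poly_Mapping.keys ?m')" "i \<notin> Poly_Mapping.keys ?m'"
    using assms by (auto simp: in_keys_iff Poly_Mapping.lookup_minus lookup_single when_def split: if_splits)
  have "image_mset (Poly_Mapping.lookup m) (mset_set (Poly_Mapping.keys ?m'))
      = image_mset (Poly_Mapping.lookup ?m') (mset_set (Poly_Mapping.keys ?m'))"
    by (rule image_mset_cong) (use keys in \<open>auto simp: Poly_Mapping.lookup_minus lookup_single when_def\<close>)
  then show ?thesis
    using assms keys by (simp add: exponents_def)
qed

lemma prod_fact_count_add_mset:
  "(\<Prod>i\<in>set_mset (add_mset k \<mu>). fact (count (add_mset k \<mu>) i) :: nat)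
    = (count \<mu> k + 1) * (\<Prod>i\<in>set_mset \<mu>. fact (count \<mu> i))"
proof -
  have "(\<Prod>i\<in>set_mset \<mu>. fact (count \<mu> i) :: nat) = (\<Prod>i\<in>insert k (set_mset \<mu>). fact (count \<mu> i))"
    by (rule prod.mono_neutral_left) (auto simp: not_in_iff)
  also have "\<dots> = fact (count \<mu> k) * (\<Prod>i\<in>set_mset \<mu> - {k}. fact (count \<mu> i))"
    by (subst prod.insert_remove) auto
  finally have 1: "(\<Prod>i\<in>set_mset \<mu>. fact (count \<mu> i) :: nat)
      = fact (count \<mu> k) * (\<Prod>i\<in>set_mset \<mu> - {k}. fact (count \<mu> i))" .
  have "(\<Prod>i\<in>insert k (set_mset \<mu>). fact (count (add_mset k \<mu>) i) :: nat)
      = fact (Suc (count \<mu> k)) * (\<Prod>i\<in>set_mset \<mu> - {k}. fact (count (add_mset k \<mu>) i))"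
    by (subst prod.insert_remove) auto
  also have "(\<Prod>i\<in>set_mset \<mu> - {k}. fact (count (add_mset k \<mu>) i) :: nat)
      = (\<Prod>i\<in>set_mset \<mu> - {k}. fact (count \<mu> i))"
    by (rule prod.cong) auto
  finally show ?thesis
    unfolding 1 by (simp add: algebra_simps)
qed

lemma coeff_aug_monomial:
  "coeff (aug_monomial_sf \<mu>) m
    = (if exponents m = \<mu> then of_nat (\<Prod>i\<in>set_mset \<mu>. fact (count \<mu> i)) else 0)"
  unfolding aug_monomial_sf_def const_of_nat[symmetric] by (simp add: monomial_sf_def)

text \<open>
  The factor \<open>r\<^sub>1! r\<^sub>2! \<dots>\<close> in the augmented monomial function is the number of ways to match the
  elements of \<open>I\<close> with the variables of a monomial that has the right exponents. By induction on
  \<open>I\<close>: an injective colouring must give \<open>c\<close> a variable with exponent exactly \<open>n c\<close>, and if the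
  exponents are right there are as many of them as there are parts \<open>n c\<close>.
\<close>

lemma coeff_aug_monomial_colourings:
  fixes I :: "'i set" and m :: "'v \<Rightarrow>\<^sub>0 nat"
  assumes "finite I" "\<And>c. c \<in> I \<Longrightarrow> 0 < n c"
  shows "coeff (aug_monomial_sf (image_mset n (mset_set I))) m
    = of_nat (card {\<gamma> \<in> I \<rightarrow>\<^sub>E UNIV. colour_monomial I n \<gamma> = m \<and> inj_on \<gamma> I})"
  using assms
proof (induction I arbitrary: m rule: finite_induct)
  case empty
  have "{\<gamma>. (\<gamma> :: 'i \<Rightarrow> 'v) = (\<lambda>x. undefined) \<and> m = 0} = (if m = 0 then {\<lambda>x. undefined} else {})"
    by auto
  moreover have "exponents m = {#} \<longleftrightarrow> m = 0"
    by (auto simp: exponents_def mset_set_empty_iff)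
  ultimately show ?case
    by (auto simp: colour_monomial_def coeff_aug_monomial)
next
  case (insert c I)
  let ?k = "n c" and ?\<mu> = "image_mset n (mset_set I)"
  let ?F = "\<Prod>i\<in>set_mset ?\<mu>. fact (count ?\<mu> i) :: nat"
  let ?R = "\<lambda>i. {\<gamma> \<in> I \<rightarrow>\<^sub>E UNIV. colour_monomial I n \<gamma> = m - Poly_Mapping.single i ?k \<and> inj_on (\<gamma>(c := i)) (insert c I)}"
  have k: "0 < ?k" and pos: "\<And>b. b \<in> I \<Longrightarrow> 0 < n b"
    using insert by auto
  have R: "of_nat (card (?R i)) = (if ?k = Poly_Mapping.lookup m i \<and> exponents m = add_mset ?k ?\<mu>
      then of_nat ?F else (0::rat))" if i: "?k \<le> Poly_Mapping.lookup m i" for i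
  proof -
    \<comment> \<open>The colour \<open>i\<close> is unused by \<open>\<gamma>\<close> iff \<open>c\<close> takes up its whole exponent in \<open>m\<close>.\<close>
    have inj: "inj_on (\<gamma>(c := i)) (insert c I) \<longleftrightarrow> inj_on \<gamma> I \<and> ?k = Poly_Mapping.lookup m i"
      if g: "colour_monomial I n \<gamma> = m - Poly_Mapping.single i ?k" for \<gamma>
    proof -
      have "Poly_Mapping.keys (colour_monomial I n \<gamma>) = \<gamma> ` I"
        by (rule keys_colour_monomial) (use insert.hyps pos in auto)
      then have "i \<in> \<gamma> ` I \<longleftrightarrow> Poly_Mapping.lookup (m - Poly_Mapping.single i ?k) i \<noteq> 0"
        unfolding g by (metis in_keys_iff)
      then have "i \<in> \<gamma> ` I \<longleftrightarrow> ?k \<noteq> Poly_Mapping.lookup m i"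
        using i by (auto simp: Poly_Mapping.lookup_minus)
      moreover have "inj_on (\<gamma>(c := i)) I \<longleftrightarrow> inj_on \<gamma> I"
        using insert.hyps by (intro inj_on_cong) auto
      ultimately show ?thesis
        using insert.hyps by (auto simp: fun_upd_image)
    qed
    have eq: "?R i = {\<gamma> \<in> I \<rightarrow>\<^sub>E UNIV. colour_monomial I n \<gamma> = m - Poly_Mapping.single i ?k
        \<and> inj_on \<gamma> I \<and> ?k = Poly_Mapping.lookup m i}"
      by (intro Collect_cong conj_cong refl) (rule inj)
    show ?thesis
    proof (cases "?k = Poly_Mapping.lookup m i")
      case True
      then show ?thesis
        using insert.IH[OF pos, of "m - Poly_Mapping.single i ?k"]
          exponents_minus_single[OF True[symmetric] k]
        unfolding eq by (auto simp: coeff_aug_monomial)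
    next
      case False
      then show ?thesis unfolding eq by auto
    qed
  qed
  have "card {\<gamma> \<in> insert c I \<rightarrow>\<^sub>E UNIV. colour_monomial (insert c I) n \<gamma> = m \<and> inj_on \<gamma> (insert c I)}
      = (\<Sum>i | ?k \<le> Poly_Mapping.lookup m i. card (?R i))"
    by (rule card_colourings_insert) (use insert in auto)
  then have "of_nat (card {\<gamma> \<in> insert c I \<rightarrow>\<^sub>E UNIV. colour_monomial (insert c I) n \<gamma> = m \<and> inj_on \<gamma> (insert c I)})
      = (\<Sum>i | ?k \<le> Poly_Mapping.lookup m i. of_nat (card (?R i)) :: rat)"
    by (simp only: of_nat_sum)
  also have "\<dots> = (\<Sum>i | ?k \<le> Poly_Mapping.lookup m i.
      if ?k = Poly_Mapping.lookup m i \<and> exponents m = add_mset ?k ?\<mu> then of_nat ?F else 0)"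
    by (rule sum.cong[OF refl], rule R, simp)
  also have "\<dots> = (\<Sum>i | Poly_Mapping.lookup m i = ?k. if exponents m = add_mset ?k ?\<mu> then of_nat ?F else 0)"
    by (rule sum.mono_neutral_cong_right) (use finite_lookup_ge[OF k, of m] in auto)
  also have "\<dots> = (if exponents m = add_mset ?k ?\<mu> then of_nat ((count ?\<mu> ?k + 1) * ?F) else 0)"
  proof (cases "exponents m = add_mset ?k ?\<mu>")
    case True
    then have "card {i. Poly_Mapping.lookup m i = ?k} = count ?\<mu> ?k + 1"
      using count_exponents[OF k, of m] by simp
    then show ?thesis
      using True by (simp only: if_True refl sum_constant of_nat_mult)
  next
    case False
    then show ?thesis by (simp only: if_False sum.neutral_const)
  qed
  also have "\<dots> = coeff (aug_monomial_sf (image_mset n (mset_set (insert c I)))) m"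
  proof -
    have "image_mset n (mset_set (insert c I)) = add_mset ?k ?\<mu>"
      using insert.hyps by simp
    then show ?thesis
      by (simp only: coeff_aug_monomial prod_fact_count_add_mset)
  qed
  finally show ?case ..
qed

section \<open>Symmetric functions\<close>

lemma mono_degree_eq: "mono_degree m = sum_mset (exponents m)"
  by (simp add: mono_degree_def exponents_def sum_unfold_sum_mset)

lemma mono_degree_superset:
  assumes "finite K" "Poly_Mapping.keys m \<subseteq> K"
  shows "mono_degree m = (\<Sum>i\<in>K. Poly_Mapping.lookup m i)"
  unfolding mono_degree_def
  by (rule sum.mono_neutral_left) (use assms in \<open>auto simp: in_keys_iff\<close>)

lemma mono_degree_add [simp]: "mono_degree (a + b) = mono_degree a + mono_degree b"
proof -
  let ?K = "Poly_Mapping.keys a \<union> Poly_Mapping.keys b"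
  show ?thesis
    using Poly_Mapping.keys_add[of a b]
    by (simp add: mono_degree_superset[of ?K] Poly_Mapping.lookup_add sum.distrib)
qed

lemma mono_degree_single [simp]: "mono_degree (Poly_Mapping.single i k) = k"
  by (auto simp: mono_degree_def)

lemma mono_degree_eq_0_iff: "mono_degree m = 0 \<longleftrightarrow> m = 0"
proof
  assume "mono_degree m = 0"
  then have "\<forall>i\<in>Poly_Mapping.keys m. Poly_Mapping.lookup m i = 0"
    by (simp add: mono_degree_def)
  then show "m = 0"
    by (intro poly_mapping_eqI) (auto simp: in_keys_iff)
qed (simp add: mono_degree_def)

lemma mono_degree_minus_single:
  assumes "k \<le> Poly_Mapping.lookup m i"
  shows "mono_degree m = k + mono_degree (m - Poly_Mapping.single i k)"
  using mono_degree_add[of "Poly_Mapping.single i k" "m - Poly_Mapping.single i k"]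
  by (simp add: minus_single_plus[OF assms])

lemma lookup_le_mono_degree: "Poly_Mapping.lookup m i \<le> mono_degree m"
  unfolding mono_degree_def by (rule lookup_le_degree)

lemma set_mset_exponents: "set_mset (exponents m) = Poly_Mapping.lookup m ` Poly_Mapping.keys m"
  by (simp add: exponents_def)

lemma is_partition_exponents: "is_partition (exponents m)"
  by (auto simp: is_partition_def set_mset_exponents in_keys_iff)

lemma inj_extends_to_bij:
  fixes \<gamma> :: "'v \<Rightarrow> 'v"
  assumes "finite K" "inj_on \<gamma> K"
  shows "\<exists>\<rho>. bij \<rho> \<and> (\<forall>k\<in>K. \<rho> k = \<gamma> k)"
proof -
  define A where "A = K \<union> \<gamma> ` K"
  have A: "finite A" "K \<subseteq> A" "\<gamma> ` K \<subseteq> A"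
    using assms by (auto simp: A_def)
  have "card (A - K) = card (A - \<gamma> ` K)"
    using assms A by (simp add: card_Diff_subset card_image)
  then obtain g where g: "bij_betw g (A - K) (A - \<gamma> ` K)"
    using A finite_same_card_bij by blast
  define \<rho> where "\<rho> x = (if x \<in> K then \<gamma> x else if x \<in> A then g x else x)" for x
  have "bij_betw \<rho> K (\<gamma> ` K)"
    using assms by (auto simp: bij_betw_def \<rho>_def inj_on_def)
  moreover have "bij_betw \<rho> (A - K) (A - \<gamma> ` K)"
    using bij_betw_cong[of "A - K" \<rho> g] g by (auto simp: \<rho>_def)
  ultimately have "bij_betw \<rho> (K \<union> (A - K)) (\<gamma> ` K \<union> (A - \<gamma> ` K))"
    by (rule bij_betw_combine) auto
  moreover have "bij_betw \<rho> (- A) (- A) = bij_betw id (- A) (- A)"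
    by (rule bij_betw_cong) (use A in \<open>auto simp: \<rho>_def\<close>)
  then have "bij_betw \<rho> (- A) (- A)"
    by simp
  ultimately have "bij_betw \<rho> ((K \<union> (A - K)) \<union> - A) ((\<gamma> ` K \<union> (A - \<gamma> ` K)) \<union> - A)"
    by (rule bij_betw_combine) (use A in auto)
  moreover have "(K \<union> (A - K)) \<union> - A = UNIV" "(\<gamma> ` K \<union> (A - \<gamma> ` K)) \<union> - A = UNIV"
    using A by auto
  ultimately show ?thesis
    by (intro exI[of _ \<rho>]) (auto simp: \<rho>_def)
qed

text \<open>
  Equal exponents mean that some injective colouring of the variables of \<open>m\<close>, each weighted by
  its exponent, produces \<open>m'\<close>: the coefficient counting these colourings does not vanish.
\<close>

lemma exponents_eq_imp_rename:
  fixes m m' :: "'v \<Rightarrow>\<^sub>0 nat"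
  assumes "exponents m = exponents m'"
  shows "\<exists>\<rho>. bij \<rho> \<and> rename_mono \<rho> m = m'"
proof -
  let ?I = "Poly_Mapping.keys m"
  have "coeff (aug_monomial_sf (exponents m)) m' \<noteq> 0"
    by (simp add: coeff_aug_monomial assms)
  then have "{\<gamma> \<in> ?I \<rightarrow>\<^sub>E UNIV. colour_monomial ?I (Poly_Mapping.lookup m) \<gamma> = m' \<and> inj_on \<gamma> ?I} \<noteq> {}"
    unfolding exponents_def
    by (subst (asm) coeff_aug_monomial_colourings) (auto simp: in_keys_iff simp del: Collect_empty_eq)
  then obtain \<gamma> where g: "colour_monomial ?I (Poly_Mapping.lookup m) \<gamma> = m'" "inj_on \<gamma> ?I"
    by blast
  obtain \<rho> where \<rho>: "bij \<rho>" "\<forall>k\<in>?I. \<rho> k = \<gamma> k"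
    using inj_extends_to_bij[OF finite_keys g(2)] by blast
  have "rename_mono \<rho> m = m'"
    using g(1) \<rho>(2) by (simp add: rename_mono_def colour_monomial_def)
  then show ?thesis using \<rho> by blast
qed

lemma lookup_rename_mono_inj:
  assumes "inj \<rho>"
  shows "Poly_Mapping.lookup (rename_mono \<rho> m) (\<rho> i) = Poly_Mapping.lookup m i"
    and "w \<notin> range \<rho> \<Longrightarrow> Poly_Mapping.lookup (rename_mono \<rho> m) w = 0"
proof -
  have "Poly_Mapping.lookup (rename_mono \<rho> m) (\<rho> i)
      = (\<Sum>j\<in>Poly_Mapping.keys m. if j = i then Poly_Mapping.lookup m j else 0)"
    unfolding rename_mono_def lookup_sum
    by (rule sum.cong) (use assms in \<open>auto simp: lookup_single when_def inj_eq\<close>)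
  then show "Poly_Mapping.lookup (rename_mono \<rho> m) (\<rho> i) = Poly_Mapping.lookup m i"
    by (simp add: in_keys_iff)
  show "Poly_Mapping.lookup (rename_mono \<rho> m) w = 0" if "w \<notin> range \<rho>"
    unfolding rename_mono_def lookup_sum
    by (rule sum.neutral) (use that in \<open>auto simp: lookup_single when_def\<close>)
qed

lemma rename_mono_eq_iff:
  assumes "inj \<rho>"
  shows "rename_mono \<rho> a = rename_mono \<rho> b \<longleftrightarrow> a = b"
  using lookup_rename_mono_inj(1)[OF assms] by (metis poly_mapping_eqI)

lemma coeff_rename_inj:
  assumes "inj \<rho>"
  shows "coeff (rename \<rho> f) (rename_mono \<rho> a) = coeff f a"
    and "m \<notin> range (rename_mono \<rho>) \<Longrightarrow> coeff (rename \<rho> f) m = 0"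
proof -
  have "{m'. rename_mono \<rho> m' = rename_mono \<rho> a} = {a}"
    using rename_mono_eq_iff[OF assms] by auto
  then show "coeff (rename \<rho> f) (rename_mono \<rho> a) = coeff f a" by (simp add: rename_def)
  show "coeff (rename \<rho> f) m = 0" if "m \<notin> range (rename_mono \<rho>)"
  proof -
    have "{m'. rename_mono \<rho> m' = m} = {}" using that by auto
    then show ?thesis by (simp add: rename_def)
  qed
qed

lemma exponents_rename_mono:
  assumes "inj \<rho>"
  shows "exponents (rename_mono \<rho> m) = exponents m"
proof -
  have keys: "Poly_Mapping.keys (rename_mono \<rho> m) = \<rho> ` Poly_Mapping.keys m"
  proof (intro set_eqI)
    fix v
    show "v \<in> Poly_Mapping.keys (rename_mono \<rho> m) \<longleftrightarrow> v \<in> \<rho> ` Poly_Mapping.keys m"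
      using lookup_rename_mono_inj[OF assms, where m = m] by (cases "v \<in> range \<rho>") (auto simp: in_keys_iff)
  qed
  have inj: "inj_on \<rho> (Poly_Mapping.keys m)"
    using assms by (auto simp: inj_on_def)
  show ?thesis
    unfolding exponents_def keys image_mset_mset_set[OF inj, symmetric]
    by (simp add: multiset.map_comp comp_def lookup_rename_mono_inj(1)[OF assms])
qed

lemma rename_mono_id [simp]: "rename_mono id m = m"
proof (rule poly_mapping_eqI)
  fix i
  have "Poly_Mapping.lookup (rename_mono id m) i
      = (\<Sum>j\<in>Poly_Mapping.keys m. if j = i then Poly_Mapping.lookup m j else 0)"
    unfolding rename_mono_def lookup_sum
    by (rule sum.cong) (auto simp: lookup_single when_def)
  then show "Poly_Mapping.lookup (rename_mono id m) i = Poly_Mapping.lookup m i"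
    by (simp add: in_keys_iff)
qed

lemma rename_mono_inv:
  assumes "bij \<rho>"
  shows "rename_mono \<rho> (rename_mono (inv \<rho>) m) = m"
  using assms by (simp add: rename_mono_comp bij_def surj_iff)

text \<open>
  This and \<open>symmetric_functions_coeff\<close> replace invariance under all bijections by the more
  convenient condition that coefficients depend on the exponents alone.
\<close>

lemma symmetric_functionsI:
  assumes "\<And>m. coeff f m \<noteq> 0 \<Longrightarrow> mono_degree m \<le> d"
    and "\<And>m m'. exponents m = exponents m' \<Longrightarrow> coeff f m = coeff f m'"
  shows "f \<in> symmetric_functions"
  unfolding symmetric_functions_def
proof (intro CollectI conjI exI allI impI)
  fix \<rho> :: "'a \<Rightarrow> 'a" assume b: "bij \<rho>"
  show "rename \<rho> f = f"
  proof (rule mfps_eqI)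
    fix m
    let ?m' = "rename_mono (inv \<rho>) m"
    have "coeff (rename \<rho> f) (rename_mono \<rho> ?m') = coeff f ?m'"
      by (rule coeff_rename_inj(1)[OF bij_is_inj[OF b]])
    also have "\<dots> = coeff f m"
      by (rule assms(2)) (rule exponents_rename_mono[OF bij_is_inj[OF bij_imp_bij_inv[OF b]]])
    finally show "coeff (rename \<rho> f) m = coeff f m"
      by (simp add: rename_mono_inv[OF b])
  qed
qed (use assms(1) in blast)

lemma symmetric_functions_coeff:
  assumes "f \<in> symmetric_functions" "exponents m = exponents m'"
  shows "coeff f m = coeff f m'"
proof -
  obtain \<rho> where \<rho>: "bij \<rho>" "rename_mono \<rho> m = m'"
    using exponents_eq_imp_rename[OF assms(2)] by blast
  then show ?thesis
    using coeff_rename_inj(1)[OF bij_is_inj[OF \<rho>(1)], of f m] assms(1) by (auto simp: symmetric_functions_def)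
qed

lemma symmetric_functions_bounded:
  assumes "f \<in> symmetric_functions"
  shows "\<exists>d. \<forall>m. coeff f m \<noteq> 0 \<longrightarrow> mono_degree m \<le> d"
  using assms unfolding symmetric_functions_def by blast

lemma symmetric_functions_zero [simp]: "0 \<in> symmetric_functions"
  by (rule symmetric_functionsI[of _ 0]) auto

lemma symmetric_functions_one [simp]: "1 \<in> symmetric_functions"
proof (rule symmetric_functionsI[of _ 0])
  fix m m' :: "'a \<Rightarrow>\<^sub>0 nat"
  assume "exponents m = exponents m'"
  then show "coeff (1 :: ('a, rat) mfps) m = coeff 1 m'"
    by (simp add: coeff_one mono_degree_eq flip: mono_degree_eq_0_iff)
qed (auto simp: coeff_one mono_degree_eq_0_iff split: if_splits)

lemma symmetric_functions_add:
  assumes "f \<in> symmetric_functions" "g \<in> symmetric_functions"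
  shows "f + g \<in> symmetric_functions"
proof -
  obtain d where d: "\<And>m. coeff f m \<noteq> 0 \<Longrightarrow> mono_degree m \<le> d"
    using symmetric_functions_bounded[OF assms(1)] by blast
  obtain e where e: "\<And>m. coeff g m \<noteq> 0 \<Longrightarrow> mono_degree m \<le> e"
    using symmetric_functions_bounded[OF assms(2)] by blast
  show ?thesis
  proof (rule symmetric_functionsI[of _ "max d e"])
    fix m assume "coeff (f + g) m \<noteq> 0"
    then have "coeff f m \<noteq> 0 \<or> coeff g m \<noteq> 0" by auto
    then show "mono_degree m \<le> max d e" using d e by fastforce
  next
    fix m m' :: "'a \<Rightarrow>\<^sub>0 nat" assume "exponents m = exponents m'"
    then show "coeff (f + g) m = coeff (f + g) m'"
      using symmetric_functions_coeff[OF assms(1), of m m'] symmetric_functions_coeff[OF assms(2), of m m']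
      by simp
  qed
qed

lemma symmetric_functions_scale:
  assumes "f \<in> symmetric_functions"
  shows "const c * f \<in> symmetric_functions"
proof -
  obtain d where d: "\<And>m. coeff f m \<noteq> 0 \<Longrightarrow> mono_degree m \<le> d"
    using symmetric_functions_bounded[OF assms(1)] by blast
  show ?thesis
  proof (rule symmetric_functionsI[of _ d])
    fix m m' :: "'a \<Rightarrow>\<^sub>0 nat" assume "exponents m = exponents m'"
    then show "coeff (const c * f) m = coeff (const c * f) m'"
      using symmetric_functions_coeff[OF assms, of m m'] by simp
  qed (use d in auto)
qed

lemma symmetric_functions_mult:
  assumes "f \<in> symmetric_functions" "g \<in> symmetric_functions"
  shows "f * g \<in> symmetric_functions"
proof -
  obtain d where d: "\<And>m. coeff f m \<noteq> 0 \<Longrightarrow> mono_degree m \<le> d"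
    using symmetric_functions_bounded[OF assms(1)] by blast
  obtain e where e: "\<And>m. coeff g m \<noteq> 0 \<Longrightarrow> mono_degree m \<le> e"
    using symmetric_functions_bounded[OF assms(2)] by blast
  have "mono_degree m \<le> d + e" if nz: "coeff (f * g) m \<noteq> 0" for m
  proof -
    obtain x where x: "x \<in> splits m" "coeff f (fst x) * coeff g (snd x) \<noteq> 0"
      using nz unfolding coeff_mult by (meson sum.neutral)
    then have "mono_degree (fst x) \<le> d" "mono_degree (snd x) \<le> e" "m = fst x + snd x"
      using d e by (auto simp: splits_def)
    then show ?thesis by simp
  qed
  moreover have "rename \<rho> (f * g) = f * g" if b: "bij \<rho>" for \<rho> :: "'a \<Rightarrow> 'a"
  proof -
    have "rename \<rho> (f * g) = rename \<rho> f * rename \<rho> g"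
      by (rule rename_mult) (rule finite_vimage_inj[OF bij_is_inj[OF b]])
    also have "\<dots> = f * g"
      using assms b by (auto simp: symmetric_functions_def)
    finally show ?thesis .
  qed
  ultimately show ?thesis
    unfolding symmetric_functions_def by blast
qed

lemma symmetric_functions_sum:
  "(\<And>i. i \<in> I \<Longrightarrow> F i \<in> symmetric_functions) \<Longrightarrow> (\<Sum>i\<in>I. F i) \<in> symmetric_functions"
  by (induction I rule: infinite_finite_induct) (auto intro: symmetric_functions_add)

lemma symmetric_functions_prod_mset:
  "(\<And>i. i \<in># M \<Longrightarrow> F i \<in> symmetric_functions) \<Longrightarrow> (\<Prod>i\<in>#M. F i) \<in> symmetric_functions"
  by (induction M) (auto intro: symmetric_functions_mult)

lemma monomial_in_symmetric_functions: "monomial_sf \<mu> \<in> symmetric_functions"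
  by (rule symmetric_functionsI[of _ "sum_mset \<mu>"])
    (auto simp: monomial_sf_def mono_degree_eq split: if_splits)

lemma aug_monomial_in_symmetric_functions: "aug_monomial_sf \<mu> \<in> symmetric_functions"
  by (rule symmetric_functionsI[of _ "sum_mset \<mu>"])
    (auto simp: coeff_aug_monomial mono_degree_eq split: if_splits)

lemma elementary_in_symmetric_functions: "elementary n \<in> symmetric_functions"
proof (rule symmetric_functionsI[of _ n])
  fix m m' :: "'a \<Rightarrow>\<^sub>0 nat" assume eq: "exponents m = exponents m'"
  have "(\<forall>i. Poly_Mapping.lookup m i \<le> 1) \<longleftrightarrow> (\<forall>k\<in>#exponents m. k \<le> 1)" for m :: "'a \<Rightarrow>\<^sub>0 nat"
    by (force simp: set_mset_exponents in_keys_iff)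
  then show "coeff (elementary n) m = coeff (elementary n) m'"
    using eq by (simp add: elementary_def mono_degree_eq)
qed (auto simp: elementary_def split: if_splits)

lemma power_sum_eq_monomial:
  assumes "0 < n"
  shows "power_sum n = monomial_sf {#n#}"
proof -
  have "(\<exists>i. m = Poly_Mapping.single i n) \<longleftrightarrow> exponents m = {#n#}" for m :: "'a \<Rightarrow>\<^sub>0 nat"
  proof
    assume "exponents m = {#n#}"
    then have c: "card (Poly_Mapping.keys m) = 1" and l: "Poly_Mapping.lookup m ` Poly_Mapping.keys m = {n}"
      using set_mset_exponents[of m] by (auto simp: exponents_def dest: arg_cong[where f = size])
    obtain i where "Poly_Mapping.keys m = {i}" using c card_1_singletonE by blast
    then have "m = Poly_Mapping.single i n"
      using l by (intro poly_mapping_eqI) (auto simp: lookup_single when_def in_keys_iff)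
    then show "\<exists>i. m = Poly_Mapping.single i n" ..
  qed (use assms in \<open>auto simp: exponents_def\<close>)
  then show ?thesis
    unfolding power_sum_def monomial_sf_def by simp
qed

lemma power_sum_in_symmetric_functions: "0 < n \<Longrightarrow> power_sum n \<in> symmetric_functions"
  by (simp add: power_sum_eq_monomial monomial_in_symmetric_functions)

section \<open>Newton's identities\<close>

lemma elementary_0: "elementary 0 = 1"
proof (rule mfps_eqI)
  fix m show "coeff (elementary 0) m = coeff 1 m"
    by (auto simp: elementary_def coeff_one mono_degree_eq_0_iff)
qed

lemma complete_0: "complete 0 = 1"
  by (rule mfps_eqI) (auto simp: complete_def coeff_one mono_degree_eq_0_iff)

text \<open>
  The common part of both Newton identities: the coefficient of \<open>m\<close> is grouped by the variable that
  the power sum contributes.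
\<close>

lemma coeff_newton_sum:
  assumes "mono_degree m = n"
  shows "coeff (\<Sum>i=1..n. const (s i) * (power_sum i * f (n - i))) m
    = (\<Sum>v\<in>Poly_Mapping.keys m. \<Sum>i=1..Poly_Mapping.lookup m v.
        s i * coeff (f (n - i)) (m - Poly_Mapping.single v i))"
proof -
  let ?G = "\<lambda>i v. s i * coeff (f (n - i)) (m - Poly_Mapping.single v i)"
  have "coeff (\<Sum>i=1..n. const (s i) * (power_sum i * f (n - i))) m
      = (\<Sum>i=1..n. \<Sum>v | i \<le> Poly_Mapping.lookup m v. ?G i v)"
    by (simp add: coeff_sum coeff_power_sum_mult sum_distrib_left)
  also have "\<dots> = (\<Sum>i=1..n. \<Sum>v | v \<in> Poly_Mapping.keys m \<and> i \<le> Poly_Mapping.lookup m v. ?G i v)"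
    by (intro sum.cong refl) (auto simp: in_keys_iff)
  also have "\<dots> = (\<Sum>v\<in>Poly_Mapping.keys m. \<Sum>i | i \<in> {1..n} \<and> i \<le> Poly_Mapping.lookup m v. ?G i v)"
    by (rule sum.swap_restrict) auto
  also have "\<dots> = (\<Sum>v\<in>Poly_Mapping.keys m. \<Sum>i=1..Poly_Mapping.lookup m v. ?G i v)"
  proof (intro sum.cong refl)
    fix v
    show "{i. i \<in> {1..n} \<and> i \<le> Poly_Mapping.lookup m v} = {1..Poly_Mapping.lookup m v}"
      using lookup_le_mono_degree[of m v] assms by auto
  qed
  finally show ?thesis .
qed

lemma coeff_newton_sum_zero:
  assumes "mono_degree m \<noteq> n" "\<And>k m. coeff (f k) m \<noteq> 0 \<Longrightarrow> mono_degree m = k"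
  shows "coeff (\<Sum>i=1..n. const (s i) * (power_sum i * f (n - i))) m = 0"
proof -
  have "coeff (f (n - i)) (m - Poly_Mapping.single v i) = 0"
    if "i \<in> {1..n}" "i \<le> Poly_Mapping.lookup m v" for i v
    using assms(1) assms(2)[of "n - i" "m - Poly_Mapping.single v i"] mono_degree_minus_single[OF that(2)] that(1) by force
  then show ?thesis
    by (simp add: coeff_sum coeff_power_sum_mult)
qed

text \<open>
  A monomial of degree \<open>n\<close> is obtained once for each of its variables \<open>v\<close> and each \<open>i\<close> between \<open>1\<close>
  and the exponent of \<open>v\<close>, thus \<open>n\<close> times.
\<close>

lemma newton_complete: "of_nat n * complete n = (\<Sum>i=1..n. power_sum i * complete (n - i))"
proof (rule mfps_eqI)
  fix m :: "'v \<Rightarrow>\<^sub>0 nat"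
  have one: "(\<Sum>i=1..n. power_sum i * complete (n - i))
      = (\<Sum>i=1..n. const 1 * (power_sum i * complete (n - i)) :: ('v, rat) mfps)"
    by simp
  show "coeff (of_nat n * complete n) m = coeff (\<Sum>i=1..n. power_sum i * complete (n - i)) m"
  proof (cases "mono_degree m = n")
    case True
    have "coeff (\<Sum>i=1..n. power_sum i * complete (n - i)) m
        = (\<Sum>v\<in>Poly_Mapping.keys m. \<Sum>i=1..Poly_Mapping.lookup m v. 1)"
      unfolding one coeff_newton_sum[OF True, of "\<lambda>_. 1" complete]
    proof (intro sum.cong refl)
      fix v i assume "i \<in> {1..Poly_Mapping.lookup m v}"
      then have "mono_degree (m - Poly_Mapping.single v i) = n - i"
        using mono_degree_minus_single[of i m v] True by simp
      then show "1 * coeff (complete (n - i)) (m - Poly_Mapping.single v i) = (1 :: rat)"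
        by (simp add: complete_def)
    qed
    also have "\<dots> = of_nat n"
      by (simp add: mono_degree_def flip: True)
    finally show ?thesis
      using True by (simp add: complete_def flip: const_of_nat)
  next
    case False
    then show ?thesis
      unfolding one
      by (subst coeff_newton_sum_zero) (auto simp: complete_def simp flip: const_of_nat split: if_splits)
  qed
qed

text \<open>
  A variable with exponent \<open>1\<close> contributes only for \<open>i = 1\<close>; one with exponent \<open>l \<ge> 2\<close> contributes
  at most for \<open>i = l - 1\<close> and \<open>i = l\<close>, with opposite signs.
\<close>

lemma newton_elementary:
  "of_nat n * elementary n = (\<Sum>i=1..n. const ((-1) ^ (i - 1)) * (power_sum i * elementary (n - i)))"
proof (rule mfps_eqI)
  fix m :: "'v \<Rightarrow>\<^sub>0 nat"
  show "coeff (of_nat n * elementary n) m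
      = coeff (\<Sum>i=1..n. const ((-1) ^ (i - 1)) * (power_sum i * elementary (n - i))) m"
  proof (cases "mono_degree m = n")
    case True
    let ?l = "Poly_Mapping.lookup m"
    let ?sf = "\<forall>i. ?l i \<le> 1"
    have inner: "(\<Sum>i=1..?l v. (-1) ^ (i - 1) * coeff (elementary (n - i)) (m - Poly_Mapping.single v i))
        = (if ?sf then 1 else (0::rat))" if v: "v \<in> Poly_Mapping.keys m" for v
    proof -
      let ?R = "\<forall>u. u \<noteq> v \<longrightarrow> ?l u \<le> 1"
      have "(\<Sum>i=1..?l v. (-1) ^ (i - 1) * coeff (elementary (n - i)) (m - Poly_Mapping.single v i))
          = (\<Sum>i=1..?l v. if ?R \<and> ?l v - i \<le> 1 then (-1) ^ (i - 1) else (0::rat))"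
      proof (rule sum.cong[OF refl])
        fix i assume "i \<in> {1..?l v}"
        then have "mono_degree (m - Poly_Mapping.single v i) = n - i"
          using mono_degree_minus_single[of i m v] True by simp
        moreover have "(\<forall>u. Poly_Mapping.lookup (m - Poly_Mapping.single v i) u \<le> 1) \<longleftrightarrow> ?R \<and> ?l v - i \<le> 1"
          by (auto simp: Poly_Mapping.lookup_minus lookup_single when_def)
        ultimately have "coeff (elementary (n - i)) (m - Poly_Mapping.single v i)
            = (if ?R \<and> ?l v - i \<le> 1 then 1 else 0)"
          unfolding elementary_def coeff_Mfps by (simp only: simp_thms)
        then show "(-1) ^ (i - 1) * coeff (elementary (n - i)) (m - Poly_Mapping.single v i)
            = (if ?R \<and> ?l v - i \<le> 1 then (-1) ^ (i - 1) else (0::rat))"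
          by (simp only: if_distrib[of "(*) ((-1) ^ (i - 1))"] mult_1_right mult_zero_right)
      qed
      also have "\<dots> = (if ?sf then 1 else 0)"
      proof (cases "?l v = 1")
        case True
        then have R: "?R \<longleftrightarrow> ?sf" by (metis order_refl)
        have "(\<Sum>i=1..?l v. if ?R \<and> ?l v - i \<le> 1 then (-1) ^ (i - 1) else (0::rat))
            = (if ?R then 1 else 0)"
          unfolding True atLeastAtMost_singleton by auto
        then show ?thesis unfolding R .
      next
        case False
        with v obtain k where k: "?l v = Suc (Suc k)"
          by (metis One_nat_def in_keys_iff not0_implies_Suc)
        then have "\<not> ?sf" by (metis Suc_le_mono not_one_le_zero One_nat_def le_zero_eq Zero_not_Suc)
        moreover have "(\<Sum>i=1..?l v. if ?R \<and> ?l v - i \<le> 1 then (-1) ^ (i - 1) else (0::rat)) = 0"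
        proof (cases ?R)
          case True
          have "(\<Sum>i=1..?l v. if ?R \<and> ?l v - i \<le> 1 then (-1) ^ (i - 1) else (0::rat))
              = (\<Sum>i\<in>{Suc k, Suc (Suc k)}. (-1) ^ (i - 1))"
            by (rule sum.mono_neutral_cong_right) (use True k in auto)
          then show ?thesis by simp
        qed (simp only: simp_thms if_False sum.neutral_const)
        ultimately show ?thesis by simp
      qed
      finally show ?thesis .
    qed
    have "coeff (\<Sum>i=1..n. const ((-1) ^ (i - 1)) * (power_sum i * elementary (n - i))) m
        = (\<Sum>v\<in>Poly_Mapping.keys m. if ?sf then 1 else (0::rat))"
      unfolding coeff_newton_sum[OF True, of "\<lambda>i. (-1) ^ (i - 1)" elementary] by (rule sum.cong[OF refl inner])
    also have "\<dots> = (if ?sf then of_nat n else 0)"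
    proof (cases ?sf)
      case sf: True
      have "?l v = 1" if "v \<in> Poly_Mapping.keys m" for v
        using sf that by (metis in_keys_iff le_antisym less_one linorder_not_le)
      then have "n = card (Poly_Mapping.keys m)"
        using True by (simp add: mono_degree_def)
      then show ?thesis using sf by simp
    next
      case False
      then show ?thesis by (simp only: if_False sum.neutral_const)
    qed
    finally show ?thesis
      using True by (simp add: elementary_def flip: const_of_nat)
  next
    case False
    then show ?thesis
      by (subst coeff_newton_sum_zero) (auto simp: elementary_def simp flip: const_of_nat split: if_splits)
  qed
qed

section \<open>Orbits of permutations\<close>

text \<open>
  For a permutation \<open>w\<close> of a finite set \<open>V\<close> these are the vertex sets of the cycles of \<open>w\<close>, with
  fixed points as singletons.
\<close>

definition orbits :: "('a \<Rightarrow> 'a) \<Rightarrow> 'a set \<Rightarrow> 'a set set" where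
  "orbits w V = orbit w ` V"

lemma orbit_permutes:
  assumes "w permutes V" "finite V"
  shows "v \<in> orbit w v" "u \<in> orbit w v \<Longrightarrow> orbit w u = orbit w v"
    "v \<in> V \<Longrightarrow> orbit w v \<subseteq> V"
proof -
  have "permutation w" using assms by (auto simp: permutation_permutes)
  then show "v \<in> orbit w v" by (rule permutation_self_in_orbit)
  show "u \<in> orbit w v \<Longrightarrow> orbit w u = orbit w v"
    using orbit_cyclic_eq3[OF cyclic_on_orbit[OF assms]] by blast
  show "v \<in> V \<Longrightarrow> orbit w v \<subseteq> V"
    by (rule permutes_orbit_subset[OF assms(1)])
qed

lemma orbits_memD:
  assumes "w permutes V" "finite V" "C \<in> orbits w V" "u \<in> C"
  shows "orbit w u = C" "u \<in> V" "w u \<in> C"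
proof -
  note o = orbit_permutes[OF assms(1,2)]
  obtain v where v: "v \<in> V" "C = orbit w v" using assms(3) by (auto simp: orbits_def)
  show "orbit w u = C" using o(2) assms(4) v(2) by blast
  show "u \<in> V" using o(3) assms(4) v by blast
  show "w u \<in> C" using assms(4) unfolding v(2) by (rule orbit.step)
qed

lemma orbits_props:
  assumes "w permutes V" "finite V"
  shows "finite (orbits w V)" "\<Union> (orbits w V) = V"
    "C \<in> orbits w V \<Longrightarrow> C \<noteq> {}" "C \<in> orbits w V \<Longrightarrow> finite C"
    "C \<in> orbits w V \<Longrightarrow> C' \<in> orbits w V \<Longrightarrow> C \<noteq> C' \<Longrightarrow> C \<inter> C' = {}"
proof -
  note o = orbit_permutes[OF assms]
  show "finite (orbits w V)" using assms by (simp add: orbits_def)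
  show "\<Union> (orbits w V) = V" using o(1,3) by (auto simp: orbits_def)
  show "C \<noteq> {}" if "C \<in> orbits w V" using o(1) that by (auto simp: orbits_def)
  show "finite C" if "C \<in> orbits w V"
    using o(3) that assms(2) by (auto simp: orbits_def intro: finite_subset)
  show "C \<inter> C' = {}" if "C \<in> orbits w V" "C' \<in> orbits w V" "C \<noteq> C'"
    using that orbits_memD(1)[OF assms] by blast
qed

lemma orbit_const:
  assumes "u \<in> orbit w v" "\<And>x. x \<in> orbit w v \<Longrightarrow> \<kappa> (w x) = \<kappa> x" "\<kappa> (w v) = \<kappa> v"
  shows "\<kappa> u = \<kappa> v"
  using assms(1)
proof (induction rule: orbit.induct)
  case base
  show ?case by (rule assms(3))
next
  case (step y)
  then show ?case using assms(2)[of y] by simp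
qed

text \<open>
  Cycles and paths of a cover are described by lists of vertices. The list chosen here starts
  at \<open>w v\<close> and ends at \<open>v\<close>, so that dropping the arc from \<open>v\<close> turns the cycle into a path
  described by the same list.
\<close>

lemma orbit_obtain_list:
  assumes "w permutes V" "finite V"
  obtains vs where "vs \<noteq> []" "distinct vs" "set vs = orbit w v" "last vs = v" "rotate1 vs = map w vs"
proof -
  define k where "k = funpow_dist1 w v v"
  have self: "v \<in> orbit w v" using orbit_permutes[OF assms] by blast
  have k: "(w ^^ k) v = v" "0 < k"
    using funpow_dist1_prop[OF self] by (auto simp: k_def)
  have inj: "inj_on (\<lambda>n. (w ^^ n) v) {0..<k}"
    unfolding k_def by (rule inj_on_funpow_dist1[OF self])
  have orb: "orbit w v = (\<lambda>n. (w ^^ n) v) ` {0..<k}"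
    unfolding k_def by (rule orbit_conv_funpow_dist1[OF self])
  define vs where "vs = map (\<lambda>i. (w ^^ Suc i) v) [0..<k]"
  have len: "length vs = k" by (simp add: vs_def)
  have "inj_on (\<lambda>i. (w ^^ Suc i) v) {0..<k}"
    using inj permutes_inj[OF assms(1)] by (auto simp: inj_on_def dest: injD)
  then have dist: "distinct vs" by (simp add: vs_def distinct_map)
  have rot: "rotate1 vs = map w vs"
  proof (rule nth_equalityI)
    fix i assume "i < length (rotate1 vs)"
    then have i: "i < k" by (simp add: len)
    show "rotate1 vs ! i = map w vs ! i"
    proof (cases "Suc i = k")
      case True
      have "vs ! i = (w ^^ Suc i) v" "vs ! 0 = w v"
        using i k by (simp_all add: vs_def)
      then show ?thesis
        using i k True len by (simp add: nth_rotate1)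
    next
      case False
      then show ?thesis
        using i len by (simp add: nth_rotate1 vs_def)
    qed
  qed simp
  have "set vs \<subseteq> orbit w v"
    by (auto simp: vs_def simp del: funpow.simps intro!: funpow_in_orbit[OF self])
  moreover have "card (set vs) = card (orbit w v)"
    using dist inj by (simp add: distinct_card len orb card_image)
  moreover have "finite (orbit w v)" by (simp add: orb)
  ultimately have "set vs = orbit w v" by (metis card_subset_eq)
  moreover have "last vs = v" "vs \<noteq> []"
    using k by (cases k; simp add: vs_def)+
  ultimately show ?thesis using that dist rot by blast
qed

lemma orbit_eq_list:
  assumes "rotate1 vs = map w vs" "v \<in> set vs"
  shows "orbit w v = set vs"
proof
  have step: "w u \<in> set vs" if "u \<in> set vs" for u
    using that by (metis assms(1) imageI list.set_map set_rotate1)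
  show "orbit w v \<subseteq> set vs"
  proof
    fix u assume "u \<in> orbit w v"
    then show "u \<in> set vs" by induction (use step assms(2) in auto)
  qed
  let ?k = "length vs"
  obtain i where i: "v = vs ! i" "i < ?k" using assms(2) by (metis in_set_conv_nth)
  have pow: "(w ^^ n) v = vs ! ((i + n) mod ?k)" for n
  proof (induction n)
    case (Suc n)
    have lt: "(i + n) mod ?k < ?k" by (rule mod_less_divisor) (use i(2) in linarith)
    have "(w ^^ Suc n) v = map w vs ! ((i + n) mod ?k)" using Suc lt by simp
    also have "\<dots> = vs ! (Suc ((i + n) mod ?k) mod ?k)"
      using lt by (simp add: nth_rotate1 flip: assms(1))
    finally show ?case by (simp add: mod_Suc_eq)
  qed (use i in simp)
  show "set vs \<subseteq> orbit w v"
  proof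
    fix u assume "u \<in> set vs"
    then obtain j where j: "u = vs ! j" "j < ?k" by (metis in_set_conv_nth)
    have "(w ^^ (j + ?k - i)) v = u"
      unfolding pow using i j by simp
    moreover have "0 < j + ?k - i" using i j by simp
    ultimately show "u \<in> orbit w v" unfolding orbit_altdef by blast
  qed
qed

lemma rotate1_eq_map:
  assumes "\<And>a b. (a, b) \<in> set (zip vs (rotate1 vs)) \<Longrightarrow> w a = b"
  shows "rotate1 vs = map w vs"
proof (rule nth_equalityI)
  fix i assume "i < length (rotate1 vs)"
  then have "(vs ! i, rotate1 vs ! i) \<in> set (zip vs (rotate1 vs))"
    by (auto simp: set_zip)
  then show "rotate1 vs ! i = map w vs ! i"
    using assms \<open>i < length (rotate1 vs)\<close> by simp
qed simp

lemma set_zip_rotate1: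
  assumes "vs \<noteq> []"
  shows "set (zip vs (rotate1 vs)) = insert (last vs, hd vs) (set (zip vs (tl vs)))"
    "set (zip vs (tl vs)) = set (zip (butlast vs) (tl vs))"
proof -
  obtain us l where vs: "vs = us @ [l]" using assms by (cases vs rule: rev_cases) auto
  have len: "length us = length (tl vs)" by (simp add: vs)
  have z: "zip vs (tl vs) = zip us (tl vs)"
    unfolding vs using len by (simp add: zip_append1 vs)
  have "rotate1 vs = tl vs @ [hd vs]" using assms by (cases vs) auto
  then have "zip vs (rotate1 vs) = zip (us @ [l]) (tl vs @ [hd vs])" by (simp add: vs)
  also have "\<dots> = zip us (tl vs) @ [(l, hd vs)]" using len by simp
  finally show "set (zip vs (rotate1 vs)) = insert (last vs, hd vs) (set (zip vs (tl vs)))"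
    using z by (simp add: vs)
  show "set (zip vs (tl vs)) = set (zip (butlast vs) (tl vs))"
    using z by (simp add: vs)
qed

text \<open>
  Induction on \<open>V\<close>, writing a permutation of \<open>V \<union> {a}\<close> as \<open>(a b) \<circ> q\<close> with \<open>q\<close> a permutation of \<open>V\<close>.
  If \<open>b = a\<close>, a fixed point is added; otherwise \<open>a\<close> is inserted just before \<open>b\<close> into the orbit of \<open>b\<close>,
  and the sign and the size of that orbit change together.
\<close>

lemma sign_eq_prod_orbits:
  assumes "finite V" "p permutes V"
  shows "sign p = (\<Prod>C\<in>orbits p V. (-1) ^ (card C - 1))"
  using assms
proof (induction V arbitrary: p rule: finite_induct)
  case empty
  then show ?case by (simp add: orbits_def)
next
  case (insert a V)
  obtain b q where bq: "p = transpose a b \<circ> q" "b \<in> insert a V" "q permutes V"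
  proof -
    have "p \<in> {p. p permutes insert a V}" using insert.prems by simp
    then show thesis unfolding permutes_insert by (auto intro: that)
  qed
  have q: "q permutes V" "finite V" using bq insert by auto
  note oq = orbit_permutes[OF q] and pq = orbits_props[OF q]
  have qa: "q a = a" using q insert.hyps by (simp add: permutes_not_in)
  show ?case
  proof (cases "b = a")
    case True
    then have "p = q" using bq by simp
    moreover have "orbit q a = {a}" using qa by (simp add: orbit_eq_singleton_iff)
    moreover have "{a} \<notin> orbits q V" using pq(2) insert.hyps by auto
    ultimately show ?thesis
      using insert.IH[OF q(1)] pq(1) by (simp add: orbits_def)
  next
    case False
    then have b: "b \<in> V" using bq by simp
    define C where "C = orbit q b"
    have C: "C \<in> orbits q V" "b \<in> C" using b oq by (auto simp: C_def orbits_def)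
    define x where "x = inv q b"
    have qx: "q x = b" using q(1) by (simp add: x_def permutes_inverses)
    have "b \<in> orbit q x" using orbit.base[of q x] qx by simp
    then have "orbit q x = C" using oq(2) by (auto simp: C_def)
    then obtain vs where vs: "vs \<noteq> []" "distinct vs" "set vs = C" "last vs = x" "rotate1 vs = map q vs"
      using orbit_obtain_list[OF q, of x] by metis
    obtain us where us: "vs = us @ [x]" using vs by (metis append_butlast_last_id)
    have aC: "a \<notin> C" using C pq(2) insert.hyps by blast
    have tl: "tl vs = map q us" "hd vs = b"
    proof -
      have "rotate1 vs = tl vs @ [hd vs]" using vs(1) by (cases vs) auto
      moreover have "map q vs = map q us @ [b]" by (simp add: us qx)
      ultimately show "tl vs = map q us" "hd vs = b" using vs(5) by simp_all
    qed
    have pu: "p u = q u" if "u \<noteq> x" "u \<noteq> a" for u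
    proof -
      have "q u \<noteq> b" using that(1) qx permutes_inj[OF q(1)] by (metis injD)
      moreover have "q u \<noteq> a" using that(2) qa permutes_inj[OF q(1)] by (metis injD)
      ultimately show ?thesis by (simp add: bq)
    qed
    have px: "p x = a" "p a = b" using qx qa by (simp_all add: bq)
    have "map p us = map q us"
    proof (rule map_cong[OF refl])
      fix u assume "u \<in> set us"
      then have "u \<noteq> x" "u \<noteq> a" using vs us aC by auto
      then show "p u = q u" by (rule pu)
    qed
    then have "map p (vs @ [a]) = tl vs @ [a, hd vs]"
      by (simp add: us px tl(1)[unfolded us] tl(2)[unfolded us])
    also have "\<dots> = rotate1 (vs @ [a])"
      using vs(1) by (cases vs) auto
    finally have orbC: "orbit p v = insert a C" if "v \<in> insert a C" for v
      using orbit_eq_list[of "vs @ [a]" p v] that vs(3) by simp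
    have orbO: "orbit p v = orbit q v" if "v \<in> V" "v \<notin> C" for v
    proof (rule orbit_cong)
      show "v \<in> orbit q v" by (rule oq)
      fix s assume s: "s \<in> orbit q v"
      then have "orbit q s = orbit q v" by (rule oq)
      moreover have "orbit q v \<noteq> C" using that oq by blast
      ultimately have "s \<noteq> x" using \<open>orbit q x = C\<close> by auto
      moreover have "s \<noteq> a" using s that oq(3)[of v] insert.hyps by blast
      ultimately show "p s = q s" by (rule pu)
    qed
    have "orbits p (insert a V) = insert (insert a C) (orbits q V - {C})"
    proof -
      have "orbit p ` C = {insert a C}" using orbC C by auto
      moreover have "orbit p ` (V - C) = orbit q ` (V - C)"
        using orbO by (intro image_cong) auto
      moreover have "orbit q ` (V - C) = orbits q V - {C}"
        using oq(1) orbits_memD(1)[OF q C(1)] by (auto simp: orbits_def)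
      moreover have "V = C \<union> (V - C)" using C pq(2) by auto
      ultimately show ?thesis
        unfolding orbits_def using orbC[of a] by (metis Un_insert_left image_Un image_insert insertI1 insert_absorb2 insert_is_Un)
    qed
    moreover have "insert a C \<notin> orbits q V - {C}" using pq(2) insert.hyps by auto
    ultimately have "(\<Prod>C\<in>orbits p (insert a V). (-1) ^ (card C - 1))
        = (-1) ^ (card (insert a C) - 1) * (\<Prod>C\<in>orbits q V - {C}. (-1) ^ (card C - 1) :: int)"
      using pq(1) by simp
    also have "(-1) ^ (card (insert a C) - 1) = - ((-1) ^ (card C - 1) :: int)"
    proof -
      have "card (insert a C) - 1 = Suc (card C - 1)"
        using aC pq(3,4)[OF C(1)] card_gt_0_iff[of C] by simp
      then show ?thesis by simp
    qed
    also have "- ((-1) ^ (card C - 1)) * (\<Prod>C\<in>orbits q V - {C}. (-1) ^ (card C - 1) :: int)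
        = - (\<Prod>C\<in>orbits q V. (-1) ^ (card C - 1))"
      using pq(1) C(1) by (simp add: prod.remove)
    also have "\<dots> = - sign q" using insert.IH[OF q(1)] by simp
    also have "\<dots> = sign p"
    proof -
      have "permutation q" using q permutation_permutes by blast
      then show ?thesis
        using False by (simp add: bq(1) sign_compose permutation_swap_id sign_swap_id)
    qed
    finally show ?thesis ..
  qed
qed

section \<open>Colourings constant on blocks\<close>

text \<open>
  A colouring of the blocks is the same as a colouring of the points that is constant on blocks.
  The set of points does not change when the blocks do, so colourings for different families of
  blocks can be compared after this translation.
\<close>

lemma card_block_colourings:
  assumes disj: "\<And>B B'. B \<in> Q \<Longrightarrow> B' \<in> Q \<Longrightarrow> B \<noteq> B' \<Longrightarrow> B \<inter> B' = {}"
    and ne: "\<And>B. B \<in> Q \<Longrightarrow> B \<noteq> {}"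
    and P: "\<And>\<gamma> \<kappa>. \<gamma> \<in> Q \<rightarrow>\<^sub>E UNIV \<Longrightarrow> \<kappa> \<in> \<Union>Q \<rightarrow>\<^sub>E UNIV \<Longrightarrow>
      (\<And>B u. B \<in> Q \<Longrightarrow> u \<in> B \<Longrightarrow> \<kappa> u = \<gamma> B) \<Longrightarrow> P \<gamma> \<longleftrightarrow> P' \<kappa>"
  shows "card {\<gamma> \<in> Q \<rightarrow>\<^sub>E UNIV. P \<gamma>}
    = card {\<kappa> \<in> \<Union>Q \<rightarrow>\<^sub>E UNIV. (\<forall>B\<in>Q. \<forall>u\<in>B. \<forall>v\<in>B. \<kappa> u = \<kappa> v) \<and> P' \<kappa>}"
proof -
  define bc where "bc \<kappa> \<longleftrightarrow> (\<forall>B\<in>Q. \<forall>u\<in>B. \<forall>v\<in>B. \<kappa> u = \<kappa> v)" for \<kappa> :: "'a \<Rightarrow> 'b"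
  have bcD: "\<kappa> u = \<kappa> v" if "bc \<kappa>" "B \<in> Q" "u \<in> B" "v \<in> B" for \<kappa> B u v
    using that unfolding bc_def by blast
  have bcF: "bc \<kappa>" if "\<And>B u. B \<in> Q \<Longrightarrow> u \<in> B \<Longrightarrow> \<kappa> u = f B" for \<kappa> and f :: "'a set \<Rightarrow> 'b"
    unfolding bc_def using that by simp
  define blk where "blk u = (THE B. B \<in> Q \<and> u \<in> B)" for u
  have blk: "blk u = B" if "B \<in> Q" "u \<in> B" for u B
    unfolding blk_def using that disj by (intro the_equality) blast+
  define F where "F \<gamma> = (\<lambda>u\<in>\<Union>Q. \<gamma> (blk u))" for \<gamma> :: "'a set \<Rightarrow> 'b"
  define G where "G \<kappa> = (\<lambda>B\<in>Q. \<kappa> (SOME u. u \<in> B))" for \<kappa> :: "'a \<Rightarrow> 'b"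
  have Fu: "F \<gamma> u = \<gamma> B" if "B \<in> Q" "u \<in> B" for \<gamma> u B
    using that blk[OF that] by (auto simp: F_def)
  have Fmem: "F \<gamma> \<in> \<Union>Q \<rightarrow>\<^sub>E UNIV" for \<gamma>
    by (simp add: F_def)
  have some: "(SOME u. u \<in> B) \<in> B" if "B \<in> Q" for B
    using ne[OF that] by (simp add: some_in_eq)
  show ?thesis
    unfolding bc_def[symmetric]
  proof (rule bij_betw_same_card[of F], rule bij_betw_byWitness[where f' = G])
    show "\<forall>\<gamma>\<in>{\<gamma> \<in> Q \<rightarrow>\<^sub>E UNIV. P \<gamma>}. G (F \<gamma>) = \<gamma>"
    proof
      fix \<gamma> assume "\<gamma> \<in> {\<gamma> \<in> Q \<rightarrow>\<^sub>E UNIV. P \<gamma>}"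
      then show "G (F \<gamma>) = \<gamma>"
        by (intro extensionalityI[of _ Q]) (auto simp: G_def Fu some PiE_def)
    qed
    show "F ` {\<gamma> \<in> Q \<rightarrow>\<^sub>E UNIV. P \<gamma>}
        \<subseteq> {\<kappa> \<in> \<Union>Q \<rightarrow>\<^sub>E UNIV. bc \<kappa> \<and> P' \<kappa>}"
    proof
      fix \<kappa> assume "\<kappa> \<in> F ` {\<gamma> \<in> Q \<rightarrow>\<^sub>E UNIV. P \<gamma>}"
      then obtain \<gamma> where g: "\<gamma> \<in> Q \<rightarrow>\<^sub>E UNIV" "P \<gamma>" "\<kappa> = F \<gamma>" by blast
      have "P' (F \<gamma>)" using P[OF g(1) Fmem Fu] g(2) by blast
      then show "\<kappa> \<in> {\<kappa> \<in> \<Union>Q \<rightarrow>\<^sub>E UNIV. bc \<kappa> \<and> P' \<kappa>}"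
        unfolding g(3) using Fmem bcF[of "F \<gamma>" \<gamma>, OF Fu] by blast
    qed
    have FG: "F (G \<kappa>) = \<kappa>" if k: "\<kappa> \<in> \<Union>Q \<rightarrow>\<^sub>E UNIV" "bc \<kappa>" for \<kappa>
    proof (rule extensionalityI[of _ "\<Union>Q"])
      fix u assume "u \<in> \<Union>Q"
      then obtain B where B: "B \<in> Q" "u \<in> B" by blast
      then show "F (G \<kappa>) u = \<kappa> u" using bcD[OF k(2) B(1) some[OF B(1)] B(2)] by (simp add: Fu G_def)
    qed (use k(1) Fmem in \<open>auto simp: PiE_def\<close>)
    then show "\<forall>\<kappa>\<in>{\<kappa> \<in> \<Union>Q \<rightarrow>\<^sub>E UNIV. bc \<kappa> \<and> P' \<kappa>}. F (G \<kappa>) = \<kappa>"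
      by (intro ballI FG) blast+
    show "G ` {\<kappa> \<in> \<Union>Q \<rightarrow>\<^sub>E UNIV. bc \<kappa> \<and> P' \<kappa>}
        \<subseteq> {\<gamma> \<in> Q \<rightarrow>\<^sub>E UNIV. P \<gamma>}"
    proof
      fix \<gamma> assume "\<gamma> \<in> G ` {\<kappa> \<in> \<Union>Q \<rightarrow>\<^sub>E UNIV. bc \<kappa> \<and> P' \<kappa>}"
      then obtain \<kappa> where k: "\<kappa> \<in> \<Union>Q \<rightarrow>\<^sub>E UNIV" "bc \<kappa>" "P' \<kappa>" "\<gamma> = G \<kappa>"
        by blast
      have G: "G \<kappa> \<in> Q \<rightarrow>\<^sub>E UNIV" by (simp add: G_def)
      have "\<kappa> u = G \<kappa> B" if "B \<in> Q" "u \<in> B" for B u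
        using that bcD[OF k(2) that(1) some[OF that(1)] that(2)] by (simp add: G_def)
      then have "P (G \<kappa>)" using P[OF G k(1)] k(3) by blast
      then show "\<gamma> \<in> {\<gamma> \<in> Q \<rightarrow>\<^sub>E UNIV. P \<gamma>}" using G k(4) by blast
    qed
  qed
qed

lemma single_sum: "Poly_Mapping.single i (\<Sum>u\<in>B. wt u) = (\<Sum>u\<in>B. Poly_Mapping.single i (wt u))"
  by (induction B rule: infinite_finite_induct) (auto simp: single_add)

lemma colour_monomial_blocks:
  assumes "\<And>B B'. B \<in> Q \<Longrightarrow> B' \<in> Q \<Longrightarrow> B \<noteq> B' \<Longrightarrow> B \<inter> B' = {}"
    and "\<And>B. B \<in> Q \<Longrightarrow> finite B"
    and "\<And>B u. B \<in> Q \<Longrightarrow> u \<in> B \<Longrightarrow> \<kappa> u = \<gamma> B"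
  shows "colour_monomial Q (sum wt) \<gamma> = colour_monomial (\<Union>Q) wt \<kappa>"
proof -
  have "colour_monomial (\<Union>Q) wt \<kappa> = (\<Sum>B\<in>Q. \<Sum>u\<in>B. Poly_Mapping.single (\<kappa> u) (wt u))"
    unfolding colour_monomial_def using sum.Union_disjoint[of Q] assms(1,2) by simp
  also have "\<dots> = (\<Sum>B\<in>Q. \<Sum>u\<in>B. Poly_Mapping.single (\<gamma> B) (wt u))"
    by (intro sum.cong refl) (simp add: assms(3))
  finally show ?thesis by (simp add: colour_monomial_def single_sum)
qed

section \<open>Permutations extending a path-cycle cover\<close>

text \<open>
  A cover of any digraph with these vertices: the paths and cycles of \<open>S\<close>, and hence its symmetric
  functions, are determined by \<open>S\<close> and the vertex set.
\<close>

locale cover =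
  fixes D :: "'a pair_pre_digraph" and S :: "'a rel"
  assumes finite_verts: "finite (pverts D)"
    and arcs_subset: "S \<subseteq> pverts D \<times> pverts D"
    and inj_fst: "inj_on fst S" and inj_snd: "inj_on snd S"
begin

abbreviation "V \<equiv> pverts D"

definition tails :: "'a set" where
  "tails = fst ` S"

definition extensions :: "('a \<Rightarrow> 'a) set" where
  "extensions = {w. w permutes V \<and> (\<forall>(u, v)\<in>S. w u = v)}"

text \<open>
  In terms of the extension \<open>w\<close>, an orbit contained in \<open>tails\<close> is a cycle of \<open>S\<close>, while an open orbit
  passes through at least one arc of \<open>w\<close> outside \<open>S\<close>.
\<close>

definition full_orbits :: "('a \<Rightarrow> 'a) \<Rightarrow> 'a set set" where
  "full_orbits w = {C \<in> orbits w V. C \<subseteq> tails}"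

definition open_orbits :: "('a \<Rightarrow> 'a) \<Rightarrow> 'a set set" where
  "open_orbits w = {C \<in> orbits w V. \<not> C \<subseteq> tails}"

text \<open>
  These vertices are the union of the open orbits of every extension, so that colourings can be
  compared across extensions.
\<close>

definition path_verts :: "'a set" where
  "path_verts = V - \<Union> (cycle_sets D S)"

lemma tails_subset: "tails \<subseteq> V"
  using arcs_subset by (auto simp: tails_def)

lemma finite_extensions: "finite extensions"
  using finite_permutations[OF finite_verts] by (auto simp: extensions_def)

lemma extensionsD:
  assumes "w \<in> extensions"
  shows "w permutes V" "(u, v) \<in> S \<longleftrightarrow> u \<in> tails \<and> v = w u" "(u, v) \<in> S \<Longrightarrow> w u = v"
proof -
  show "w permutes V" and 1: "(u, v) \<in> S \<Longrightarrow> w u = v" for u v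
    using assms by (auto simp: extensions_def)
  then show "(u, v) \<in> S \<longleftrightarrow> u \<in> tails \<and> v = w u"
    by (force simp: tails_def)
qed

lemma incident_arcs_orbit:
  assumes w: "w \<in> extensions" and C: "C \<in> orbits w V"
  shows "incident_arcs S C = {(u, w u) |u. u \<in> C \<inter> tails}"
proof -
  have "u \<in> C" if "u \<in> tails" "w u \<in> C" for u
  proof -
    have u: "u \<in> orbit w u" "w u \<in> orbit w u"
      using orbit_permutes(1)[OF extensionsD(1)[OF w] finite_verts] orbit.base[of w u] by auto
    have "orbit w (w u) = C"
      using orbits_memD(1)[OF extensionsD(1)[OF w] finite_verts C that(2)] .
    moreover have "orbit w (w u) = orbit w u"
      using orbit_permutes(2)[OF extensionsD(1)[OF w] finite_verts u(2)] .
    ultimately show ?thesis using u by simp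
  qed
  then show ?thesis
    using orbits_memD(3)[OF extensionsD(1)[OF w] finite_verts C]
    by (auto simp: incident_arcs_def extensionsD(2)[OF w])
qed

lemma full_orbits_eq_cycle_sets:
  assumes w: "w \<in> extensions"
  shows "full_orbits w = cycle_sets D S"
proof (intro set_eqI iffI)
  note wp = extensionsD(1)[OF w]
  fix C assume "C \<in> full_orbits w"
  then have C: "C \<in> orbits w V" "C \<subseteq> tails" by (auto simp: full_orbits_def)
  then obtain v where v: "C = orbit w v" by (auto simp: orbits_def)
  obtain vs where vs: "vs \<noteq> []" "distinct vs" "set vs = C" "rotate1 vs = map w vs"
    using orbit_obtain_list[OF wp finite_verts] v by metis
  have "incident_arcs S (set vs) = set (zip vs (rotate1 vs))"
    using incident_arcs_orbit[OF w C(1)] C(2) vs(3,4) by (auto simp: zip_map2 zip_same_conv_map)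
  moreover have "set vs \<subseteq> V" using orbits_memD(2)[OF wp finite_verts C(1)] vs(3) by blast
  ultimately show "C \<in> cycle_sets D S"
    using vs unfolding cycle_sets_def by blast
next
  fix C assume "C \<in> cycle_sets D S"
  then obtain vs where vs: "C = set vs" "vs \<noteq> []" "set vs \<subseteq> V"
      "incident_arcs S (set vs) = set (zip vs (rotate1 vs))"
    unfolding cycle_sets_def by blast
  have sub: "set (zip vs (rotate1 vs)) \<subseteq> S"
    using vs(4) by (auto simp: incident_arcs_def)
  have "rotate1 vs = map w vs"
    by (rule rotate1_eq_map) (use sub extensionsD(3)[OF w] in blast)
  then have orb: "orbit w (hd vs) = C"
    using orbit_eq_list[of vs w "hd vs"] vs by simp
  then have "C \<in> orbits w V"
    using vs(2,3) hd_in_set[OF vs(2)] unfolding orbits_def by blast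
  moreover have "set vs \<subseteq> tails"
  proof -
    have "map fst (zip vs (rotate1 vs)) = vs" by simp
    then have "set vs = fst ` set (zip vs (rotate1 vs))" by (metis list.set_map)
    then show ?thesis using sub by (auto simp: tails_def)
  qed
  ultimately show "C \<in> full_orbits w"
    by (simp add: full_orbits_def vs(1))
qed

lemma open_orbits_props:
  assumes w: "w \<in> extensions"
  shows "finite (open_orbits w)" "\<Union> (open_orbits w) = path_verts"
    "C \<in> open_orbits w \<Longrightarrow> C \<noteq> {}" "C \<in> open_orbits w \<Longrightarrow> finite C"
    "C \<in> open_orbits w \<Longrightarrow> C' \<in> open_orbits w \<Longrightarrow> C \<noteq> C' \<Longrightarrow> C \<inter> C' = {}"
proof -
  note o = orbits_props[OF extensionsD(1)[OF w] finite_verts]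
  show "finite (open_orbits w)" using o(1) by (simp add: open_orbits_def)
  have split: "orbits w V = full_orbits w \<union> open_orbits w" "full_orbits w \<inter> open_orbits w = {}"
    by (auto simp: full_orbits_def open_orbits_def)
  have "\<Union> (full_orbits w) \<inter> \<Union> (open_orbits w) = {}"
    using o(5) split by blast
  then show "\<Union> (open_orbits w) = path_verts"
    using o(2) unfolding path_verts_def full_orbits_eq_cycle_sets[OF w, symmetric] split(1) by auto
qed (use orbits_props[OF extensionsD(1)[OF w] finite_verts] in \<open>auto simp: open_orbits_def\<close>)

lemma path_verts_subset: "path_verts \<subseteq> V"
  by (auto simp: path_verts_def)

lemma orbit_const_path_verts:
  assumes w: "w \<in> extensions" and v: "v \<in> path_verts" and \<kappa>: "\<And>x. x \<in> path_verts \<Longrightarrow> \<kappa> (w x) = \<kappa> x"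
    and u: "u \<in> orbit w v"
  shows "\<kappa> u = \<kappa> v"
proof (rule orbit_const[OF u])
  obtain C where C: "C \<in> open_orbits w" "v \<in> C"
    using v open_orbits_props(2)[OF w] by blast
  then have "orbit w v = C"
    using orbits_memD(1)[OF extensionsD(1)[OF w] finite_verts] by (auto simp: open_orbits_def)
  then show "\<kappa> (w x) = \<kappa> x" if "x \<in> orbit w v" for x
    using that C(1) open_orbits_props(2)[OF w] \<kappa> by blast
qed (use v \<kappa> in blast)

text \<open>
  A closing extension joins the end of each path to its own start: the vertices outside \<open>tails\<close> are
  the ends of the paths, and no orbit contains two of them.
\<close>

definition closing :: "('a \<Rightarrow> 'a) \<Rightarrow> bool" where
  "closing w \<longleftrightarrow> w \<in> extensions \<and> (\<forall>u\<in>V - tails. \<forall>v\<in>V - tails. v \<in> orbit w u \<longrightarrow> u = v)"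

text \<open>
  The colouring \<open>\<kappa>\<close> certifies that different ends lie in different orbits and is easier to
  maintain than the orbits themselves. When the arc \<open>(u, v)\<close> is added, \<open>w\<close> already contains it
  or \<open>v\<close> is the image of another end \<open>t\<close>; then exchanging the images of \<open>u\<close> and \<open>t\<close> merges
  their orbits, and the colour of \<open>u\<close> is replaced by that of \<open>t\<close>, which remains an end.
\<close>

lemma exists_extension_separating_ends:
  assumes "finite R" "R \<subseteq> V \<times> V" "inj_on fst R" "inj_on snd R"
  shows "\<exists>w \<kappa>. w permutes V \<and> (\<forall>(u, v)\<in>R. w u = v) \<and> (\<forall>x. \<kappa> (w x) = \<kappa> x) \<and> inj_on (\<kappa> :: 'a \<Rightarrow> 'a) (V - fst ` R)"
  using assms
proof (induction R rule: finite_induct)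
  case empty
  show ?case by (auto intro!: exI[of _ "\<lambda>x. x"] simp: permutes_def)
next
  case (insert e R)
  obtain u v where e: "e = (u, v)" by fastforce
  have new: "u \<notin> fst ` R" "v \<notin> snd ` R" and uv: "u \<in> V" "v \<in> V"
    using insert.hyps insert.prems by (auto simp: e)
  obtain w and \<kappa> :: "'a \<Rightarrow> 'a" where w: "w permutes V" "\<forall>(u, v)\<in>R. w u = v" "\<And>x. \<kappa> (w x) = \<kappa> x"
      "inj_on \<kappa> (V - fst ` R)"
    using insert by auto
  define t where "t = inv w v"
  have t: "w t = v" using w(1) by (simp add: t_def permutes_inverses)
  have tV: "t \<in> V" using t uv(2) w(1) by (metis permutes_in_image)
  have tR: "t \<notin> fst ` R" using w(2) t new(2) by force
  show ?case
  proof (cases "t = u")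
    case True
    have "inj_on \<kappa> (V - fst ` insert e R)"
      by (rule inj_on_subset[OF w(4)]) auto
    then show ?thesis
      using w True t e by (intro exI[of _ w] exI[of _ \<kappa>]) auto
  next
    case False
    define w' where "w' = w \<circ> transpose u t"
    define \<kappa>' where "\<kappa>' x = (if \<kappa> x = \<kappa> u then \<kappa> t else \<kappa> x)" for x
    have "w' permutes V"
      unfolding w'_def by (intro permutes_compose permutes_swap_id uv tV w)
    moreover have "\<forall>(a, b)\<in>insert e R. w' a = b"
    proof
      fix x assume x: "x \<in> insert e R"
      show "case x of (a, b) \<Rightarrow> w' a = b"
      proof (cases "x = e")
        case True
        then show ?thesis by (simp add: e w'_def t)
      next
        case False
        then have xR: "x \<in> R" using x by simp
        then have "fst x \<noteq> u" "fst x \<noteq> t" using new(1) tR by force+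
        then show ?thesis using w(2) xR by (auto simp: w'_def case_prod_unfold)
      qed
    qed
    moreover have "\<kappa>' (w' x) = \<kappa>' x" for x
    proof -
      have "\<kappa> v = \<kappa> t" using w(3)[of t] t by simp
      then show ?thesis
        using t w(3) by (cases "x = u"; cases "x = t") (auto simp: \<kappa>'_def w'_def)
    qed
    moreover have "inj_on \<kappa>' (V - fst ` insert e R)"
    proof -
      have "\<kappa> x \<noteq> \<kappa> u" if "x \<in> V - fst ` insert e R" for x
        using that w(4) uv new(1) by (auto simp: e inj_on_def)
      then show ?thesis
        using w(4) by (auto simp: inj_on_def \<kappa>'_def)
    qed
    ultimately show ?thesis by blast
  qed
qed

lemma closing_exists: "\<exists>w. closing w"
proof -
  have fin: "finite S"
    using arcs_subset finite_verts by (meson finite_SigmaI finite_subset)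
  obtain w and \<kappa> :: "'a \<Rightarrow> 'a" where w: "w permutes V" "\<forall>(u, v)\<in>S. w u = v" "\<And>x. \<kappa> (w x) = \<kappa> x"
      "inj_on \<kappa> (V - tails)"
    using exists_extension_separating_ends[OF fin arcs_subset inj_fst inj_snd] unfolding tails_def by blast
  have "u = v" if "u \<in> V - tails" "v \<in> V - tails" "v \<in> orbit w u" for u v
    using orbit_const[OF that(3), of \<kappa>] w(3,4) that(1,2) by (metis inj_onD)
  then show ?thesis
    using w(1,2) unfolding closing_def extensions_def by blast
qed

lemma closing_open_orbit:
  assumes w: "closing w" and C: "C \<in> open_orbits w"
  obtains t where "t \<in> V" "t \<notin> tails" "C = orbit w t" "C \<inter> tails = C - {t}" "t \<in> C"
proof -
  have wp: "w permutes V" using w extensionsD(1) by (auto simp: closing_def)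
  note m = orbits_memD[OF wp finite_verts]
  obtain t where t: "t \<in> C" "t \<notin> tails" and CO: "C \<in> orbits w V"
    using C by (auto simp: open_orbits_def)
  have orb: "C = orbit w t" using m(1)[OF CO t(1)] by simp
  have "u = t" if "u \<in> C" "u \<notin> tails" for u
    using w that t m(2)[OF CO] orb unfolding closing_def by blast
  then have "C \<inter> tails = C - {t}" using t by blast
  then show ?thesis using that t orb m(2)[OF CO] by blast
qed

text \<open>
  In one direction, list an open orbit so that it ends at its only end \<open>t\<close>. In the other, let \<open>t\<close> be the
  preimage under \<open>w\<close> of the first vertex of a path. No arc of \<open>S\<close> enters that vertex, so \<open>t\<close> is an end,
  and it lies in the same orbit as the last vertex of the path; hence both coincide and \<open>w\<close>
  closes up this path.
\<close>

lemma open_orbits_eq_path_sets: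
  assumes w: "closing w"
  shows "open_orbits w = path_sets D S"
proof (intro set_eqI iffI)
  have ext: "w \<in> extensions" using w by (simp add: closing_def)
  note wp = extensionsD(1)[OF ext]
  fix C assume C: "C \<in> open_orbits w"
  then have CO: "C \<in> orbits w V" by (simp add: open_orbits_def)
  obtain t where t: "t \<in> V" "t \<notin> tails" "C = orbit w t" "C \<inter> tails = C - {t}"
    using closing_open_orbit[OF w C] by metis
  obtain vs where vs: "vs \<noteq> []" "distinct vs" "set vs = C" "last vs = t" "rotate1 vs = map w vs"
    using orbit_obtain_list[OF wp finite_verts] t(3) by metis
  have "set (zip vs (rotate1 vs)) = {(u, w u) |u. u \<in> C}"
    using vs(3,5) by (auto simp: zip_map2 zip_same_conv_map)
  moreover have "fst x \<noteq> t" if "x \<in> set (zip vs (tl vs))" for x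
  proof -
    have "fst x \<in> set (butlast vs)"
      using that unfolding set_zip_rotate1(2)[OF vs(1)] by (metis prod.collapse set_zip_leftD)
    moreover have "distinct (butlast vs @ [t])" using vs by (metis append_butlast_last_id)
    ultimately show ?thesis by auto
  qed
  ultimately have "set (zip vs (tl vs)) = {(u, w u) |u. u \<in> C - {t}}"
    unfolding set_zip_rotate1(1)[OF vs(1)] vs(4) by force
  then have "incident_arcs S (set vs) = set (zip vs (tl vs))"
    using incident_arcs_orbit[OF ext CO] vs(3) t(4) by simp
  moreover have "set vs \<subseteq> V" using orbits_memD(2)[OF wp finite_verts CO] vs(3) by blast
  ultimately show "C \<in> path_sets D S"
    using vs unfolding path_sets_def by blast
next
  have ext: "w \<in> extensions" using w by (simp add: closing_def)
  note wp = extensionsD(1)[OF ext] and wS = extensionsD(2)[OF ext] and wS' = extensionsD(3)[OF ext]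
  fix C assume "C \<in> path_sets D S"
  then obtain vs where vs: "C = set vs" "vs \<noteq> []" "distinct vs" "set vs \<subseteq> V"
      "incident_arcs S (set vs) = set (zip vs (tl vs))"
    unfolding path_sets_def by blast
  have sub: "set (zip vs (tl vs)) \<subseteq> S"
    using vs(5) by (auto simp: incident_arcs_def)
  have l: "last vs \<notin> tails"
  proof
    assume "last vs \<in> tails"
    then obtain x where "(last vs, x) \<in> S" by (auto simp: tails_def)
    then have "(last vs, x) \<in> set (zip (butlast vs) (tl vs))"
      using vs(2) unfolding set_zip_rotate1(2)[OF vs(2), symmetric] vs(5)[symmetric]
      by (simp add: incident_arcs_def)
    then have "last vs \<in> set (butlast vs)" by (rule set_zip_leftD)
    moreover have "distinct (butlast vs @ [last vs])" using vs by simp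
    ultimately show False by simp
  qed
  define t where "t = inv w (hd vs)"
  have wt: "w t = hd vs" using wp by (simp add: t_def permutes_inverses)
  have tV: "t \<in> V" using wt vs(2,4) wp by (metis hd_in_set permutes_in_image subsetD)
  have "t \<notin> tails"
  proof
    assume "t \<in> tails"
    then have "(t, hd vs) \<in> incident_arcs S (set vs)"
      using wS wt vs(2) by (auto simp: incident_arcs_def)
    then have "hd vs \<in> set (tl vs)" unfolding vs(5) by (rule set_zip_rightD)
    then show False using vs(2,3) by (cases vs) auto
  qed
  moreover have "last vs \<in> orbit w t"
  proof -
    have "vs ! i \<in> orbit w t" if "i < length vs" for i
      using that
    proof (induction i)
      case 0
      then show ?case using wt vs(2) orbit.base[of w t] by (simp add: hd_conv_nth)
    next
      case (Suc i)
      have "(vs ! i, vs ! Suc i) \<in> set (zip vs (tl vs))"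
        using Suc.prems by (auto simp: set_zip nth_tl intro!: exI[of _ i])
      then have "w (vs ! i) = vs ! Suc i" using sub wS' by blast
      then show ?case using Suc orbit.step[of "vs ! i" w t] by simp
    qed
    then show ?thesis using vs(2) by (simp add: last_conv_nth)
  qed
  ultimately have "t = last vs"
    using w l tV vs(2,4) unfolding closing_def by (meson DiffI last_in_set subsetD)
  have "rotate1 vs = map w vs"
  proof (rule rotate1_eq_map)
    fix a b assume "(a, b) \<in> set (zip vs (rotate1 vs))"
    then show "w a = b"
      using sub wS' wt \<open>t = last vs\<close> unfolding set_zip_rotate1(1)[OF vs(2)] by blast
  qed
  then have "orbit w (hd vs) = C"
    using orbit_eq_list[of vs w "hd vs"] vs by simp
  then have "C \<in> orbits w V"
    using vs(4) hd_in_set[OF vs(2)] unfolding orbits_def by blast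
  moreover have "last vs \<in> C" using vs by simp
  ultimately show "C \<in> open_orbits w"
    using l by (auto simp: open_orbits_def)
qed

section \<open>Expansion of augmented monomial functions in power sums\<close>

text \<open>
  For a closing extension each exponent is \<open>2 (card C - 1)\<close>, so that its weight is \<open>1\<close>.
\<close>

definition weight :: "('a \<Rightarrow> 'a) \<Rightarrow> rat" where
  "weight w = (\<Prod>C\<in>open_orbits w. (-1) ^ (card C - 1 + card (C \<inter> tails)))"

text \<open>
  The second factor depends only on \<open>S\<close>: composing an extension with a transposition reverses its
  weight as long as the result is again an extension.
\<close>

lemma weight_eq_sign:
  assumes w: "w \<in> extensions"
  shows "weight w = of_int (sign w) *
    ((\<Prod>C\<in>cycle_sets D S. (-1) ^ (card C - 1)) * (-1) ^ card (path_verts \<inter> tails))"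
proof -
  note wp = extensionsD(1)[OF w] and op = open_orbits_props[OF w]
  let ?e = "\<lambda>C. (-1) ^ (card C - 1) :: rat"
  have fin: "finite (orbits w V)" by (rule orbits_props[OF wp finite_verts])
  have "of_int (sign w) = (\<Prod>C\<in>orbits w V. ?e C)"
    by (simp add: sign_eq_prod_orbits[OF finite_verts wp])
  also have "orbits w V = cycle_sets D S \<union> open_orbits w"
    unfolding full_orbits_eq_cycle_sets[OF w, symmetric] by (auto simp: full_orbits_def open_orbits_def)
  also have "(\<Prod>C\<in>cycle_sets D S \<union> open_orbits w. ?e C)
      = (\<Prod>C\<in>cycle_sets D S. ?e C) * (\<Prod>C\<in>open_orbits w. ?e C)"
    unfolding full_orbits_eq_cycle_sets[OF w, symmetric]
    by (rule prod.union_disjoint) (use fin in \<open>auto simp: full_orbits_def open_orbits_def\<close>)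
  finally have sg: "of_int (sign w) = (\<Prod>C\<in>cycle_sets D S. ?e C) * (\<Prod>C\<in>open_orbits w. ?e C)" .
  have "path_verts \<inter> tails = (\<Union>C\<in>open_orbits w. C \<inter> tails)"
    using op(2) by auto
  then have "card (path_verts \<inter> tails) = (\<Sum>C\<in>open_orbits w. card (C \<inter> tails))"
  proof (simp only:, intro card_UN_disjoint)
    show "\<forall>C\<in>open_orbits w. \<forall>C'\<in>open_orbits w. C \<noteq> C' \<longrightarrow> (C \<inter> tails) \<inter> (C' \<inter> tails) = {}"
      using op(5) by blast
  qed (use op(1,4) in auto)
  then have "weight w = (\<Prod>C\<in>open_orbits w. ?e C) * (-1) ^ card (path_verts \<inter> tails)"
    by (simp add: weight_def power_add prod.distrib power_sum)
  moreover have "(\<Prod>C\<in>cycle_sets D S. ?e C) * (\<Prod>C\<in>cycle_sets D S. ?e C) = 1"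
    by (simp add: power_add[symmetric] flip: prod.distrib)
  ultimately show ?thesis
    unfolding sg by (simp add: algebra_simps)
qed

lemma weight_closing:
  assumes w: "closing w"
  shows "weight w = 1"
  unfolding weight_def
proof (rule prod.neutral, rule ballI)
  fix C assume C: "C \<in> open_orbits w"
  have ext: "w \<in> extensions" using w by (simp add: closing_def)
  have fin: "finite C" by (rule open_orbits_props(4)[OF ext C])
  obtain t where "C \<inter> tails = C - {t}" "t \<in> C"
    by (rule closing_open_orbit[OF w C])
  then have "card (C \<inter> tails) = card C - 1" using fin by simp
  then show "(-1) ^ (card C - 1 + card (C \<inter> tails)) = (1 :: rat)"
    by simp
qed

text \<open>
  The cancellation at the heart of the proof. If two ends \<open>s\<close> and \<open>t\<close> have the same colour, then
  \<open>w \<mapsto> w \<circ> (s t)\<close> is an involution on the extensions that leave \<open>\<kappa>\<close> invariant, and it reverses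
  weights. Otherwise every such extension is closing, and there is at most one: the colour of an end
  determines which start it is mapped to.
\<close>

lemma sum_weight_fixing:
  fixes \<kappa> :: "'a \<Rightarrow> 'v"
  shows "(\<Sum>w | w \<in> extensions \<and> (\<forall>v\<in>path_verts. \<kappa> (w v) = \<kappa> v). weight w)
    = (if (\<forall>B\<in>path_sets D S. \<forall>u\<in>B. \<forall>v\<in>B. \<kappa> u = \<kappa> v) \<and>
          (\<forall>B\<in>path_sets D S. \<forall>B'\<in>path_sets D S. \<forall>u\<in>B. \<forall>v\<in>B'. \<kappa> u = \<kappa> v \<longrightarrow> B = B')
       then 1 else 0)"
    (is "sum weight ?W = (if ?const \<and> ?inj then 1 else 0)")
proof -
  obtain w0 where w0: "closing w0" using closing_exists by blast
  have ext0: "w0 \<in> extensions" using w0 by (simp add: closing_def)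
  note paths = open_orbits_eq_path_sets[OF w0]
  have ends: "V - tails \<subseteq> path_verts"
    unfolding path_verts_def full_orbits_eq_cycle_sets[OF ext0, symmetric] by (auto simp: full_orbits_def)
  have endB: "\<exists>B\<in>path_sets D S. t \<in> B" if "t \<in> V - tails" for t
    using that ends open_orbits_props(2)[OF ext0] unfolding paths by blast
  show ?thesis
  proof (cases "inj_on \<kappa> (V - tails)")
    case False
    then obtain s t where st: "s \<in> V - tails" "t \<in> V - tails" "s \<noteq> t" "\<kappa> s = \<kappa> t"
      by (auto simp: inj_on_def)
    let ?\<tau> = "transpose s t"
    have mem: "w \<circ> ?\<tau> \<in> ?W" if w: "w \<in> ?W" for w
    proof -
      have "w \<circ> ?\<tau> permutes V"
        using w st by (intro permutes_compose permutes_swap_id) (auto simp: extensions_def)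
      moreover have "(w \<circ> ?\<tau>) u = v" if uv: "(u, v) \<in> S" for u v
      proof -
        have "u \<noteq> s" "u \<noteq> t" using uv st by (force simp: tails_def)+
        then show ?thesis using w uv by (auto simp: extensions_def)
      qed
      moreover have "\<kappa> ((w \<circ> ?\<tau>) v) = \<kappa> v" if "v \<in> path_verts" for v
        using w st ends that by (cases "v = s"; cases "v = t") auto
      ultimately show ?thesis by (auto simp: extensions_def)
    qed
    have flip: "weight (w \<circ> ?\<tau>) = - weight w" if w: "w \<in> ?W" for w
    proof -
      have "permutation w"
        using w finite_verts permutation_permutes by (auto simp: extensions_def)
      then have "sign (w \<circ> ?\<tau>) = - sign w"
        using st(3) by (simp add: sign_compose permutation_swap_id sign_swap_id)
      then show ?thesis
        using w mem[OF w] by (simp add: weight_eq_sign)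
    qed
    have "sum weight ?W = sum (\<lambda>w. weight (w \<circ> ?\<tau>)) ?W"
      by (rule sum.reindex_bij_witness[of _ "\<lambda>w. w \<circ> ?\<tau>" "\<lambda>w. w \<circ> ?\<tau>"])
        (use mem in \<open>auto simp: comp_assoc\<close>)
    also have "\<dots> = - sum weight ?W"
      by (simp only: sum_negf[symmetric]) (rule sum.cong[OF refl flip])
    finally have "sum weight ?W = 0" by simp
    moreover have "\<not> ?inj"
    proof
      assume inj: ?inj
      obtain B B' where B: "B \<in> path_sets D S" "s \<in> B" "B' \<in> path_sets D S" "t \<in> B'"
        using endB st by blast
      then have "B = B'" using inj st(4) by blast
      then have "t \<in> orbit w0 s"
        using B orbits_memD(1)[OF extensionsD(1)[OF ext0] finite_verts, of B s]
        unfolding paths[symmetric] by (auto simp: open_orbits_def)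
      then show False using w0 st unfolding closing_def by blast
    qed
    ultimately show ?thesis by simp
  next
    case inj: True
    have cl: "closing w" if "w \<in> ?W" for w
      unfolding closing_def
    proof (intro conjI ballI impI)
      show ext: "w \<in> extensions" using that by simp
      fix u v assume uv: "u \<in> V - tails" "v \<in> V - tails" "v \<in> orbit w u"
      have "\<kappa> v = \<kappa> u"
        by (rule orbit_const_path_verts[OF ext _ _ uv(3)]) (use that uv ends in auto)
      then show "u = v" using inj uv by (metis inj_onD)
    qed
    show ?thesis
    proof (cases "?W = {}")
      case True
      have "\<not> ?const"
      proof
        assume const: ?const
        have w0B: "w0 v \<in> B" if "B \<in> path_sets D S" "v \<in> B" for v B
          using that orbits_memD(3)[OF extensionsD(1)[OF ext0] finite_verts]
          unfolding paths[symmetric] by (auto simp: open_orbits_def)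
        have "\<kappa> (w0 v) = \<kappa> v" if v: "v \<in> path_verts" for v
        proof -
          obtain B where B: "B \<in> path_sets D S" "v \<in> B"
            using v open_orbits_props(2)[OF ext0] unfolding paths by blast
          show ?thesis by (rule bspec[OF bspec[OF bspec[OF const B(1)] w0B[OF B]] B(2)])
        qed
        then have "w0 \<in> ?W" using ext0 by simp
        then show False using True by blast
      qed
      then have not: "\<not> (?const \<and> ?inj)" by blast
      show ?thesis unfolding if_not_P[OF not] True by simp
    next
      case False
      then obtain w where w: "w \<in> ?W" by blast
      note clw = cl[OF w]
      have ext: "w \<in> extensions" using w by simp
      note pw = open_orbits_eq_path_sets[OF clw]
      have const: ?const
      proof (intro ballI)
        fix B u v assume B: "B \<in> path_sets D S" "u \<in> B" "v \<in> B"
        have "orbit w v = B"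
          using B orbits_memD(1)[OF extensionsD(1)[OF ext] finite_verts]
          unfolding pw[symmetric] by (auto simp: open_orbits_def)
        moreover have "v \<in> path_verts"
          using B open_orbits_props(2)[OF ext] unfolding pw by blast
        ultimately show "\<kappa> u = \<kappa> v"
          using orbit_const_path_verts[OF ext, of v \<kappa> u] w B by blast
      qed
      have inj': "?inj"
      proof (intro ballI impI)
        fix B B' u v assume B: "B \<in> path_sets D S" "B' \<in> path_sets D S" "u \<in> B" "v \<in> B'" "\<kappa> u = \<kappa> v"
        obtain s where s: "s \<in> V" "s \<notin> tails" "s \<in> B" "B = orbit w s"
          using closing_open_orbit[OF clw, of B] B(1) pw by metis
        obtain t where t: "t \<in> V" "t \<notin> tails" "t \<in> B'" "B' = orbit w t"
          using closing_open_orbit[OF clw, of B'] B(2) pw by metis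
        have "\<kappa> s = \<kappa> t" using const B s t by metis
        then have "s = t" using inj s t by (auto simp: inj_on_def)
        then show "B = B'" using s t by simp
      qed
      have "?W = {w}"
      proof -
        have "w' u = w u" if w': "w' \<in> ?W" for w' u
        proof (cases "u \<in> V - tails")
          case True
          have ext': "w' \<in> extensions" using w' by simp
          note wp = extensionsD(1)[OF ext] and wp' = extensionsD(1)[OF ext']
          \<comment> \<open>\<open>w u\<close> is the start of a path, so its preimage under \<open>w'\<close> is an end, and it has the colour of \<open>u\<close>.\<close>
          define y where "y = inv w' (w u)"
          have y: "w' y = w u" using wp' by (simp add: y_def permutes_inverses)
          have yV: "y \<in> V" using y True wp wp' by (metis DiffD1 permutes_in_image)
          have "y \<notin> tails"
          proof
            assume "y \<in> tails"
            then have "(y, w u) \<in> S" using y extensionsD(2)[OF ext'] by simp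
            then have "w y = w u" "y \<in> tails" using extensionsD(2)[OF ext] by auto
            then show False using True permutes_inj[OF wp] by (metis DiffD2 injD)
          qed
          then have "y \<in> V - tails" using yV by simp
          moreover have "\<kappa> y = \<kappa> u"
          proof -
            have "\<kappa> (w' y) = \<kappa> y" "\<kappa> (w u) = \<kappa> u"
              using w w' ends True \<open>y \<in> V - tails\<close> by auto
            then show ?thesis using y by simp
          qed
          ultimately have "y = u" using inj True by (metis inj_onD)
          then show ?thesis using y by simp
        next
          case False
          show ?thesis
          proof (cases "u \<in> tails")
            case True
            then obtain v where "(u, v) \<in> S" by (auto simp: tails_def)
            then show ?thesis using w w' by (auto simp: extensions_def)
          next
            case False
            then have "u \<notin> V" using \<open>u \<notin> V - tails\<close> by simp
            then show ?thesis using w w' by (auto simp: extensions_def permutes_not_in)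
          qed
        qed
        then show ?thesis using w by (auto intro!: ext)
      qed
      then have "sum weight ?W = 1"
        using weight_closing[OF clw] by simp
      then show ?thesis unfolding if_P[OF conjI[OF const inj']] .
    qed
  qed
qed

text \<open>
  Both coefficients of \<open>m\<close> count colourings of the vertices on paths, the left one those that are constant
  on paths and separate them, the right one pairs of an extension and an invariant colouring. Summing
  over the extensions first leaves exactly the former, by \<open>sum_weight_fixing\<close>. Vertices carry
  weights because, for \<open>S = {}\<close>, every augmented monomial function is then of the form on the left.
\<close>

lemma aug_monomial_paths:
  fixes wt :: "'a \<Rightarrow> nat"
  assumes pos: "\<And>v. v \<in> V \<Longrightarrow> 0 < wt v"
  shows "(aug_monomial_sf (image_mset (sum wt) (mset_set (path_sets D S))) :: ('v, rat) mfps)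
    = (\<Sum>w\<in>extensions. const (weight w) * (\<Prod>C\<in>open_orbits w. power_sum (sum wt C)))"
proof (rule mfps_eqI)
  fix m :: "'v \<Rightarrow>\<^sub>0 nat"
  obtain w0 where w0: "closing w0" using closing_exists by blast
  have ext0: "w0 \<in> extensions" using w0 by (simp add: closing_def)
  note paths = open_orbits_eq_path_sets[OF w0] and op0 = open_orbits_props[OF ext0]
  have wtpos: "0 < sum wt C" if "w \<in> extensions" "C \<in> open_orbits w" for w C
  proof (rule sum_pos)
    show "finite C" "C \<noteq> {}" using open_orbits_props(3,4)[OF that(1)] that(2) by auto
    show "0 < wt v" if "v \<in> C" for v
      using that pos open_orbits_props(2)[OF \<open>w \<in> extensions\<close>] \<open>C \<in> open_orbits w\<close> path_verts_subset by blast
  qed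
  define K where "K = {\<kappa> \<in> path_verts \<rightarrow>\<^sub>E (UNIV :: 'v set). colour_monomial path_verts wt \<kappa> = m}"
  have finV: "finite path_verts" using finite_verts path_verts_subset by (rule rev_finite_subset)
  have finK: "finite K"
    using finite_colourings[OF finV, of wt m "\<lambda>_. True"] pos path_verts_subset by (auto simp: K_def)
  let ?const = "\<lambda>\<kappa> :: 'a \<Rightarrow> 'v. \<forall>B\<in>path_sets D S. \<forall>u\<in>B. \<forall>v\<in>B. \<kappa> u = \<kappa> v"
  let ?inj = "\<lambda>\<kappa> :: 'a \<Rightarrow> 'v. \<forall>B\<in>path_sets D S. \<forall>B'\<in>path_sets D S. \<forall>u\<in>B. \<forall>v\<in>B'. \<kappa> u = \<kappa> v \<longrightarrow> B = B'"
  have "coeff (aug_monomial_sf (image_mset (sum wt) (mset_set (path_sets D S)))) m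
      = of_nat (card {\<gamma> \<in> path_sets D S \<rightarrow>\<^sub>E UNIV. colour_monomial (path_sets D S) (sum wt) \<gamma> = m \<and> inj_on \<gamma> (path_sets D S)})"
    using coeff_aug_monomial_colourings[OF op0(1), of "sum wt" m] wtpos[OF ext0] unfolding paths by blast
  also have "card {\<gamma> \<in> path_sets D S \<rightarrow>\<^sub>E UNIV. colour_monomial (path_sets D S) (sum wt) \<gamma> = m \<and> inj_on \<gamma> (path_sets D S)}
      = card {\<kappa> \<in> \<Union>(path_sets D S) \<rightarrow>\<^sub>E UNIV. ?const \<kappa> \<and> colour_monomial (\<Union>(path_sets D S)) wt \<kappa> = m \<and> ?inj \<kappa>}"
  proof (rule card_block_colourings)
    fix \<gamma> :: "'a set \<Rightarrow> 'v" and \<kappa> :: "'a \<Rightarrow> 'v"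
    assume eq: "\<And>B u. B \<in> path_sets D S \<Longrightarrow> u \<in> B \<Longrightarrow> \<kappa> u = \<gamma> B"
    have "colour_monomial (path_sets D S) (sum wt) \<gamma> = colour_monomial (\<Union>(path_sets D S)) wt \<kappa>"
      by (rule colour_monomial_blocks) (use op0(4,5) eq paths in auto)
    moreover have "inj_on \<gamma> (path_sets D S) \<longleftrightarrow> ?inj \<kappa>"
    proof
      assume inj: "inj_on \<gamma> (path_sets D S)"
      show "?inj \<kappa>"
        using inj eq by (metis inj_onD)
    next
      assume inj: "?inj \<kappa>"
      show "inj_on \<gamma> (path_sets D S)"
      proof (rule inj_onI)
        fix B B' assume B: "B \<in> path_sets D S" "B' \<in> path_sets D S" "\<gamma> B = \<gamma> B'"
        obtain u v where uv: "u \<in> B" "v \<in> B'" using op0(3) B(1,2) unfolding paths by blast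
        then have "\<kappa> u = \<kappa> v" using B eq[of B u] eq[of B' v] by simp
        then show "B = B'" using inj B(1,2) uv by metis
      qed
    qed
    ultimately show "colour_monomial (path_sets D S) (sum wt) \<gamma> = m \<and> inj_on \<gamma> (path_sets D S) \<longleftrightarrow>
        colour_monomial (\<Union>(path_sets D S)) wt \<kappa> = m \<and> ?inj \<kappa>" by simp
  qed (use op0(3,5) paths in auto)
  also have "{\<kappa> \<in> \<Union>(path_sets D S) \<rightarrow>\<^sub>E UNIV. ?const \<kappa> \<and> colour_monomial (\<Union>(path_sets D S)) wt \<kappa> = m \<and> ?inj \<kappa>}
      = {\<kappa> \<in> K. ?const \<kappa> \<and> ?inj \<kappa>}"
    using op0(2) unfolding paths K_def by auto
  also have "of_nat (card {\<kappa> \<in> K. ?const \<kappa> \<and> ?inj \<kappa>}) = (\<Sum>\<kappa>\<in>K. if ?const \<kappa> \<and> ?inj \<kappa> then 1 else (0::rat))"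
    using finK by (simp add: sum.If_cases Int_def)
  also have "\<dots> = (\<Sum>\<kappa>\<in>K. \<Sum>w | w \<in> extensions \<and> (\<forall>v\<in>path_verts. \<kappa> (w v) = \<kappa> v). weight w)"
    by (simp only: sum_weight_fixing)
  also have "\<dots> = (\<Sum>w\<in>extensions. \<Sum>\<kappa> | \<kappa> \<in> K \<and> (\<forall>v\<in>path_verts. \<kappa> (w v) = \<kappa> v). weight w)"
    by (rule sum.swap_restrict[OF finK finite_extensions])
  also have "\<dots> = (\<Sum>w\<in>extensions. weight w * coeff (\<Prod>C\<in>open_orbits w. power_sum (sum wt C)) m)"
  proof (rule sum.cong[OF refl])
    fix w assume w: "w \<in> extensions"
    note op = open_orbits_props[OF w]
    have orb: "orbit w v = C" if "C \<in> open_orbits w" "v \<in> C" for C v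
      using orbits_memD(1)[OF extensionsD(1)[OF w] finite_verts] that by (auto simp: open_orbits_def)
    have wC: "w v \<in> C" if "C \<in> open_orbits w" "v \<in> C" for C v
      using orbits_memD(3)[OF extensionsD(1)[OF w] finite_verts] that by (auto simp: open_orbits_def)
    have fix_iff: "(\<forall>v\<in>path_verts. \<kappa> (w v) = \<kappa> v) \<longleftrightarrow> (\<forall>C\<in>open_orbits w. \<forall>u\<in>C. \<forall>v\<in>C. \<kappa> u = \<kappa> v)"
      for \<kappa> :: "'a \<Rightarrow> 'v"
    proof
      assume L: "\<forall>v\<in>path_verts. \<kappa> (w v) = \<kappa> v"
      show "\<forall>C\<in>open_orbits w. \<forall>u\<in>C. \<forall>v\<in>C. \<kappa> u = \<kappa> v"
      proof (intro ballI)
        fix C u v assume C: "C \<in> open_orbits w" "u \<in> C" "v \<in> C"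
        show "\<kappa> u = \<kappa> v"
        proof (rule orbit_const_path_verts[OF w])
          show "v \<in> path_verts" using C op(2) by blast
          show "u \<in> orbit w v" using orb C by blast
        qed (use L in blast)
      qed
    next
      assume "\<forall>C\<in>open_orbits w. \<forall>u\<in>C. \<forall>v\<in>C. \<kappa> u = \<kappa> v"
      then show "\<forall>v\<in>path_verts. \<kappa> (w v) = \<kappa> v"
        using wC unfolding op(2)[symmetric] by blast
    qed
    have "coeff (\<Prod>C\<in>open_orbits w. power_sum (sum wt C)) m
        = of_nat (card {\<gamma> \<in> open_orbits w \<rightarrow>\<^sub>E UNIV. colour_monomial (open_orbits w) (sum wt) \<gamma> = m})"
      by (rule coeff_prod_power_sum) (use op(1) wtpos[OF w] in auto)
    also have "card {\<gamma> \<in> open_orbits w \<rightarrow>\<^sub>E UNIV. colour_monomial (open_orbits w) (sum wt) \<gamma> = m}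
        = card {\<kappa> \<in> \<Union>(open_orbits w) \<rightarrow>\<^sub>E UNIV. (\<forall>C\<in>open_orbits w. \<forall>u\<in>C. \<forall>v\<in>C. \<kappa> u = \<kappa> v) \<and>
            colour_monomial (\<Union>(open_orbits w)) wt \<kappa> = m}"
    proof (rule card_block_colourings)
      fix \<gamma> :: "'a set \<Rightarrow> 'v" and \<kappa> :: "'a \<Rightarrow> 'v"
      assume eq: "\<And>B u. B \<in> open_orbits w \<Longrightarrow> u \<in> B \<Longrightarrow> \<kappa> u = \<gamma> B"
      have "colour_monomial (open_orbits w) (sum wt) \<gamma> = colour_monomial (\<Union>(open_orbits w)) wt \<kappa>"
        by (rule colour_monomial_blocks) (use op(4,5) eq in auto)
      then show "colour_monomial (open_orbits w) (sum wt) \<gamma> = m \<longleftrightarrow>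
          colour_monomial (\<Union>(open_orbits w)) wt \<kappa> = m" by simp
    qed (use op(3,5) in auto)
    also have "{\<kappa> \<in> \<Union>(open_orbits w) \<rightarrow>\<^sub>E UNIV. (\<forall>C\<in>open_orbits w. \<forall>u\<in>C. \<forall>v\<in>C. \<kappa> u = \<kappa> v) \<and>
            colour_monomial (\<Union>(open_orbits w)) wt \<kappa> = m}
        = {\<kappa>. \<kappa> \<in> K \<and> (\<forall>v\<in>path_verts. \<kappa> (w v) = \<kappa> v)}"
      unfolding fix_iff op(2) K_def by blast
    finally show "(\<Sum>\<kappa> | \<kappa> \<in> K \<and> (\<forall>v\<in>path_verts. \<kappa> (w v) = \<kappa> v). weight w)
        = weight w * coeff (\<Prod>C\<in>open_orbits w. power_sum (sum wt C)) m"
      by (simp add: mult.commute)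
  qed
  also have "\<dots> = coeff (\<Sum>w\<in>extensions. const (weight w) * (\<Prod>C\<in>open_orbits w. power_sum (sum wt C))) m"
    by (simp add: coeff_sum)
  finally show "coeff (aug_monomial_sf (image_mset (sum wt) (mset_set (path_sets D S)))) m
      = coeff (\<Sum>w\<in>extensions. const (weight w) * (\<Prod>C\<in>open_orbits w. power_sum (sum wt C))) m" .
qed

end

section \<open>The elementary functions form a basis\<close>

interpretation mfps_vs: vector_space "\<lambda>c f. const c * f :: ('v, rat) mfps"
  by unfold_locales (simp_all add: const_add const_mult algebra_simps)

interpretation mfps_pair: vector_space_pair
  "\<lambda>c f. const c * f :: ('v, rat) mfps" "\<lambda>c f. const c * f :: ('v, rat) mfps"
  by unfold_locales

definition partitions_upto :: "nat \<Rightarrow> nat multiset set" where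
  "partitions_upto n = {\<mu>. is_partition \<mu> \<and> sum_mset \<mu> \<le> n}"

lemma finite_partitions_upto: "finite (partitions_upto n)"
proof (rule finite_subset)
  show "partitions_upto n \<subseteq> mset ` {xs. set xs \<subseteq> {..n} \<and> length xs \<le> n}"
  proof
    fix \<mu> assume \<mu>: "\<mu> \<in> partitions_upto n"
    obtain xs where xs: "mset xs = \<mu>" using ex_mset by blast
    have "size \<mu> \<le> sum_mset \<mu>" if "0 \<notin># \<mu>" for \<mu> :: "nat multiset"
      using that by (induction \<mu>) auto
    moreover have \<mu>': "0 \<notin># \<mu>" "sum_mset \<mu> \<le> n"
      using \<mu> by (auto simp: partitions_upto_def is_partition_def)
    ultimately have "length xs \<le> n"
      using xs by (metis le_trans size_mset)
    moreover have "x \<le> n" if "x \<in> set xs" for x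
    proof -
      have "x \<in># \<mu>" using that xs by auto
      then show ?thesis using \<mu>'(2) sum_mset.remove[of x \<mu>] by simp
    qed
    ultimately show "\<mu> \<in> mset ` {xs. set xs \<subseteq> {..n} \<and> length xs \<le> n}"
      using xs by blast
  qed
  show "finite (mset ` {xs. set xs \<subseteq> {..n} \<and> length xs \<le> n})"
    by (intro finite_imageI finite_lists_length_le) simp
qed

text \<open>
  The span has to be bounded by degree, since independence is derived from a dimension count in finite
  dimension.
\<close>

definition elementary_filtration :: "nat \<Rightarrow> ('v, rat) mfps set" where
  "elementary_filtration n = mfps_vs.span (elementary_sf ` partitions_upto n)"

lemma elementary_filtration_base: "\<mu> \<in> partitions_upto n \<Longrightarrow> elementary_sf \<mu> \<in> elementary_filtration n"
  unfolding elementary_filtration_def by (intro mfps_vs.span_base imageI)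

lemma elementary_filtration_mono: "m \<le> n \<Longrightarrow> elementary_filtration m \<subseteq> elementary_filtration n"
  unfolding elementary_filtration_def by (intro mfps_vs.span_mono image_mono) (auto simp: partitions_upto_def)

lemma elementary_sf_union: "elementary_sf (\<mu> + \<nu>) = elementary_sf \<mu> * elementary_sf \<nu>"
  by (simp add: elementary_sf_def)

lemma complete_sf_union: "complete_sf (\<mu> + \<nu>) = complete_sf \<mu> * complete_sf \<nu>"
  by (simp add: complete_sf_def)

lemma span_mult_closed:
  assumes "f \<in> mfps_vs.span A" "g \<in> mfps_vs.span B"
    and "\<And>a b. a \<in> A \<Longrightarrow> b \<in> B \<Longrightarrow> a * b \<in> mfps_vs.span C"
  shows "f * g \<in> mfps_vs.span C"
proof -
  have a: "a * g \<in> mfps_vs.span C" if "a \<in> A" for a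
    using assms(2)
  proof (induction rule: mfps_vs.span_induct_alt)
    case (step c x y)
    have "a * (const c * x + y) = const c * (a * x) + a * y" by (simp add: algebra_simps)
    then show ?case
      using step assms(3)[OF that] by (simp add: mfps_vs.span_add mfps_vs.span_scale)
  qed (simp add: mfps_vs.span_zero)
  show ?thesis
    using assms(1)
  proof (induction rule: mfps_vs.span_induct_alt)
    case (step c x y)
    have "(const c * x + y) * g = const c * (x * g) + y * g" by (simp add: algebra_simps)
    then show ?case
      using step a by (simp add: mfps_vs.span_add mfps_vs.span_scale)
  qed (simp add: mfps_vs.span_zero)
qed

lemma elementary_filtration_mult:
  fixes f g :: "('v, rat) mfps"
  assumes "f \<in> elementary_filtration m" "g \<in> elementary_filtration n"
  shows "f * g \<in> elementary_filtration (m + n)"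
  using assms unfolding elementary_filtration_def
proof (rule span_mult_closed)
  fix a b :: "('v, rat) mfps"
  assume "a \<in> elementary_sf ` partitions_upto m" "b \<in> elementary_sf ` partitions_upto n"
  then obtain \<mu> \<nu> where ab: "a = elementary_sf \<mu>" "b = elementary_sf \<nu>"
      "\<mu> \<in> partitions_upto m" "\<nu> \<in> partitions_upto n" by blast
  then have "\<mu> + \<nu> \<in> partitions_upto (m + n)"
    by (auto simp: partitions_upto_def is_partition_def)
  then show "a * b \<in> mfps_vs.span (elementary_sf ` partitions_upto (m + n))"
    unfolding ab elementary_sf_union[symmetric] by (intro mfps_vs.span_base imageI)
qed

lemma elementary_in_filtration: "elementary n \<in> elementary_filtration n"
proof (cases "n = 0")
  case True
  have "elementary_sf {#} \<in> elementary_filtration n"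
    by (rule elementary_filtration_base) (simp add: partitions_upto_def is_partition_def)
  then show ?thesis using True by (simp add: elementary_sf_def elementary_0)
next
  case False
  have "elementary_sf {#n#} \<in> elementary_filtration n"
    by (rule elementary_filtration_base) (use False in \<open>simp add: partitions_upto_def is_partition_def\<close>)
  then show ?thesis by (simp add: elementary_sf_def)
qed

lemma filtration_diff: "f \<in> elementary_filtration n \<Longrightarrow> g \<in> elementary_filtration n \<Longrightarrow> f - g \<in> elementary_filtration n"
  and filtration_scale: "f \<in> elementary_filtration n \<Longrightarrow> const c * f \<in> elementary_filtration n"
  and filtration_sum: "(\<And>i. i \<in> I \<Longrightarrow> F i \<in> elementary_filtration n) \<Longrightarrow> (\<Sum>i\<in>I. F i) \<in> elementary_filtration n"
  unfolding elementary_filtration_def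
  by (auto intro: mfps_vs.span_diff mfps_vs.span_scale mfps_vs.span_sum)

text \<open>
  Newton's identity solved for the power sum, for recursion on \<open>n\<close>.
\<close>

lemma newton_elementary_last:
  assumes "0 < n"
  shows "(power_sum n :: ('v, rat) mfps) = const ((-1) ^ (n - 1)) * (const (of_nat n) * elementary n
    - (\<Sum>i=1..<n. const ((-1) ^ (i - 1)) * (power_sum i * elementary (n - i))))"
proof -
  have "{1..n} = insert n {1..<n}" using assms by auto
  then have "(of_nat n * elementary n :: ('v, rat) mfps) = const ((-1) ^ (n - 1)) * power_sum n
      + (\<Sum>i=1..<n. const ((-1) ^ (i - 1)) * (power_sum i * elementary (n - i)))"
    using newton_elementary[of n, where ?'a = 'v] by (simp add: elementary_0)
  then have "(const (of_nat n) * elementary n :: ('v, rat) mfps)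
      - (\<Sum>i=1..<n. const ((-1) ^ (i - 1)) * (power_sum i * elementary (n - i)))
      = const ((-1) ^ (n - 1)) * power_sum n"
    by (simp add: const_of_nat)
  moreover have "const ((-1) ^ (n - 1)) * (const ((-1) ^ (n - 1)) * power_sum n) = (power_sum n :: ('v, rat) mfps)"
    by (simp add: mult.assoc[symmetric] const_mult[symmetric] flip: power_add)
  ultimately show ?thesis by simp
qed

lemma power_sum_in_filtration: "0 < n \<Longrightarrow> (power_sum n :: ('v, rat) mfps) \<in> elementary_filtration n"
proof (induction n rule: less_induct)
  case (less n)
  have "(power_sum i * elementary (n - i) :: ('v, rat) mfps) \<in> elementary_filtration n" if "i \<in> {1..<n}" for i
    using elementary_filtration_mult[OF less.IH[of i] elementary_in_filtration[of "n - i"]] that by simp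
  then show ?case
    unfolding newton_elementary_last[OF less.prems]
    by (intro filtration_scale filtration_diff filtration_sum elementary_in_filtration)
qed

lemma one_in_filtration: "1 \<in> elementary_filtration n"
  using elementary_in_filtration[of 0] elementary_filtration_mono[of 0 n] by (auto simp: elementary_0)

lemma prod_power_sum_in_filtration:
  assumes "finite I" "\<And>c. c \<in> I \<Longrightarrow> 0 < n c"
  shows "(\<Prod>c\<in>I. power_sum (n c)) \<in> elementary_filtration (\<Sum>c\<in>I. n c)"
  using assms
  by (induction I rule: finite_induct)
    (simp_all add: one_in_filtration elementary_filtration_mult power_sum_in_filtration)

lemma path_sets_empty:
  "path_sets D {} = (\<lambda>v. {v}) ` pverts D"
proof (intro set_eqI iffI)
  fix B assume "B \<in> path_sets D {}"
  then obtain vs where vs: "B = set vs" "vs \<noteq> []" "set vs \<subseteq> pverts D" "set (zip vs (tl vs)) = {}"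
    by (auto simp: path_sets_def incident_arcs_def)
  then obtain v where "vs = [v]" by (cases vs; cases "tl vs") auto
  then show "B \<in> (\<lambda>v. {v}) ` pverts D" using vs by auto
next
  fix B assume "B \<in> (\<lambda>v. {v}) ` pverts D"
  then obtain v where v: "v \<in> pverts D" "B = set [v]" by auto
  then show "B \<in> path_sets D {}"
    unfolding path_sets_def by (intro CollectI exI[of _ "[v]"]) (simp add: incident_arcs_def)
qed

text \<open>
  Apply the expansion to the digraph without arcs whose vertices are weighted by the parts of \<open>\<mu>\<close>.
  Its only cover is empty, its paths are the single vertices, and the products of power sums all have degree
  \<open>sum_mset \<mu>\<close>.
\<close>

lemma aug_monomial_in_filtration:
  assumes "is_partition \<mu>"
  shows "(aug_monomial_sf \<mu> :: ('v, rat) mfps) \<in> elementary_filtration (sum_mset \<mu>)"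
proof -
  obtain xs where xs: "mset xs = \<mu>" using ex_mset by blast
  define D :: "nat pair_pre_digraph" where "D = \<lparr>pverts = {..<length xs}, parcs = {}\<rparr>"
  interpret cover D "{}" by unfold_locales (auto simp: D_def)
  define wt where "wt i = (if i < length xs then xs ! i else 1)" for i
  have pos: "0 < wt i" for i
  proof (cases "i < length xs")
    case True
    then have "wt i \<in># \<mu>" using xs by (auto simp: wt_def)
    then show ?thesis using assms by (auto simp: is_partition_def intro: gr0I)
  qed (simp add: wt_def)
  have "image_mset wt (mset_set {..<length xs}) = mset (map wt [0..<length xs])"
    by (simp add: atLeast0LessThan mset_map flip: mset_set_upto_eq_mset_upto)
  also have "map wt [0..<length xs] = xs"
    by (rule nth_equalityI) (auto simp: wt_def)
  finally have type': "image_mset wt (mset_set {..<length xs}) = \<mu>" using xs by simp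
  have "image_mset (sum wt) (mset_set (path_sets D {})) = image_mset wt (mset_set {..<length xs})"
    by (simp add: path_sets_empty D_def multiset.map_comp comp_def flip: image_mset_mset_set)
  then have type: "image_mset (sum wt) (mset_set (path_sets D {})) = \<mu>" by (simp add: type')
  have total: "(\<Sum>C\<in>open_orbits w. sum wt C) = sum_mset \<mu>" if w: "w \<in> extensions" for w
  proof -
    note op = open_orbits_props[OF w]
    have "(\<Sum>C\<in>open_orbits w. sum wt C) = sum wt path_verts"
      unfolding op(2)[symmetric] by (subst sum.Union_disjoint) (use op(4,5) in auto)
    also have "path_verts = {..<length xs}"
    proof -
      have "cycle_sets D {} = {}"
      proof (rule equals0I)
        fix C assume "C \<in> cycle_sets D {}"
        then obtain vs :: "nat list" where vs: "vs \<noteq> []" "set (zip vs (rotate1 vs)) = {}"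
          by (auto simp: cycle_sets_def incident_arcs_def)
        then show False by (cases vs) auto
      qed
      then show ?thesis unfolding path_verts_def by (simp add: D_def)
    qed
    also have "sum wt \<dots> = sum_mset \<mu>"
      unfolding sum_unfold_sum_mset type' ..
    finally show ?thesis .
  qed
  have "(\<Prod>C\<in>open_orbits w. power_sum (sum wt C) :: ('v, rat) mfps) \<in> elementary_filtration (sum_mset \<mu>)"
    if w: "w \<in> extensions" for w
    unfolding total[OF w, symmetric]
    by (rule prod_power_sum_in_filtration)
      (use open_orbits_props[OF w] pos in \<open>auto intro!: sum_pos\<close>)
  then show ?thesis
    unfolding type[symmetric] aug_monomial_paths[of wt, OF pos]
    by (intro filtration_sum filtration_scale) (simp add: type)
qed

lemma monomial_in_filtration:
  assumes "\<mu> \<in> partitions_upto n"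
  shows "(monomial_sf \<mu> :: ('v, rat) mfps) \<in> elementary_filtration n"
proof -
  let ?c = "of_nat (\<Prod>i\<in>set_mset \<mu>. fact (count \<mu> i)) :: rat"
  have "(\<Prod>i\<in>set_mset \<mu>. fact (count \<mu> i) :: nat) \<noteq> 0" by simp
  then have "const (inverse ?c) * aug_monomial_sf \<mu> = (monomial_sf \<mu> :: ('v, rat) mfps)"
    unfolding aug_monomial_sf_def const_of_nat[symmetric] mult.assoc[symmetric] const_mult[symmetric]
    by (simp del: of_nat_prod)
  moreover have "const (inverse ?c) * (aug_monomial_sf \<mu> :: ('v, rat) mfps) \<in> elementary_filtration n"
    using aug_monomial_in_filtration[of \<mu>] elementary_filtration_mono[of "sum_mset \<mu>" n] assms
    by (intro filtration_scale) (auto simp: partitions_upto_def)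
  ultimately show ?thesis by simp
qed

text \<open>
  In finitely many variables, monomial functions with too many parts vanish. This is where an infinite
  set of variables is essential for \<open>\<omega>\<close> to exist.
\<close>

lemma exists_exponents:
  assumes "infinite (UNIV :: 'v set)" "is_partition \<mu>"
  shows "\<exists>m :: 'v \<Rightarrow>\<^sub>0 nat. exponents m = \<mu>"
  using assms(2)
proof (induction \<mu>)
  case empty
  show ?case by (intro exI[of _ 0]) (simp add: exponents_def)
next
  case (add k \<mu>)
  then have k: "0 < k" and "is_partition \<mu>" by (auto simp: is_partition_def)
  then obtain m :: "'v \<Rightarrow>\<^sub>0 nat" where m: "exponents m = \<mu>" using add.IH by blast
  obtain i where i: "i \<notin> Poly_Mapping.keys m"
    using ex_new_if_finite[OF assms(1) finite_keys] by blast
  let ?m = "m + Poly_Mapping.single i k"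
  have "Poly_Mapping.lookup ?m i = k" using i by (simp add: Poly_Mapping.lookup_add in_keys_iff)
  then have "exponents ?m = add_mset k (exponents (?m - Poly_Mapping.single i k))"
    using k by (rule exponents_minus_single)
  then show ?case using m by (intro exI[of _ ?m]) simp
qed

lemma symmetric_function_expansion:
  fixes f :: "('v, rat) mfps"
  assumes "infinite (UNIV :: 'v set)" "f \<in> symmetric_functions"
    and d: "\<And>m. coeff f m \<noteq> 0 \<Longrightarrow> mono_degree m \<le> d"
  shows "\<exists>c. f = (\<Sum>\<mu>\<in>partitions_upto d. const (c \<mu>) * monomial_sf \<mu>)"
proof -
  define c where "c \<mu> = coeff f (SOME m. exponents m = \<mu>)" for \<mu>
  have c: "coeff f m = c (exponents m)" for m
    unfolding c_def by (rule symmetric_functions_coeff[OF assms(2)]) (rule someI[of "\<lambda>m'. exponents m' = exponents m" m, OF refl, symmetric])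
  have "f = (\<Sum>\<mu>\<in>partitions_upto d. const (c \<mu>) * monomial_sf \<mu>)"
  proof (rule mfps_eqI)
    fix m :: "'v \<Rightarrow>\<^sub>0 nat"
    have "coeff (\<Sum>\<mu>\<in>partitions_upto d. const (c \<mu>) * monomial_sf \<mu>) m
        = (\<Sum>\<mu>\<in>partitions_upto d. if exponents m = \<mu> then c \<mu> else 0)"
      unfolding coeff_sum by (rule sum.cong) (auto simp: monomial_sf_def)
    also have "\<dots> = (if exponents m \<in> partitions_upto d then c (exponents m) else 0)"
      by (rule sum.delta'[OF finite_partitions_upto])
    also have "\<dots> = coeff f m"
      using d[of m] c[of m] is_partition_exponents[of m] by (auto simp: partitions_upto_def mono_degree_eq)
    finally show "coeff f m = coeff (\<Sum>\<mu>\<in>partitions_upto d. const (c \<mu>) * monomial_sf \<mu>) m" ..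
  qed
  then show ?thesis by blast
qed

lemma symmetric_function_in_filtration:
  fixes f :: "('v, rat) mfps"
  assumes "infinite (UNIV :: 'v set)" "f \<in> symmetric_functions"
  shows "\<exists>d. f \<in> elementary_filtration d"
proof -
  obtain d where d: "\<And>m. coeff f m \<noteq> 0 \<Longrightarrow> mono_degree m \<le> d"
    using symmetric_functions_bounded[OF assms(2)] by blast
  obtain c where "f = (\<Sum>\<mu>\<in>partitions_upto d. const (c \<mu>) * monomial_sf \<mu>)"
    using symmetric_function_expansion[OF assms d] by blast
  then have "f \<in> elementary_filtration d"
    by (simp add: filtration_sum filtration_scale monomial_in_filtration)
  then show ?thesis ..
qed

lemma monomials_independent:
  assumes "infinite (UNIV :: 'v set)"
  shows "mfps_vs.independent ((monomial_sf :: _ \<Rightarrow> ('v, rat) mfps) ` partitions_upto n)"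
    and "inj_on (monomial_sf :: _ \<Rightarrow> ('v, rat) mfps) (partitions_upto n)"
proof -
  let ?M = "monomial_sf :: _ \<Rightarrow> ('v, rat) mfps"
  have ex: "\<exists>m :: 'v \<Rightarrow>\<^sub>0 nat. exponents m = \<mu>" if "\<mu> \<in> partitions_upto n" for \<mu>
    using that exists_exponents[OF assms, of \<mu>] by (auto simp: partitions_upto_def)
  show inj: "inj_on ?M (partitions_upto n)"
  proof (rule inj_onI)
    fix \<mu> \<nu> assume \<mu>: "\<mu> \<in> partitions_upto n" and eq: "?M \<mu> = ?M \<nu>"
    obtain m :: "'v \<Rightarrow>\<^sub>0 nat" where m: "exponents m = \<mu>" using ex[OF \<mu>] by blast
    have "coeff (?M \<mu>) m = coeff (?M \<nu>) m" by (simp add: eq)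
    then show "\<mu> = \<nu>" using m by (simp add: monomial_sf_def split: if_splits)
  qed
  show "mfps_vs.independent (?M ` partitions_upto n)"
  proof (rule mfps_vs.independent_if_scalars_zero)
    fix c x assume zero: "(\<Sum>x\<in>?M ` partitions_upto n. const (c x) * x) = 0" and "x \<in> ?M ` partitions_upto n"
    then obtain \<mu> where \<mu>: "\<mu> \<in> partitions_upto n" "x = ?M \<mu>" by blast
    obtain m :: "'v \<Rightarrow>\<^sub>0 nat" where m: "exponents m = \<mu>" using ex[OF \<mu>(1)] by blast
    have "0 = coeff (\<Sum>x\<in>?M ` partitions_upto n. const (c x) * x) m" by (simp add: zero)
    also have "\<dots> = (\<Sum>\<nu>\<in>partitions_upto n. coeff (const (c (?M \<nu>)) * ?M \<nu>) m)"
      by (simp add: sum.reindex[OF inj] coeff_sum)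
    also have "\<dots> = (\<Sum>\<nu>\<in>partitions_upto n. if \<mu> = \<nu> then c (?M \<nu>) else 0)"
      by (rule sum.cong) (auto simp: monomial_sf_def m)
    also have "\<dots> = c x"
      using \<mu> finite_partitions_upto by simp
    finally show "c x = 0" by simp
  qed (simp add: finite_partitions_upto)
qed

text \<open>
  The monomial functions of degree at most \<open>n\<close> are independent and lie in the span of the elementary
  functions of degree at most \<open>n\<close>. As both families are indexed by the same partitions, a smaller
  spanning subset of the latter is impossible.
\<close>

lemma elementary_independent_upto:
  assumes "infinite (UNIV :: 'v set)"
  shows "mfps_vs.independent ((elementary_sf :: _ \<Rightarrow> ('v, rat) mfps) ` partitions_upto n)"
    and "inj_on (elementary_sf :: _ \<Rightarrow> ('v, rat) mfps) (partitions_upto n)"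
proof -
  let ?M = "monomial_sf :: _ \<Rightarrow> ('v, rat) mfps" and ?E = "elementary_sf :: _ \<Rightarrow> ('v, rat) mfps"
  let ?P = "partitions_upto n"
  obtain B where B: "B \<subseteq> ?E ` ?P" "mfps_vs.independent B" "?E ` ?P \<subseteq> mfps_vs.span B"
    using mfps_vs.maximal_independent_subset[of "?E ` ?P"] by blast
  have finE: "finite (?E ` ?P)" using finite_partitions_upto by simp
  then have finB: "finite B" using B(1) by (rule rev_finite_subset)
  have "mfps_vs.span (?E ` ?P) \<subseteq> mfps_vs.span B"
    by (rule mfps_vs.span_minimal[OF B(3) mfps_vs.subspace_span])
  moreover have "?M ` ?P \<subseteq> mfps_vs.span (?E ` ?P)"
    using monomial_in_filtration by (auto simp: elementary_filtration_def)
  ultimately have "?M ` ?P \<subseteq> mfps_vs.span B" by (rule order_trans[rotated])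
  then have "card (?M ` ?P) \<le> card B"
    using mfps_vs.independent_span_bound[OF finB monomials_independent(1)[OF assms]] by blast
  then have card: "card ?P \<le> card B"
    by (simp add: card_image[OF monomials_independent(2)[OF assms]])
  have "card B \<le> card (?E ` ?P)" by (rule card_mono[OF finE B(1)])
  moreover have "card (?E ` ?P) \<le> card ?P" by (rule card_image_le[OF finite_partitions_upto])
  ultimately have "card B = card (?E ` ?P)" "card (?E ` ?P) = card ?P" using card by auto
  then show "inj_on ?E ?P" "mfps_vs.independent (?E ` ?P)"
    using eq_card_imp_inj_on[OF finite_partitions_upto] card_subset_eq[OF finE B(1)] B(2) by auto
qed

lemma elementary_independent:
  assumes "infinite (UNIV :: 'v set)"
  shows "mfps_vs.independent ((elementary_sf :: _ \<Rightarrow> ('v, rat) mfps) ` Collect is_partition)"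
    and "inj_on (elementary_sf :: _ \<Rightarrow> ('v, rat) mfps) (Collect is_partition)"
proof -
  let ?E = "elementary_sf :: _ \<Rightarrow> ('v, rat) mfps"
  have U: "Collect is_partition = (\<Union>n. partitions_upto n)"
    by (auto simp: partitions_upto_def)
  have chain: "partitions_upto m \<subseteq> partitions_upto n" if "m \<le> n" for m n
    using that by (auto simp: partitions_upto_def)
  have "mfps_vs.independent (\<Union> (range (\<lambda>n. ?E ` partitions_upto n)))"
  proof (rule mfps_vs.independent_Union_directed)
    fix c d assume "c \<in> range (\<lambda>n. ?E ` partitions_upto n)" "d \<in> range (\<lambda>n. ?E ` partitions_upto n)"
    then obtain m n where "c = ?E ` partitions_upto m" "d = ?E ` partitions_upto n" by blast
    then show "c \<subseteq> d \<or> d \<subseteq> c" using chain by (metis image_mono linear)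
  qed (use elementary_independent_upto(1)[OF assms] in blast)
  then show "mfps_vs.independent (?E ` Collect is_partition)"
    by (simp add: U image_UN)
  show "inj_on ?E (Collect is_partition)"
  proof (rule inj_onI)
    fix \<mu> \<nu> assume "\<mu> \<in> Collect is_partition" "\<nu> \<in> Collect is_partition" "?E \<mu> = ?E \<nu>"
    moreover from this have "\<mu> \<in> partitions_upto (max (sum_mset \<mu>) (sum_mset \<nu>))"
        "\<nu> \<in> partitions_upto (max (sum_mset \<mu>) (sum_mset \<nu>))"
      by (auto simp: partitions_upto_def)
    ultimately show "\<mu> = \<nu>" using elementary_independent_upto(2)[OF assms] by (metis inj_onD)
  qed
qed

section \<open>The involution \<open>\<omega>\<close>\<close>

lemma elementary_sf_in_symmetric_functions: "elementary_sf \<mu> \<in> symmetric_functions"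
  unfolding elementary_sf_def by (intro symmetric_functions_prod_mset elementary_in_symmetric_functions)

lemma symmetric_functions_eq_span:
  assumes "infinite (UNIV :: 'v set)"
  shows "(symmetric_functions :: ('v, rat) mfps set) = mfps_vs.span (elementary_sf ` Collect is_partition)"
proof
  show "(symmetric_functions :: ('v, rat) mfps set) \<subseteq> mfps_vs.span (elementary_sf ` Collect is_partition)"
  proof
    fix f :: "('v, rat) mfps" assume "f \<in> symmetric_functions"
    then obtain d where "f \<in> elementary_filtration d"
      using symmetric_function_in_filtration[OF assms] by blast
    moreover have "elementary_filtration d \<subseteq> mfps_vs.span (elementary_sf ` Collect is_partition)"
      unfolding elementary_filtration_def
      by (intro mfps_vs.span_mono image_mono) (auto simp: partitions_upto_def)
    ultimately show "f \<in> mfps_vs.span (elementary_sf ` Collect is_partition)" by blast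
  qed
  show "mfps_vs.span (elementary_sf ` Collect is_partition) \<subseteq> (symmetric_functions :: ('v, rat) mfps set)"
    by (rule mfps_vs.span_minimal)
      (auto simp: mfps_vs.subspace_def elementary_sf_in_symmetric_functions
        intro: symmetric_functions_add symmetric_functions_scale)
qed

text \<open>
  Identities that are linear in a symmetric function may be checked on the elementary basis.
\<close>

lemma symmetric_functions_induct [consumes 2, case_names zero step]:
  fixes f :: "('v, rat) mfps"
  assumes inf: "infinite (UNIV :: 'v set)" and "f \<in> symmetric_functions"
    and "P 0"
    and step: "\<And>c \<mu> g. is_partition \<mu> \<Longrightarrow> g \<in> symmetric_functions \<Longrightarrow> P g \<Longrightarrow>
      P (const c * elementary_sf \<mu> + g)"
  shows "P f"
proof -
  have "f \<in> mfps_vs.span (elementary_sf ` Collect is_partition)"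
    using assms(2) by (simp add: symmetric_functions_eq_span[OF inf])
  then have "f \<in> symmetric_functions \<and> P f"
  proof (induction rule: mfps_vs.span_induct_alt)
    case (step c x g)
    then obtain \<mu> where "is_partition \<mu>" "x = elementary_sf \<mu>" by blast
    then show ?case
      using step.IH assms(4)[of \<mu> g c]
      by (simp add: symmetric_functions_add symmetric_functions_scale elementary_sf_in_symmetric_functions)
  qed (simp add: assms(3))
  then show ?thesis ..
qed

text \<open>
  Prescribing \<open>e\<^sub>\<mu> \<mapsto> h\<^sub>\<mu>\<close> on the basis gives a linear map, and any other solution agrees with it on
  the span of the basis and, by convention, outside.
\<close>

lemma is_omega_omega:
  assumes "infinite (UNIV :: 'v set)"
  shows "is_omega (omega :: ('v, rat) mfps \<Rightarrow> ('v, rat) mfps)"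
proof -
  let ?E = "elementary_sf :: _ \<Rightarrow> ('v, rat) mfps"
  note ind = elementary_independent[OF assms]
  obtain g :: "('v, rat) mfps \<Rightarrow> ('v, rat) mfps" where g: "Vector_Spaces.linear (\<lambda>c f. const c * f) (\<lambda>c f. const c * f) g"
      "\<forall>x\<in>?E ` Collect is_partition. g x = complete_sf (inv_into (Collect is_partition) ?E x)"
    using mfps_pair.linear_independent_extend[OF ind(1),
        of "\<lambda>x. complete_sf (inv_into (Collect is_partition) ?E x)"] by blast
  interpret g: Vector_Spaces.linear "\<lambda>c f. const c * f :: ('v, rat) mfps" "\<lambda>c f. const c * f :: ('v, rat) mfps" g
    by (rule g(1))
  define \<phi> where "\<phi> f = (if f \<in> symmetric_functions then g f else 0)" for f
  have ex: "is_omega \<phi>"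
    unfolding is_omega_def
  proof (intro conjI ballI allI impI)
    fix \<mu> assume "is_partition \<mu>"
    then show "\<phi> (?E \<mu>) = complete_sf \<mu>"
      using g(2) ind(2) elementary_sf_in_symmetric_functions[of \<mu>, where ?'a = 'v]
      by (simp add: \<phi>_def)
  qed (auto simp: \<phi>_def symmetric_functions_add symmetric_functions_scale g.add g.scale)
  have unique: "\<psi> = \<phi>" if \<psi>: "is_omega \<psi>" for \<psi>
  proof
    fix f
    show "\<psi> f = \<phi> f"
    proof (cases "f \<in> symmetric_functions")
      case True
      with assms show ?thesis
      proof (induction rule: symmetric_functions_induct)
        case zero
        have "\<theta> 0 = 0" if "is_omega \<theta>" for \<theta> :: "('v, rat) mfps \<Rightarrow> ('v, rat) mfps"
        proof -
          have "\<theta> (const 0 * 0) = const 0 * \<theta> 0"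
            using that symmetric_functions_zero unfolding is_omega_def by blast
          then show ?thesis by simp
        qed
        from this[OF ex] this[OF \<psi>] show ?case by simp
      next
        case (step c \<mu> g)
        have x: "?E \<mu> \<in> symmetric_functions" "const c * ?E \<mu> \<in> symmetric_functions"
          by (simp_all add: elementary_sf_in_symmetric_functions symmetric_functions_scale)
        have "\<theta> (const c * ?E \<mu> + g) = const c * complete_sf \<mu> + \<theta> g" if "is_omega \<theta>"
          for \<theta> :: "('v, rat) mfps \<Rightarrow> ('v, rat) mfps"
          using that x step.hyps unfolding is_omega_def by simp
        from this[OF ex] this[OF \<psi>] show ?case by (simp add: step.IH)
      qed
    next
      case False
      then show ?thesis using \<psi> ex by (simp add: is_omega_def)
    qed
  qed
  show ?thesis
    unfolding omega_def by (rule theI[of is_omega, OF ex unique])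
qed

lemma omega_add:
  fixes f g :: "('v, rat) mfps"
  assumes "infinite (UNIV :: 'v set)" "f \<in> symmetric_functions" "g \<in> symmetric_functions"
  shows "omega (f + g) = omega f + omega g"
  using is_omega_omega[OF assms(1)] assms(2,3) by (simp add: is_omega_def)

lemma omega_scale:
  fixes f :: "('v, rat) mfps"
  assumes "infinite (UNIV :: 'v set)" "f \<in> symmetric_functions"
  shows "omega (const c * f) = const c * omega f"
  using is_omega_omega[OF assms(1)] assms(2) by (simp add: is_omega_def)

lemma omega_elementary_sf:
  assumes "infinite (UNIV :: 'v set)" "is_partition \<mu>"
  shows "omega (elementary_sf \<mu> :: ('v, rat) mfps) = complete_sf \<mu>"
  using is_omega_omega[OF assms(1)] assms(2) by (simp add: is_omega_def)

lemma omega_zero: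
  assumes "infinite (UNIV :: 'v set)"
  shows "omega (0 :: ('v, rat) mfps) = 0"
  using omega_scale[OF assms symmetric_functions_zero, of 0] by simp

lemma omega_sum:
  fixes F :: "'i \<Rightarrow> ('v, rat) mfps"
  assumes "infinite (UNIV :: 'v set)" "\<And>i. i \<in> I \<Longrightarrow> F i \<in> symmetric_functions"
  shows "omega (\<Sum>i\<in>I. F i) = (\<Sum>i\<in>I. omega (F i))"
  using assms(2)
  by (induction I rule: infinite_finite_induct)
    (simp_all add: omega_zero assms(1) omega_add symmetric_functions_sum)

text \<open>
  By linearity in each factor, this reduces to \<open>e\<^sub>\<mu> e\<^sub>\<nu> = e\<^bsub>\<mu> + \<nu>\<^esub>\<close> and \<open>h\<^sub>\<mu> h\<^sub>\<nu> = h\<^bsub>\<mu> + \<nu>\<^esub>\<close>.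
\<close>

lemma omega_mult:
  fixes f g :: "('v, rat) mfps"
  assumes inf: "infinite (UNIV :: 'v set)" and f: "f \<in> symmetric_functions" and g: "g \<in> symmetric_functions"
  shows "omega (f * g) = omega f * omega g"
proof -
  let ?E = "elementary_sf :: _ \<Rightarrow> ('v, rat) mfps"
  note [simp] = elementary_sf_in_symmetric_functions symmetric_functions_mult symmetric_functions_scale
    omega_add[OF inf] omega_scale[OF inf] omega_elementary_sf[OF inf] omega_zero[OF inf]
  have e: "omega (?E \<mu> * g) = omega (?E \<mu>) * omega g" if \<mu>: "is_partition \<mu>" for \<mu>
    using inf g
  proof (induction rule: symmetric_functions_induct)
    case (step c \<nu> h)
    have "is_partition (\<mu> + \<nu>)" using \<mu> step.hyps by (simp add: is_partition_def)
    then have "omega (?E \<mu> * ?E \<nu>) = omega (?E \<mu>) * omega (?E \<nu>)"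
      using \<mu> step.hyps unfolding elementary_sf_union[symmetric] by (simp add: complete_sf_union)
    moreover have "?E \<mu> * (const c * ?E \<nu> + h) = const c * (?E \<mu> * ?E \<nu>) + ?E \<mu> * h"
      by (simp add: algebra_simps)
    ultimately show ?case
      using step by (simp add: algebra_simps)
  qed simp
  show ?thesis
    using inf f
  proof (induction rule: symmetric_functions_induct)
    case (step c \<nu> h)
    have "(const c * ?E \<nu> + h) * g = const c * (?E \<nu> * g) + h * g" by (simp add: algebra_simps)
    moreover have "omega (const c * (?E \<nu> * g) + h * g)
        = const c * (omega (?E \<nu>) * omega g) + omega h * omega g"
      using step g e[OF step.hyps(1)] by simp
    moreover have "omega (const c * ?E \<nu> + h) = const c * omega (?E \<nu>) + omega h"
      using step by simp
    ultimately show ?case by (simp only: distrib_right mult.assoc)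
  qed simp
qed

lemma omega_one:
  assumes "infinite (UNIV :: 'v set)"
  shows "omega (1 :: ('v, rat) mfps) = 1"
  using omega_elementary_sf[OF assms, of "{#}"] by (simp add: elementary_sf_def complete_sf_def is_partition_def)

lemma omega_elementary:
  assumes "infinite (UNIV :: 'v set)"
  shows "omega (elementary n :: ('v, rat) mfps) = complete n"
proof (cases "n = 0")
  case True
  then show ?thesis by (simp add: elementary_0 complete_0 omega_one assms)
next
  case False
  then show ?thesis
    using omega_elementary_sf[OF assms, of "{#n#}"] by (simp add: elementary_sf_def complete_sf_def is_partition_def)
qed

text \<open>
  Applying \<open>\<omega>\<close> to Newton's identity for the \<open>e\<^sub>n\<close> must give Newton's identity for the \<open>h\<^sub>n\<close>.
  By induction all summands but the last correspond, hence so does the last.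
\<close>

lemma omega_power_sum:
  assumes inf: "infinite (UNIV :: 'v set)" and "0 < n"
  shows "omega (power_sum n :: ('v, rat) mfps) = const ((-1) ^ (n - 1)) * power_sum n"
  using assms(2)
proof (induction n rule: less_induct)
  case (less n)
  let ?p = "power_sum :: _ \<Rightarrow> ('v, rat) mfps"
  have sym: "const ((-1) ^ (i - 1)) * (?p i * elementary (n - i)) \<in> symmetric_functions" if "i \<in> {1..<n}" for i
    using that by (intro symmetric_functions_scale symmetric_functions_mult
        power_sum_in_symmetric_functions elementary_in_symmetric_functions) auto
  have sum: "(\<Sum>i=1..<n. const ((-1) ^ (i - 1)) * (?p i * elementary (n - i))) \<in> symmetric_functions"
    by (rule symmetric_functions_sum[OF sym])
  have term_eq: "omega (const ((-1) ^ (i - 1)) * (?p i * elementary (n - i))) = ?p i * complete (n - i)"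
    if i: "i \<in> {1..<n}" for i
  proof -
    have "omega (const ((-1) ^ (i - 1)) * (?p i * elementary (n - i)))
        = const ((-1) ^ (i - 1)) * (omega (?p i) * complete (n - i))"
      using i by (simp add: omega_scale omega_mult inf symmetric_functions_mult
          power_sum_in_symmetric_functions elementary_in_symmetric_functions omega_elementary)
    also have "\<dots> = (const ((-1) ^ (i - 1)) * const ((-1) ^ (i - 1))) * (?p i * complete (n - i))"
      using less.IH[of i] i by simp
    also have "const ((-1) ^ (i - 1)) * const ((-1) ^ (i - 1)) = (1 :: ('v, rat) mfps)"
      by (simp add: const_mult[symmetric] flip: power_add)
    finally show ?thesis by simp
  qed
  have diff: "omega (f - g) = omega f - omega g" if "f \<in> symmetric_functions" "g \<in> symmetric_functions"
    for f g :: "('v, rat) mfps"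
  proof -
    have "f - g = f + const (-1) * g" by (simp add: const_uminus)
    moreover have "omega (f + const (-1) * g) = omega f + const (-1) * omega g"
      by (simp only: omega_add[OF inf that(1) symmetric_functions_scale[OF that(2)]] omega_scale[OF inf that(2)])
    ultimately show ?thesis by (simp add: const_uminus)
  qed
  have "omega (?p n) = const ((-1) ^ (n - 1)) * (const (of_nat n) * complete n
      - (\<Sum>i=1..<n. ?p i * complete (n - i)))"
  proof -
    let ?R = "const (of_nat n) * elementary n
        - (\<Sum>i=1..<n. const ((-1) ^ (i - 1)) * (?p i * elementary (n - i)))"
    have R: "?R \<in> symmetric_functions"
    proof -
      have "const (of_nat n) * elementary n
          + const (-1) * (\<Sum>i=1..<n. const ((-1) ^ (i - 1)) * (?p i * elementary (n - i))) \<in> symmetric_functions"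
        by (intro symmetric_functions_add symmetric_functions_scale sum elementary_in_symmetric_functions)
      then show ?thesis by (simp add: const_uminus)
    qed
    have "omega (?p n) = const ((-1) ^ (n - 1)) * omega ?R"
      by (subst newton_elementary_last[OF less.prems]) (rule omega_scale[OF inf R])
    also have "omega ?R = const (of_nat n) * complete n
        - (\<Sum>i=1..<n. omega (const ((-1) ^ (i - 1)) * (?p i * elementary (n - i))))"
      by (simp only: diff[OF symmetric_functions_scale[OF elementary_in_symmetric_functions] sum]
          omega_sum[OF inf sym] omega_scale[OF inf elementary_in_symmetric_functions] omega_elementary[OF inf])
    also have "(\<Sum>i=1..<n. omega (const ((-1) ^ (i - 1)) * (?p i * elementary (n - i))))
        = (\<Sum>i=1..<n. ?p i * complete (n - i))"
      by (rule sum.cong[OF refl term_eq])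
    finally show ?thesis .
  qed
  also have "const (of_nat n) * complete n - (\<Sum>i=1..<n. ?p i * complete (n - i)) = ?p n"
  proof -
    have "{1..n} = insert n {1..<n}" using less.prems by auto
    then show ?thesis
      using newton_complete[of n, where ?'a = 'v] by (simp add: complete_0 const_of_nat)
  qed
  finally show ?case .
qed

lemma omega_prod_power_sum:
  assumes inf: "infinite (UNIV :: 'v set)" and "finite I" "\<And>c. c \<in> I \<Longrightarrow> 0 < n c"
  shows "omega (\<Prod>c\<in>I. power_sum (n c) :: ('v, rat) mfps)
      = (\<Prod>c\<in>I. const ((-1) ^ (n c - 1)) * power_sum (n c))"
    and "(\<Prod>c\<in>I. power_sum (n c) :: ('v, rat) mfps) \<in> symmetric_functions"
proof -
  have "omega (\<Prod>c\<in>I. power_sum (n c) :: ('v, rat) mfps)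
      = (\<Prod>c\<in>I. const ((-1) ^ (n c - 1)) * power_sum (n c)) \<and>
      (\<Prod>c\<in>I. power_sum (n c) :: ('v, rat) mfps) \<in> symmetric_functions"
    using assms(2,3)
    by (induction I rule: finite_induct)
      (simp_all add: omega_one omega_mult inf power_sum_in_symmetric_functions omega_power_sum symmetric_functions_mult)
  then show "omega (\<Prod>c\<in>I. power_sum (n c) :: ('v, rat) mfps)
      = (\<Prod>c\<in>I. const ((-1) ^ (n c - 1)) * power_sum (n c))"
    "(\<Prod>c\<in>I. power_sum (n c) :: ('v, rat) mfps) \<in> symmetric_functions" by blast+
qed

section \<open>Series in two sets of variables\<close>

lemma lookup_xy_parts:
  "Poly_Mapping.lookup (x_part m) i = Poly_Mapping.lookup m (Inl i)"
  "Poly_Mapping.lookup (y_part m) i = Poly_Mapping.lookup m (Inr i)"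
  by (simp_all add: x_part_def y_part_def map_key.rep_eq)

lemma lookup_xy_mono:
  "Poly_Mapping.lookup (xy_mono a b) (Inl i) = Poly_Mapping.lookup a i"
  "Poly_Mapping.lookup (xy_mono a b) (Inr j) = Poly_Mapping.lookup b j"
  by (simp_all add: xy_mono_def Poly_Mapping.lookup_add lookup_rename_mono_inj image_iff)

lemma xy_mono_parts [simp]: "xy_mono (x_part m) (y_part m) = m"
proof (rule poly_mapping_eqI)
  fix k show "Poly_Mapping.lookup (xy_mono (x_part m) (y_part m)) k = Poly_Mapping.lookup m k"
    by (cases k) (simp_all add: lookup_xy_mono lookup_xy_parts)
qed

lemma parts_xy_mono [simp]: "x_part (xy_mono a b) = a" "y_part (xy_mono a b) = b"
  by (rule poly_mapping_eqI, simp add: lookup_xy_mono lookup_xy_parts)+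

text \<open>
  The splitting of \<open>m\<close> into its \<open>x\<close> part and its \<open>y\<close> part is the only one that contributes.
\<close>

lemma coeff_in_x_mult_in_y: "coeff (in_x f * in_y g) m = coeff f (x_part m) * coeff g (y_part m)"
proof -
  let ?s = "(rename_mono Inl (x_part m), rename_mono Inr (y_part m))"
  have mem: "?s \<in> splits m"
    using xy_mono_parts[of m] by (simp add: splits_def xy_mono_def)
  have "coeff (in_x f) (fst s) * coeff (in_y g) (snd s)
      = (if s = ?s then coeff f (x_part m) * coeff g (y_part m) else 0)" if s: "s \<in> splits m" for s
  proof (cases "fst s \<in> range (rename_mono Inl) \<and> snd s \<in> range (rename_mono Inr)")
    case True
    then obtain a b where ab: "fst s = rename_mono Inl a" "snd s = rename_mono Inr b" by blast
    then have "m = xy_mono a b" using s by (auto simp: splits_def xy_mono_def)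
    then show ?thesis
      using ab by (simp add: in_x_def in_y_def coeff_rename_inj prod_eq_iff)
  next
    case False
    then have "s \<noteq> ?s" by auto
    then show ?thesis
      using False coeff_rename_inj(2)[of Inl "fst s" f] coeff_rename_inj(2)[of Inr "snd s" g]
      by (auto simp: in_x_def in_y_def)
  qed
  then have "coeff (in_x f * in_y g) m
      = (\<Sum>s\<in>splits m. if s = ?s then coeff f (x_part m) * coeff g (y_part m) else 0)"
    unfolding coeff_mult by (rule sum.cong[OF refl])
  also have "\<dots> = coeff f (x_part m) * coeff g (y_part m)"
    using mem finite_splits[of m] by (simp only: sum.delta if_True)
  finally show ?thesis .
qed

lemma rename_const:
  assumes "inj \<rho>"
  shows "rename \<rho> (const c) = const c"
proof (rule mfps_eqI)
  fix m
  have z: "rename_mono \<rho> 0 = 0" by (simp add: rename_mono_def)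
  show "coeff (rename \<rho> (const c)) m = coeff (const c) m"
  proof (cases "m \<in> range (rename_mono \<rho>)")
    case True
    then obtain a where a: "m = rename_mono \<rho> a" by blast
    have "m = 0 \<longleftrightarrow> a = 0" unfolding a using rename_mono_eq_iff[OF assms, of a 0] z by simp
    then show ?thesis
      using coeff_rename_inj(1)[OF assms, of "const c" a] unfolding a by (simp add: const_def)
  next
    case False
    then have "m \<noteq> 0" using z by (metis rangeI)
    then show ?thesis using coeff_rename_inj(2)[OF assms False] by (simp add: const_def)
  qed
qed

lemma rename_sum: "rename \<rho> (\<Sum>i\<in>I. F i) = (\<Sum>i\<in>I. rename \<rho> (F i))"
proof -
  have zero: "rename \<rho> 0 = 0" by (rule mfps_eqI) (simp add: rename_def)
  show ?thesis
    by (induction I rule: infinite_finite_induct) (auto simp: zero rename_add)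
qed

lemma rename_prod:
  assumes "inj \<rho>"
  shows "rename \<rho> (\<Prod>i\<in>I. F i) = (\<Prod>i\<in>I. rename \<rho> (F i))"
proof -
  have one: "rename \<rho> 1 = 1" using rename_const[OF assms, of 1] by simp
  show ?thesis
    by (induction I rule: infinite_finite_induct)
      (auto simp: one rename_mult finite_vimage_inj[OF assms])
qed

lemma rename_scale:
  assumes "inj \<rho>"
  shows "rename \<rho> (const c * f) = const c * rename \<rho> f"
  by (simp add: rename_mult finite_vimage_inj[OF assms] rename_const[OF assms])

text \<open>
  For a bijection between different sets of variables: with \<open>sum_decode\<close>, power sums in the \<open>x\<close>
  alone turn into power sums in the \<open>x\<close> and \<open>y\<close> together.
\<close>

lemma rename_power_sum_bij:
  assumes "bij \<rho>" "0 < n"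
  shows "rename \<rho> (power_sum n) = power_sum n"
proof (rule mfps_eqI)
  fix m
  have "(\<exists>i. m = Poly_Mapping.single (\<rho> i) n) \<longleftrightarrow> (\<exists>i. m = Poly_Mapping.single i n)"
    using assms(1) by (metis bij_pointE)
  then show "coeff (rename \<rho> (power_sum n)) m = coeff (power_sum n) m"
    unfolding coeff_rename_power_sum[OF bij_is_inj[OF assms(1)] assms(2)] by (simp add: power_sum_def)
qed

lemma bij_sum_decode: "bij sum_decode"
  by (metis bij_betw_def inj_sum_decode surj_sum_decode)

lemma power_sum_union:
  assumes "0 < n"
  shows "(power_sum n :: xy_series) = in_x (power_sum n) + in_y (power_sum n)"
proof -
  have "rename sum_decode (power_sum n) = in_x (power_sum n) + in_y (power_sum n)"
    using x_to_xy_power_sum[OF assms]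
    by (simp add: x_to_xy_def in_x_def rename_comp finite_vimage_x_to_xy finite_vimage_inj comp_def)
  then show ?thesis by (simp add: rename_power_sum_bij[OF bij_sum_decode assms])
qed

text \<open>
  The substitution \<open>g \<mapsto> g(-y)\<close> for a series in one set of variables.
\<close>

definition negate :: "('v, rat) mfps \<Rightarrow> ('v, rat) mfps" where
  "negate f = Mfps (\<lambda>m. (-1) ^ mono_degree m * coeff f m)"

lemma negate_y_in_x_mult_in_y: "negate_y (in_x f * in_y g) = in_x f * in_y (negate g)"
  by (rule mfps_eqI) (simp add: negate_y_def negate_def coeff_in_x_mult_in_y)

lemma negate_y_sum: "negate_y (\<Sum>i\<in>I. F i) = (\<Sum>i\<in>I. negate_y (F i))"
  by (rule mfps_eqI) (simp add: negate_y_def coeff_sum sum_distrib_left)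

lemma in_x_one: "in_x 1 = 1"
  using rename_const[of "Inl :: nat \<Rightarrow> nat + nat" 1] by (simp add: in_x_def)

lemma negate_y_in_y: "negate_y (in_y g) = in_y (negate g)"
  using negate_y_in_x_mult_in_y[of 1 g] by (simp add: in_x_one)

lemma negate_mult: "negate (f * g) = negate f * negate g"
proof (rule mfps_eqI)
  fix m
  have "coeff (negate f * negate g) m
      = (\<Sum>x\<in>splits m. (-1) ^ mono_degree m * (coeff f (fst x) * coeff g (snd x)))"
    unfolding coeff_mult
    by (rule sum.cong) (auto simp: splits_def negate_def power_add)
  then show "coeff (negate (f * g)) m = coeff (negate f * negate g) m"
    by (simp add: negate_def coeff_mult sum_distrib_left)
qed

lemma negate_power_sum: "negate (power_sum n) = const ((-1) ^ n) * power_sum n"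
  by (rule mfps_eqI) (auto simp: negate_def power_sum_def)

lemma negate_prod_power_sum:
  "negate (\<Prod>c\<in>I. power_sum (n c)) = (\<Prod>c\<in>I. const ((-1) ^ n c) * power_sum (n c))"
proof -
  have one: "negate 1 = 1"
    by (rule mfps_eqI) (auto simp: negate_def coeff_one mono_degree_def)
  show ?thesis
    by (induction I rule: infinite_finite_induct) (auto simp: one negate_mult negate_power_sum)
qed

lemma omega_x_sum:
  assumes "\<And>i. i \<in> I \<Longrightarrow> F i \<in> symmetric_functions"
  shows "omega_x (\<Sum>i\<in>I. in_x (F i) * in_y (G i)) = (\<Sum>i\<in>I. in_x (omega (F i)) * in_y (G i))"
proof (rule mfps_eqI)
  fix m
  let ?H = "\<Sum>i\<in>I. in_x (F i) * in_y (G i)" and ?b = "y_part m"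
  have "y_coeff ?H ?b = (\<Sum>i\<in>I. const (coeff (G i) ?b) * F i)"
    by (rule mfps_eqI) (simp add: y_coeff_def coeff_sum coeff_in_x_mult_in_y, rule sum.cong[OF refl mult.commute])
  then have "omega (y_coeff ?H ?b) = (\<Sum>i\<in>I. const (coeff (G i) ?b) * omega (F i))"
    using assms by (simp add: omega_sum omega_scale symmetric_functions_scale)
  then show "coeff (omega_x ?H) m = coeff (\<Sum>i\<in>I. in_x (omega (F i)) * in_y (G i)) m"
    by (simp add: omega_x_def coeff_sum coeff_in_x_mult_in_y) (rule sum.cong[OF refl mult.commute])
qed

lemma x_to_xy_sum:
  "x_to_xy (\<Sum>i\<in>I. in_x (F i) * in_y (G i)) = (\<Sum>i\<in>I. rename sum_decode (F i) * in_y (G i))"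
proof -
  have x: "x_to_xy (in_x f) = rename sum_decode f" for f
    by (simp add: x_to_xy_def in_x_def rename_comp finite_vimage_x_to_xy finite_vimage_inj comp_def)
  have "x_to_xy (\<Sum>i\<in>I. in_x (F i) * in_y (G i)) = (\<Sum>i\<in>I. x_to_xy (in_x (F i) * in_y (G i)))"
    unfolding x_to_xy_def by (rule rename_sum)
  then show ?thesis by (simp add: x_to_xy_mult x x_to_xy_in_y)
qed

section \<open>Both sides as sums over permutations\<close>

lemma power_sum_sf_type: "power_sum_sf (set_partition_type P) = (\<Prod>C\<in>P. power_sum (card C))"
  by (simp add: power_sum_sf_def set_partition_type_def multiset.map_comp comp_def prod_unfold_prod_mset)

context cover
begin

lemma aug_monomial_type:
  "(aug_monomial_sf (set_partition_type (path_sets D S)) :: ('v, rat) mfps)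
    = (\<Sum>w\<in>extensions. \<Prod>C\<in>open_orbits w. const ((-1) ^ (card C - 1 + card (C \<inter> tails))) * power_sum (card C))"
proof -
  have card: "sum (\<lambda>_. Suc 0) = (card :: 'a set \<Rightarrow> nat)" by (rule ext) simp
  show ?thesis
    using aug_monomial_paths[of "\<lambda>_. 1", where ?'v = 'v]
    by (simp add: card set_partition_type_def weight_def const_prod prod.distrib)
qed

lemma card_open_orbit_pos:
  assumes "w \<in> extensions" "C \<in> open_orbits w"
  shows "0 < card C"
  using open_orbits_props(3,4)[OF assms(1)] assms(2) by (simp add: card_gt_0_iff)

text \<open>
  The sign \<open>(-1)\<^bsup>|C| - 1\<^esup>\<close> of \<open>\<omega> p\<^bsub>|C|\<^esub>\<close> cancels against the same sign in the expansion.
\<close>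

lemma omega_aug_monomial_type:
  assumes inf: "infinite (UNIV :: 'v set)"
  shows "omega (aug_monomial_sf (set_partition_type (path_sets D S)) :: ('v, rat) mfps)
    = (\<Sum>w\<in>extensions. \<Prod>C\<in>open_orbits w. const ((-1) ^ card (C \<inter> tails)) * power_sum (card C))"
proof -
  let ?p = "\<lambda>w. \<Prod>C\<in>open_orbits w. power_sum (card C) :: ('v, rat) mfps"
  note P = omega_prod_power_sum[OF inf open_orbits_props(1) card_open_orbit_pos]
  have aug: "(aug_monomial_sf (set_partition_type (path_sets D S)) :: ('v, rat) mfps)
      = (\<Sum>w\<in>extensions. const (\<Prod>C\<in>open_orbits w. (-1) ^ (card C - 1 + card (C \<inter> tails))) * ?p w)"
    by (simp add: aug_monomial_type prod.distrib const_prod)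
  have "omega (aug_monomial_sf (set_partition_type (path_sets D S)) :: ('v, rat) mfps)
      = (\<Sum>w\<in>extensions. const (\<Prod>C\<in>open_orbits w. (-1) ^ (card C - 1 + card (C \<inter> tails))) * omega (?p w))"
    unfolding aug using P(2) by (simp add: omega_sum omega_scale inf symmetric_functions_scale)
  also have "\<dots> = (\<Sum>w\<in>extensions. \<Prod>C\<in>open_orbits w. const ((-1) ^ card (C \<inter> tails)) * power_sum (card C))"
  proof (rule sum.cong[OF refl])
    fix w assume w: "w \<in> extensions"
    have cancel: "const ((-1) ^ (k + l)) * (const ((-1) ^ k) * f) = const ((-1) ^ l) * f"
      for k l and f :: "('v, rat) mfps"
    proof -
      have "(-1 :: rat) ^ (k + l) * (-1) ^ k = (-1) ^ l"
        by (simp add: power_add flip: power_mult_distrib)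
      then show ?thesis by (simp only: mult.assoc[symmetric] const_mult[symmetric])
    qed
    show "const (\<Prod>C\<in>open_orbits w. (-1) ^ (card C - 1 + card (C \<inter> tails))) * omega (?p w)
        = (\<Prod>C\<in>open_orbits w. const ((-1) ^ card (C \<inter> tails)) * power_sum (card C))"
      by (simp only: P(1)[OF w w] const_prod prod.distrib[symmetric] cancel)
  qed
  finally show ?thesis .
qed

lemma prod_orbits:
  assumes w: "w \<in> extensions"
  shows "(\<Prod>C\<in>open_orbits w. F C) * (\<Prod>C\<in>cycle_sets D S. G C)
    = (\<Prod>C\<in>orbits w V. if C \<subseteq> C \<inter> tails then G C else F C)"
proof -
  have fin: "finite (orbits w V)" by (rule orbits_props[OF extensionsD(1)[OF w] finite_verts])
  have "(\<Prod>C\<in>orbits w V. if C \<subseteq> C \<inter> tails then G C else F C)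
      = (\<Prod>C\<in>orbits w V \<inter> {C. C \<subseteq> C \<inter> tails}. G C) * (\<Prod>C\<in>orbits w V \<inter> - {C. C \<subseteq> C \<inter> tails}. F C)"
    by (rule prod.If_cases[OF fin])
  moreover have "orbits w V \<inter> {C. C \<subseteq> C \<inter> tails} = cycle_sets D S"
    unfolding full_orbits_eq_cycle_sets[OF w, symmetric] by (auto simp: full_orbits_def)
  moreover have "orbits w V \<inter> - {C. C \<subseteq> C \<inter> tails} = open_orbits w"
    by (auto simp: open_orbits_def)
  ultimately show ?thesis by (simp add: mult.commute)
qed

end

text \<open>
  The contribution of an orbit \<open>C\<close> in which \<open>U\<close> is the set of initial vertices of arcs in the cover: the first
  for the defining sum of the path-cycle symmetric function, the second for the sum over covers
  of the complement.
\<close>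

definition left_factor :: "'a set \<Rightarrow> 'a set \<Rightarrow> xy_series" where
  "left_factor C U = (if C \<subseteq> U then in_y (power_sum (card C))
     else const ((-1) ^ (card C - 1 + card U)) * in_x (power_sum (card C)))"

definition right_factor :: "'a set \<Rightarrow> 'a set \<Rightarrow> xy_series" where
  "right_factor C U = (if C \<subseteq> U then const ((-1) ^ card C) * in_y (power_sum (card C))
     else const ((-1) ^ card U) * (in_x (power_sum (card C)) + in_y (power_sum (card C))))"

context cover
begin

lemma in_x_in_y_expansion:
  "in_x (aug_monomial_sf (set_partition_type (path_sets D S))) *
      in_y (power_sum_sf (set_partition_type (cycle_sets D S)))
    = (\<Sum>w\<in>extensions. \<Prod>C\<in>orbits w V. left_factor C (C \<inter> tails))"
  unfolding aug_monomial_type power_sum_sf_type in_x_def in_y_def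
    rename_sum rename_prod[OF inj_Inl] rename_prod[OF inj_Inr] rename_scale[OF inj_Inl] sum_distrib_right
  by (rule sum.cong[OF refl]) (simp only: prod_orbits left_factor_def in_x_def in_y_def)

lemma omega_negate_expansion:
  "omega (aug_monomial_sf (set_partition_type (path_sets D S))) *
      in_y (negate (power_sum_sf (set_partition_type (cycle_sets D S))))
    = (\<Sum>w\<in>extensions. \<Prod>C\<in>orbits w V. right_factor C (C \<inter> tails))"
proof -
  have inf: "infinite (UNIV :: (nat + nat) set)" by simp
  have "(\<Prod>C\<in>open_orbits w. const ((-1) ^ card (C \<inter> tails)) * (power_sum (card C) :: xy_series))
      = (\<Prod>C\<in>open_orbits w. const ((-1) ^ card (C \<inter> tails)) * (in_x (power_sum (card C)) + in_y (power_sum (card C))))"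
    if "w \<in> extensions" for w
    by (rule prod.cong[OF refl]) (simp only: power_sum_union[OF card_open_orbit_pos[OF that]])
  then have 1: "omega (aug_monomial_sf (set_partition_type (path_sets D S)) :: xy_series)
      = (\<Sum>w\<in>extensions. \<Prod>C\<in>open_orbits w. const ((-1) ^ card (C \<inter> tails)) *
          (in_x (power_sum (card C)) + in_y (power_sum (card C))))"
    unfolding omega_aug_monomial_type[OF inf] by (intro sum.cong refl)
  have 2: "in_y (negate (power_sum_sf (set_partition_type (cycle_sets D S))))
      = (\<Prod>C\<in>cycle_sets D S. const ((-1) ^ card C) * in_y (power_sum (card C)))"
    unfolding power_sum_sf_type negate_prod_power_sum in_y_def rename_prod[OF inj_Inr] rename_scale[OF inj_Inr] ..
  show ?thesis
    unfolding 1 2 sum_distrib_right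
    by (rule sum.cong[OF refl]) (simp only: prod_orbits right_factor_def)
qed

text \<open>
  The value of \<open>\<omega>\<close> depends on the set of variables; for augmented monomial functions both values have
  the same expansion in power sums.
\<close>

lemma rename_omega_aug_monomial:
  "rename sum_decode (omega (aug_monomial_sf (set_partition_type (path_sets D S))))
    = omega (aug_monomial_sf (set_partition_type (path_sets D S)))"
proof -
  have inf: "infinite (UNIV :: (nat + nat) set)" "infinite (UNIV :: nat set)" by simp_all
  have "(\<Prod>C\<in>open_orbits w. const ((-1) ^ card (C \<inter> tails)) * rename sum_decode (power_sum (card C)))
      = (\<Prod>C\<in>open_orbits w. const ((-1) ^ card (C \<inter> tails)) * power_sum (card C))"
    if "w \<in> extensions" for w
    by (rule prod.cong[OF refl]) (simp only: rename_power_sum_bij[OF bij_sum_decode card_open_orbit_pos[OF that]])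
  then show ?thesis
    unfolding omega_aug_monomial_type[OF inf(1)] omega_aug_monomial_type[OF inf(2)]
      rename_sum rename_prod[OF inj_sum_decode] rename_scale[OF inj_sum_decode]
    by (intro sum.cong refl)
qed

end

section \<open>Comparison orbit by orbit\<close>

lemma cover_path_cycle_cover:
  assumes "finite (pverts D)" "parcs D \<subseteq> pverts D \<times> pverts D" "path_cycle_cover D S"
  shows "cover D S"
  using assms by unfold_locales (auto simp: path_cycle_cover_def)

text \<open>
  Choosing a subset of \<open>A\<close> amounts to choosing its intersection with each block independently.
\<close>

lemma sum_Pow_prod_blocks:
  fixes g :: "'a set \<Rightarrow> 'a set \<Rightarrow> 'b :: comm_semiring_1"
  assumes "finite Q" "\<And>C. C \<in> Q \<Longrightarrow> finite C"
    and disj: "\<And>C C'. C \<in> Q \<Longrightarrow> C' \<in> Q \<Longrightarrow> C \<noteq> C' \<Longrightarrow> C \<inter> C' = {}"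
    and "A \<subseteq> \<Union>Q"
  shows "(\<Sum>T\<in>Pow A. \<Prod>C\<in>Q. g C (C \<inter> T)) = (\<Prod>C\<in>Q. \<Sum>U\<in>Pow (C \<inter> A). g C U)"
proof -
  have "(\<Prod>C\<in>Q. \<Sum>U\<in>Pow (C \<inter> A). g C U) = (\<Sum>h\<in>(\<Pi>\<^sub>E C\<in>Q. Pow (C \<inter> A)). \<Prod>C\<in>Q. g C (h C))"
    by (rule prod_sum_PiE) (use assms in auto)
  also have "\<dots> = (\<Sum>T\<in>Pow A. \<Prod>C\<in>Q. g C (C \<inter> T))"
  proof (rule sum.reindex_bij_witness[of _ "\<lambda>T. \<lambda>C\<in>Q. C \<inter> T" "\<lambda>h. \<Union>C\<in>Q. h C"])
    fix h assume h: "h \<in> (\<Pi>\<^sub>E C\<in>Q. Pow (C \<inter> A))"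
    have hC: "h C \<subseteq> C" "h C \<subseteq> A" if "C \<in> Q" for C using h that by (auto simp: PiE_def Pi_def)
    have int: "C \<inter> (\<Union>C\<in>Q. h C) = h C" if "C \<in> Q" for C
    proof
      show "C \<inter> (\<Union>C\<in>Q. h C) \<subseteq> h C"
        using disj[OF that] hC(1) by blast
    qed (use hC that in blast)
    show "(\<lambda>C\<in>Q. C \<inter> (\<Union>C\<in>Q. h C)) = h"
      by (rule extensionalityI[of _ Q]) (use h int in \<open>auto simp: PiE_def\<close>)
    show "(\<Union>C\<in>Q. h C) \<in> Pow A" using hC(2) by blast
    show "(\<Prod>C\<in>Q. g C (C \<inter> (\<Union>C\<in>Q. h C))) = (\<Prod>C\<in>Q. g C (h C))"
      by (rule prod.cong[OF refl]) (simp only: int)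
  next
    fix T assume T: "T \<in> Pow A"
    show "(\<Union>C\<in>Q. (\<lambda>C\<in>Q. C \<inter> T) C) = T" using T assms(4) by auto
    show "(\<lambda>C\<in>Q. C \<inter> T) \<in> (\<Pi>\<^sub>E C\<in>Q. Pow (C \<inter> A))" using T by auto
  qed
  finally show ?thesis ..
qed

text \<open>
  A pair of a cover \<open>S\<close> and an extension \<open>w\<close> is determined by \<open>w\<close> and the set \<open>T\<close> of initial vertices
  of the arcs in \<open>S\<close>, and \<open>T\<close> may be any set of vertices \<open>v\<close> for which \<open>(v, w v)\<close> is an arc of \<open>D\<close>.
\<close>

lemma sum_covers_eq_sum_permutations:
  fixes g :: "'a set \<Rightarrow> 'a set \<Rightarrow> 'b :: comm_semiring_1"
  assumes fin: "finite (pverts D)" and arcs: "parcs D \<subseteq> pverts D \<times> pverts D"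
  shows "(\<Sum>S | path_cycle_cover D S. \<Sum>w\<in>cover.extensions D S.
        \<Prod>C\<in>orbits w (pverts D). g C (C \<inter> cover.tails S))
    = (\<Sum>w | w permutes pverts D. \<Prod>C\<in>orbits w (pverts D).
        \<Sum>U\<in>Pow {v \<in> C. (v, w v) \<in> parcs D}. g C U)"
proof -
  let ?V = "pverts D"
  let ?A = "\<lambda>w. {v \<in> ?V. (v, w v) \<in> parcs D}"
  have cov: "cover D S" if "path_cycle_cover D S" for S
    by (rule cover_path_cycle_cover[OF fin arcs that])
  have finS: "finite {S. path_cycle_cover D S}"
    by (rule finite_subset[of _ "Pow (parcs D)"])
      (use fin arcs in \<open>auto simp: path_cycle_cover_def intro: finite_subset\<close>)
  let ?X = "SIGMA S:{S. path_cycle_cover D S}. cover.extensions D S"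
  let ?Y = "SIGMA w:{w. w permutes ?V}. Pow (?A w)"
  have "(\<Sum>S | path_cycle_cover D S. \<Sum>w\<in>cover.extensions D S.
        \<Prod>C\<in>orbits w ?V. g C (C \<inter> cover.tails S))
      = (\<Sum>(S, w)\<in>?X. \<Prod>C\<in>orbits w ?V. g C (C \<inter> cover.tails S))"
    by (rule sum.Sigma) (use finS cov in \<open>auto intro: cover.finite_extensions\<close>)
  also have "\<dots> = (\<Sum>(w, T)\<in>?Y. \<Prod>C\<in>orbits w ?V. g C (C \<inter> T))"
  proof (rule sum.reindex_bij_witness[of _ "\<lambda>(w, T). ((\<lambda>v. (v, w v)) ` T, w)" "\<lambda>(S, w). (w, fst ` S)"])
    fix x assume "x \<in> ?X"
    then obtain S w where x: "x = (S, w)" "path_cycle_cover D S" "w \<in> cover.extensions D S" by blast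
    interpret cover D S by (rule cov[OF x(2)])
    have "S = (\<lambda>v. (v, w v)) ` fst ` S"
      using extensionsD(2,3)[OF x(3)] by (force simp: tails_def image_iff)
    then show "(case (case x of (S, w) \<Rightarrow> (w, fst ` S)) of (w, T) \<Rightarrow> ((\<lambda>v. (v, w v)) ` T, w)) = x"
      using x(1) by simp
    have "fst ` S \<subseteq> ?A w"
      using extensionsD(3)[OF x(3)] x(2) tails_subset by (fastforce simp: tails_def path_cycle_cover_def)
    then show "(case x of (S, w) \<Rightarrow> (w, fst ` S)) \<in> ?Y"
      using x(1) extensionsD(1)[OF x(3)] by simp
    show "(case (case x of (S, w) \<Rightarrow> (w, fst ` S)) of (w, T) \<Rightarrow> \<Prod>C\<in>orbits w ?V. g C (C \<inter> T))
        = (case x of (S, w) \<Rightarrow> \<Prod>C\<in>orbits w ?V. g C (C \<inter> cover.tails S))"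
      using x(1) by (simp add: tails_def)
  next
    fix y assume "y \<in> ?Y"
    then obtain w T where y: "y = (w, T)" "w permutes ?V" "T \<subseteq> ?A w" by blast
    let ?S = "(\<lambda>v. (v, w v)) ` T"
    show "(case (case y of (w, T) \<Rightarrow> ((\<lambda>v. (v, w v)) ` T, w)) of (S, w) \<Rightarrow> (w, fst ` S)) = y"
      using y(1) by (simp add: image_image)
    have S: "path_cycle_cover D ?S"
      using y(3) permutes_inj[OF y(2)] by (auto simp: path_cycle_cover_def inj_on_def dest: injD)
    interpret cover D ?S by (rule cov[OF S])
    have "w \<in> extensions" using y(2) by (auto simp: extensions_def)
    then show "(case y of (w, T) \<Rightarrow> ((\<lambda>v. (v, w v)) ` T, w)) \<in> ?X"
      using y(1) S by simp
  qed
  also have "\<dots> = (\<Sum>w | w permutes ?V. \<Sum>T\<in>Pow (?A w). \<Prod>C\<in>orbits w ?V. g C (C \<inter> T))"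
    by (rule sum.Sigma[symmetric]) (use fin in \<open>auto simp: finite_permutations\<close>)
  also have "\<dots> = (\<Sum>w | w permutes ?V. \<Prod>C\<in>orbits w ?V. \<Sum>U\<in>Pow {v \<in> C. (v, w v) \<in> parcs D}. g C U)"
  proof (rule sum.cong[OF refl])
    fix w assume "w \<in> {w. w permutes ?V}"
    then have w: "w permutes ?V" by simp
    note o = orbits_props[OF w fin]
    have "(\<Sum>T\<in>Pow (?A w). \<Prod>C\<in>orbits w ?V. g C (C \<inter> T))
        = (\<Prod>C\<in>orbits w ?V. \<Sum>U\<in>Pow (C \<inter> ?A w). g C U)"
      by (rule sum_Pow_prod_blocks) (use o in auto)
    also have "\<dots> = (\<Prod>C\<in>orbits w ?V. \<Sum>U\<in>Pow {v \<in> C. (v, w v) \<in> parcs D}. g C U)"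
    proof (rule prod.cong[OF refl])
      fix C assume "C \<in> orbits w ?V"
      then have "C \<inter> ?A w = {v \<in> C. (v, w v) \<in> parcs D}" using o(2) by blast
      then show "(\<Sum>U\<in>Pow (C \<inter> ?A w). g C U) = (\<Sum>U\<in>Pow {v \<in> C. (v, w v) \<in> parcs D}. g C U)"
        by simp
    qed
    finally show "(\<Sum>T\<in>Pow (?A w). \<Prod>C\<in>orbits w ?V. g C (C \<inter> T))
        = (\<Prod>C\<in>orbits w ?V. \<Sum>U\<in>Pow {v \<in> C. (v, w v) \<in> parcs D}. g C U)" .
  qed
  finally show ?thesis .
qed

lemma sum_Pow_sign:
  assumes "finite B"
  shows "(\<Sum>U\<in>Pow B. (-1) ^ card U) = (if B = {} then 1 else 0 :: rat)"
proof -
  have "(\<Prod>x\<in>B. 1 - 1 :: rat) = (\<Sum>U\<in>Pow B. (-1) ^ card U * prod (\<lambda>_. 1) U * prod (\<lambda>_. 1) (B - U))"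
    by (rule prod_diff_conv_sum[OF assms])
  then show ?thesis using assms by (auto simp: power_0_left)
qed

lemma const_sum: "const (\<Sum>i\<in>I. F i) = (\<Sum>i\<in>I. const (F i))"
  by (induction I rule: infinite_finite_induct) (auto simp: const_add)

text \<open>
  The subset \<open>C\<close> itself is exceptional in both factors. Apart from it, both sides are alternating sums over all
  subsets of a set, which vanish unless the set is empty. So the left side is nonzero only for
  \<open>B = C\<close>, where the missing term for \<open>C\<close> leaves \<open>p(x) + p(y)\<close>, and for \<open>B = {}\<close>, where only the sign
  \<open>(-1)\<^bsup>|C| - 1\<^esup>\<close> of \<open>p(x)\<close> remains; on the right side the two cases are interchanged.
\<close>

lemma sum_left_factor_eq_sum_right_factor:
  assumes "finite C" "C \<noteq> {}" "B \<subseteq> C"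
  shows "(\<Sum>U\<in>Pow B. left_factor C U) = (\<Sum>U\<in>Pow (C - B). right_factor C U)"
proof -
  let ?x = "in_x (power_sum (card C))" and ?y = "in_y (power_sum (card C))"
  \<comment> \<open>Both factors have this shape, with the term for \<open>U = C\<close> replaced by \<open>a\<close>.\<close>
  have step: "(\<Sum>U\<in>Pow B. if C \<subseteq> U then a else const ((-1) ^ (k + card U)) * f)
      = (if B = C then a - const ((-1) ^ (k + card C)) * f else 0)
        + (if B = {} then const ((-1) ^ k) * f else 0)"
    if B: "B \<subseteq> C" for B k and a f :: xy_series
  proof -
    have fin: "finite B" using B assms(1) by (rule finite_subset)
    have "(\<Sum>U\<in>Pow B. const ((-1) ^ (k + card U)) * f) = const ((-1) ^ k * (\<Sum>U\<in>Pow B. (-1) ^ card U)) * f"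
      by (simp only: power_add sum_distrib_right[symmetric] const_sum[symmetric] sum_distrib_left[symmetric])
    also have "\<dots> = (if B = {} then const ((-1) ^ k) * f else 0)"
      by (simp add: sum_Pow_sign[OF fin])
    finally have all: "(\<Sum>U\<in>Pow B. const ((-1) ^ (k + card U)) * f) = (if B = {} then const ((-1) ^ k) * f else 0)" .
    show ?thesis
    proof (cases "B = C")
      case True
      let ?h = "\<lambda>U. const ((-1) ^ (k + card U)) * f"
      have mem: "finite (Pow C)" "C \<in> Pow C" using assms(1) by simp_all
      have "(\<Sum>U\<in>Pow C. if C \<subseteq> U then a else ?h U)
          = a + (\<Sum>U\<in>Pow C - {C}. if C \<subseteq> U then a else ?h U)"
        using sum.remove[OF mem, of "\<lambda>U. if C \<subseteq> U then a else ?h U"] by simp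
      also have "(\<Sum>U\<in>Pow C - {C}. if C \<subseteq> U then a else ?h U) = (\<Sum>U\<in>Pow C - {C}. ?h U)"
        by (rule sum.cong) auto
      also have "\<dots> = (\<Sum>U\<in>Pow C. ?h U) - ?h C"
        using sum.remove[OF mem, of ?h] by simp
      finally show ?thesis using all True by simp
    next
      case False
      have "(\<Sum>U\<in>Pow B. if C \<subseteq> U then a else const ((-1) ^ (k + card U)) * f)
          = (\<Sum>U\<in>Pow B. const ((-1) ^ (k + card U)) * f)"
        by (rule sum.cong) (use False B in auto)
      then show ?thesis using all False by simp
    qed
  qed
  obtain k where k: "card C = Suc k" using assms(1,2) by (metis card_gt_0_iff gr0_implies_Suc)
  then have k1: "card C - 1 = k" by simp
  have L: "(\<Sum>U\<in>Pow B. left_factor C U)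
      = (if B = C then ?y - const ((-1) ^ (k + card C)) * ?x else 0) + (if B = {} then const ((-1) ^ k) * ?x else 0)"
    unfolding left_factor_def k1 by (rule step[OF assms(3)])
  have R: "(\<Sum>U\<in>Pow (C - B). right_factor C U)
      = (if C - B = C then const ((-1) ^ card C) * ?y - const ((-1) ^ (0 + card C)) * (?x + ?y) else 0)
        + (if C - B = {} then const ((-1) ^ 0) * (?x + ?y) else 0)"
    using step[OF Diff_subset[of C B], of "const ((-1) ^ card C) * ?y" 0 "?x + ?y"]
    unfolding right_factor_def add_0 .
  have "(-1 :: rat) ^ (k + card C) = -1" by (simp add: k flip: power_add)
  moreover have "C - B = C \<longleftrightarrow> B = {}" "C - B = {} \<longleftrightarrow> B = C" using assms(3) by auto
  ultimately show ?thesis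
    unfolding L R using assms(2) by (auto simp: k const_uminus algebra_simps)
qed

text \<open>
  The sum \<open>R\<close> over the covers of the complement is the common value: \<open>sgn \<mu> f\<^sub>\<mu> = \<omega> m\<^sub>\<mu>\<close> for the
  augmented monomial function \<open>m\<^sub>\<mu>\<close>, so the first form of the right-hand side is \<open>R\<close> up to notation,
  and the second becomes \<open>R\<close> when the substitutions are carried out cover by cover.
\<close>

theorem theorem1:
  fixes D :: "'a pair_pre_digraph"
  assumes "pair_fin_digraph D"
  shows "path_cycle_sf D =
           (\<Sum>S | path_cycle_cover (complement_digraph D) S.
              of_int (sgn_partition (set_partition_type (path_sets (complement_digraph D) S))) *
              forgotten_sf (set_partition_type (path_sets (complement_digraph D) S)) *
              negate_y (in_y (power_sum_sf (set_partition_type (cycle_sets (complement_digraph D) S))))) \<and>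
         path_cycle_sf D = x_to_xy (omega_x (negate_y (path_cycle_sf (complement_digraph D))))"
proof -
  interpret pair_fin_digraph D by (rule assms)
  let ?D' = "complement_digraph D" and ?V = "pverts D"
  have fin: "finite ?V" "finite (pverts ?D')" and verts: "pverts ?D' = ?V"
    by (auto simp: complement_digraph_def)
  have arcs: "parcs D \<subseteq> ?V \<times> ?V" "parcs ?D' \<subseteq> pverts ?D' \<times> pverts ?D'"
    by (auto simp: complement_digraph_def dest: in_arcsD1 in_arcsD2)
  have cov: "cover D S" if "path_cycle_cover D S" for S
    by (rule cover_path_cycle_cover[OF fin(1) arcs(1) that])
  have cov': "cover ?D' S" if "path_cycle_cover ?D' S" for S
    by (rule cover_path_cycle_cover[OF fin(2) arcs(2) that])
  let ?m = "\<lambda>S. aug_monomial_sf (set_partition_type (path_sets ?D' S))"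
  let ?q = "\<lambda>S. power_sum_sf (set_partition_type (cycle_sets ?D' S))"
  define R where "R = (\<Sum>S | path_cycle_cover ?D' S. omega (?m S) * in_y (negate (?q S)))"
  have "path_cycle_sf D = (\<Sum>S | path_cycle_cover D S. \<Sum>w\<in>cover.extensions D S.
      \<Prod>C\<in>orbits w ?V. left_factor C (C \<inter> cover.tails S))"
    unfolding path_cycle_sf_def by (rule sum.cong[OF refl]) (simp add: cover.in_x_in_y_expansion[OF cov])
  also have "\<dots> = (\<Sum>w | w permutes ?V. \<Prod>C\<in>orbits w ?V. \<Sum>U\<in>Pow {v \<in> C. (v, w v) \<in> parcs D}. left_factor C U)"
    by (rule sum_covers_eq_sum_permutations[OF fin(1) arcs(1)])
  also have "\<dots> = (\<Sum>w | w permutes ?V. \<Prod>C\<in>orbits w ?V. \<Sum>U\<in>Pow {v \<in> C. (v, w v) \<in> parcs ?D'}. right_factor C U)"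
  proof (rule sum.cong[OF refl], rule prod.cong[OF refl])
    fix w C assume "w \<in> {w. w permutes ?V}" and C: "C \<in> orbits w ?V"
    then have w: "w permutes ?V" by simp
    have "C - {v \<in> C. (v, w v) \<in> parcs D} = {v \<in> C. (v, w v) \<in> parcs ?D'}"
      using orbits_memD(2,3)[OF w fin(1) C] orbits_memD(2)[OF w fin(1) C]
      by (auto simp: complement_digraph_def)
    then show "(\<Sum>U\<in>Pow {v \<in> C. (v, w v) \<in> parcs D}. left_factor C U)
        = (\<Sum>U\<in>Pow {v \<in> C. (v, w v) \<in> parcs ?D'}. right_factor C U)"
      using sum_left_factor_eq_sum_right_factor[of C "{v \<in> C. (v, w v) \<in> parcs D}"]
        orbits_props(3,4)[OF w fin(1) C] by auto
  qed
  also have "\<dots> = (\<Sum>S | path_cycle_cover ?D' S. \<Sum>w\<in>cover.extensions ?D' S.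
      \<Prod>C\<in>orbits w (pverts ?D'). right_factor C (C \<inter> cover.tails S))"
    using sum_covers_eq_sum_permutations[OF fin(2) arcs(2), of right_factor] unfolding verts by (rule sym)
  also have "\<dots> = R"
    unfolding R_def by (rule sum.cong[OF refl]) (simp add: cover.omega_negate_expansion[OF cov'])
  finally have main: "path_cycle_sf D = R" .
  have sgn: "of_int (sgn_partition \<mu>) * forgotten_sf \<mu> = omega (aug_monomial_sf \<mu>)" for \<mu>
  proof -
    have "sgn_partition \<mu> * sgn_partition \<mu> = 1"
      by (simp add: sgn_partition_def flip: power_add)
    then show ?thesis
      unfolding forgotten_sf_def mult.assoc[symmetric] of_int_mult[symmetric] by simp
  qed
  have "x_to_xy (omega_x (negate_y (path_cycle_sf ?D')))
      = (\<Sum>S | path_cycle_cover ?D' S. rename sum_decode (omega (?m S)) * in_y (negate (?q S)))"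
    unfolding path_cycle_sf_def negate_y_sum negate_y_in_x_mult_in_y
    by (simp add: omega_x_sum aug_monomial_in_symmetric_functions x_to_xy_sum)
  also have "\<dots> = R"
    unfolding R_def by (rule sum.cong[OF refl]) (simp add: cover.rename_omega_aug_monomial[OF cov'])
  finally show ?thesis
    unfolding main sgn negate_y_in_y R_def by simp
qed

end
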